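(* Let $p:\mathcal D\to\mathcal C$ be a functor such that $\mathcal C$ is factorization preordered, let $S,T$ be bifibrational formulas over objects $A,B$ of $\mathcal C$ and $f:A\to B$. Then there is a one-to-one correspondence between arrows $\alpha:S\to T$ in $\mathrm{Bif}(p)$ with $\Lambda_p(\alpha)=f$ and maximally multifocused proofs of $S\Rightarrow_f^{\bot_{\mathsf i}}T$.
   Context: Composition is in diagrammatic order. A category $\mathcal C$ is factorization preordered if for all composable $f$, $g,h$ (parallel), $k$: $fg=fh$ and $gk=hk$ imply $g=h$. Free bifibration. A (cloven) bifibration is a functor $q:\mathcal E\to\mathcal C$ with, for every $f:A\to B$ in $\mathcal C$ and $S$ over $A$, a chosen $f_S:S\to f^+S$ over $f$ such that each $\alpha:S\to T$ over $fg$ factors uniquely as $\alpha=f_S\beta$ with $\beta$ over $g$; and for every $g:B\to C$ and $T$ over $C$, a chosen $\bar g_T:g^-T\to T$ over $g$ such that each $\alpha:S\to T$ over $fg$ factors uniquely as $\alpha=\beta\bar g_T$ with $\beta$ over $f$. Morphisms of bifibrations over $\mathcal C$ are functors over $\mathcal C$ sending chosen liftings to chosen liftings. The free bifibration on $p$ is a bifibration $\Lambda_p:\mathrm{Bif}(p)\to\mathcal C$ with a functor $\eta_p:\mathcal D\to\mathrm{Bif}(p)$, $\Lambda_p\eta_p=p$, such that each $\theta:\mathcal D\to\mathcal E$ with $q\theta=p$ ($q$ a bifibration) extends along $\eta_p$ to a unique morphism of bifibrations. Its objects are the bifibrational formulas: each object $X$ of $\mathcal D$ is an atomic formula over $p(X)$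 (the object $\eta_p X$); if $S$ is over $A$ and $f:A\to B$ then $f^+S$ is over $B$; if $T$ is over $C$ and $g:B\to C$ then $g^-T$ is over $B$. Notation. A formula is positive if its outermost connective is some $f^+$, negative if it is some $g^-$. For a finite sequence $\pi=(f_0,\dots,f_n)$ of composable arrows, $\pi^+S=f_n^+\cdots f_0^+S$ and $\pi^-S=f_0^-\cdots f_n^-S$; for the empty sequence $\epsilon$, $\epsilon^\pm S=S$; inside base arrows $\pi$ denotes the composite (an identity for $\epsilon$). $N,M$ range over non-positive formulas (atomic or negative), $P,Q$ over non-negative formulas (atomic or positive). For arrows with $ab=cd$ write $(a,b)\le(c,d)$ if there is an arrow $e$ with $c=ae$ and $b=ed$. Maximally multifocused proofs derive annotated sequents $S\Rightarrow_h^{q}T$, where $q$ is a pre-inversion state $q_{\mathsf i}\in\{\bot_{\mathsf i},\mathsf L,\mathsf R\}$ or a pre-focus state $q_{\mathsf f}$ of the form $\bot_{\mathsf f}$, $\mathsf L[\pi,f]$ or $\mathsf R[f,\rho]$. They are generated by the rules: - Axiom: for $\delta:X\to Y$ in $\mathcal D$ with $p(\delta)=f$, $X\Rightarrow_f^{q_{\mathsf f}}Y$ for any pre-focus state $q_{\mathsf f}$. - Inversion: from $N\Rightarrow_{\pi f\rho}^{q'}P$ infer $\pi^+N\Rightarrow_f^{q}\rho^-P$, where $q$ is a pre-inversion state, $\pi$ is empty iff the left side of the conclusion is non-positive, $\rho$ is empty iff the right side of the conclusion is non-negative (so $\pi,\rho$ are determined by the conclusion), and $q'=\bot_{\mathsf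 f}$ if $q=\bot_{\mathsf i}$; $q'=\mathsf L[\pi,f]$ if $q=\mathsf L$ (then $\rho=\epsilon$); $q'=\mathsf R[f,\rho]$ if $q=\mathsf R$ (then $\pi=\epsilon$). - Left focus ($\sigma$ non-empty): from $P\Rightarrow_g^{\mathsf L}Q$ infer $\sigma^-P\Rightarrow_{\sigma g}^{q_{\mathsf f}}Q$, provided that if $q_{\mathsf f}=\mathsf R[f,\rho]$ then $(\sigma,g)\not\le(f,\rho)$. - Right focus ($\tau$ non-empty): from $N\Rightarrow_g^{\mathsf R}M$ infer $N\Rightarrow_{g\tau}^{q_{\mathsf f}}\tau^+M$, provided that if $q_{\mathsf f}=\mathsf L[\pi,f]$ then $(\pi,f)\not\le(g,\tau)$. - Bi-focus ($\sigma,\tau$ non-empty): from $P\Rightarrow_g^{\bot_{\mathsf i}}N$ infer $\sigma^-P\Rightarrow_{\sigma g\tau}^{q_{\mathsf f}}\tau^+N$, provided that if $q_{\mathsf f}=\mathsf L[\pi,f]$ then $(\pi,f)\not\le(\sigma g,\tau)$, and if $q_{\mathsf f}=\mathsf R[f,\rho]$ then $(\sigma,g\tau)\not\le(f,\rho)$. *)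

theory Defs
  imports Main "HOL-Library.Equipollence"
begin

section \<open>Categories and functors\<close>

record ('o, 'a) cat =
  Obj :: "'o set"
  Arr :: "'a set"
  Dom :: "'a \<Rightarrow> 'o"
  Cod :: "'a \<Rightarrow> 'o"
  Ident :: "'o \<Rightarrow> 'a"
  Comp :: "'a \<Rightarrow> 'a \<Rightarrow> 'a"  (infixl \<open>\<cdot>\<index>\<close> 70)

text \<open>Composition is in diagrammatic order: \<open>f \<cdot>\<^bsub>C\<^esub> g\<close> is meaningful when
  \<open>Cod C f = Dom C g\<close>. All operations are unconstrained outside the carriers.\<close>

definition hom :: "('o, 'a) cat \<Rightarrow> 'o \<Rightarrow> 'o \<Rightarrow> 'a set" where
  "hom C A B = {f \<in> Arr C. Dom C f = A \<and> Cod C f = B}"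

definition category :: "('o, 'a) cat \<Rightarrow> bool" where
  "category C \<longleftrightarrow>
     (\<forall>f\<in>Arr C. Dom C f \<in> Obj C \<and> Cod C f \<in> Obj C) \<and>
     (\<forall>A\<in>Obj C. Ident C A \<in> hom C A A) \<and>
     (\<forall>f\<in>Arr C. \<forall>g\<in>Arr C. Cod C f = Dom C g \<longrightarrow>
        f \<cdot>\<^bsub>C\<^esub> g \<in> hom C (Dom C f) (Cod C g)) \<and>
     (\<forall>f\<in>Arr C. Ident C (Dom C f) \<cdot>\<^bsub>C\<^esub> f = f \<and> f \<cdot>\<^bsub>C\<^esub> Ident C (Cod C f) = f) \<and>
     (\<forall>f\<in>Arr C. \<forall>g\<in>Arr C. \<forall>h\<in>Arr C. Cod C f = Dom C g \<and> Cod C g = Dom C h \<longrightarrow>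
        (f \<cdot>\<^bsub>C\<^esub> g) \<cdot>\<^bsub>C\<^esub> h = f \<cdot>\<^bsub>C\<^esub> (g \<cdot>\<^bsub>C\<^esub> h))"

definition factorization_preordered :: "('o, 'a) cat \<Rightarrow> bool" where
  "factorization_preordered C \<longleftrightarrow>
     (\<forall>f\<in>Arr C. \<forall>g\<in>Arr C. \<forall>h\<in>Arr C. \<forall>k\<in>Arr C.
        Cod C f = Dom C g \<and> Dom C g = Dom C h \<and> Cod C g = Cod C h \<and> Cod C g = Dom C k \<and>
        f \<cdot>\<^bsub>C\<^esub> g = f \<cdot>\<^bsub>C\<^esub> h \<and> g \<cdot>\<^bsub>C\<^esub> k = h \<cdot>\<^bsub>C\<^esub> k \<longrightarrow> g = h)"

record ('o, 'a, 'x, 'b) fmap =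
  omap :: "'o \<Rightarrow> 'x"
  amap :: "'a \<Rightarrow> 'b"

definition is_functor :: "('o, 'a) cat \<Rightarrow> ('x, 'b) cat \<Rightarrow> ('o, 'a, 'x, 'b) fmap \<Rightarrow> bool" where
  "is_functor D C F \<longleftrightarrow>
     (\<forall>X\<in>Obj D. omap F X \<in> Obj C) \<and>
     (\<forall>a\<in>Arr D. amap F a \<in> hom C (omap F (Dom D a)) (omap F (Cod D a))) \<and>
     (\<forall>X\<in>Obj D. amap F (Ident D X) = Ident C (omap F X)) \<and>
     (\<forall>a\<in>Arr D. \<forall>b\<in>Arr D. Cod D a = Dom D b \<longrightarrow>
        amap F (a \<cdot>\<^bsub>D\<^esub> b) = amap F a \<cdot>\<^bsub>C\<^esub> amap F b)"

definition fmap_comp ::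
    "('o, 'a, 'x, 'b) fmap \<Rightarrow> ('x, 'b, 'y, 'c) fmap \<Rightarrow> ('o, 'a, 'y, 'c) fmap" where
  "fmap_comp F G = \<lparr>omap = omap G \<circ> omap F, amap = amap G \<circ> amap F\<rparr>"

text \<open>Equality of functors out of \<open>D\<close>: only the values on the carriers of \<open>D\<close> matter.\<close>

definition functor_eq ::
    "('o, 'a) cat \<Rightarrow> ('o, 'a, 'x, 'b) fmap \<Rightarrow> ('o, 'a, 'x, 'b) fmap \<Rightarrow> bool" where
  "functor_eq D F G \<longleftrightarrow>
     (\<forall>X\<in>Obj D. omap F X = omap G X) \<and> (\<forall>a\<in>Arr D. amap F a = amap G a)"


section \<open>Cloven bifibrations and the free bifibration\<close>

text \<open>\<open>Push E f S\<close> is the chosen lifting \<open>f\<^sub>S : S \<rightarrow> f\<^sup>+ S\<close> and \<open>Pull E g T\<close> the chosen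
  lifting of \<open>g\<close> with target \<open>T\<close>; the objects \<open>f\<^sup>+ S\<close> and \<open>g\<^sup>- T\<close> are recovered as the
  codomain, respectively domain, of these arrows.\<close>

record ('eo, 'ea, 'co, 'ca) bifib =
  Tot :: "('eo, 'ea) cat"
  Proj :: "('eo, 'ea, 'co, 'ca) fmap"
  Push :: "'ca \<Rightarrow> 'eo \<Rightarrow> 'ea"
  Pull :: "'ca \<Rightarrow> 'eo \<Rightarrow> 'ea"

definition push_obj :: "('eo, 'ea, 'co, 'ca) bifib \<Rightarrow> 'ca \<Rightarrow> 'eo \<Rightarrow> 'eo" where
  "push_obj E f S = Cod (Tot E) (Push E f S)"

definition pull_obj :: "('eo, 'ea, 'co, 'ca) bifib \<Rightarrow> 'ca \<Rightarrow> 'eo \<Rightarrow> 'eo" where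
  "pull_obj E g T = Dom (Tot E) (Pull E g T)"

definition bifibration :: "('co, 'ca) cat \<Rightarrow> ('eo, 'ea, 'co, 'ca) bifib \<Rightarrow> bool" where
  "bifibration C E \<longleftrightarrow>
     category (Tot E) \<and> is_functor (Tot E) C (Proj E) \<and>
     (\<forall>f\<in>Arr C. \<forall>S\<in>Obj (Tot E). omap (Proj E) S = Dom C f \<longrightarrow>
        Push E f S \<in> hom (Tot E) S (push_obj E f S) \<and> amap (Proj E) (Push E f S) = f \<and>
        (\<forall>g\<in>Arr C. \<forall>T\<in>Obj (Tot E). \<forall>\<alpha>\<in>hom (Tot E) S T.
           Dom C g = Cod C f \<and> amap (Proj E) \<alpha> = f \<cdot>\<^bsub>C\<^esub> g \<longrightarrow>
           (\<exists>!\<beta>. \<beta> \<in> hom (Tot E) (push_obj E f S) T \<and> amap (Proj E) \<beta> = g \<and>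
                 \<alpha> = Push E f S \<cdot>\<^bsub>Tot E\<^esub> \<beta>))) \<and>
     (\<forall>g\<in>Arr C. \<forall>T\<in>Obj (Tot E). omap (Proj E) T = Cod C g \<longrightarrow>
        Pull E g T \<in> hom (Tot E) (pull_obj E g T) T \<and> amap (Proj E) (Pull E g T) = g \<and>
        (\<forall>f\<in>Arr C. \<forall>S\<in>Obj (Tot E). \<forall>\<alpha>\<in>hom (Tot E) S T.
           Cod C f = Dom C g \<and> amap (Proj E) \<alpha> = f \<cdot>\<^bsub>C\<^esub> g \<longrightarrow>
           (\<exists>!\<beta>. \<beta> \<in> hom (Tot E) S (pull_obj E g T) \<and> amap (Proj E) \<beta> = f \<and>
                 \<alpha> = \<beta> \<cdot>\<^bsub>Tot E\<^esub> Pull E g T)))"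

definition bifib_morphism :: "('co, 'ca) cat \<Rightarrow> ('eo, 'ea, 'co, 'ca) bifib \<Rightarrow>
    ('fo, 'fa, 'co, 'ca) bifib \<Rightarrow> ('eo, 'ea, 'fo, 'fa) fmap \<Rightarrow> bool" where
  "bifib_morphism C E E' F \<longleftrightarrow>
     is_functor (Tot E) (Tot E') F \<and>
     functor_eq (Tot E) (fmap_comp F (Proj E')) (Proj E) \<and>
     (\<forall>f\<in>Arr C. \<forall>S\<in>Obj (Tot E). omap (Proj E) S = Dom C f \<longrightarrow>
        amap F (Push E f S) = Push E' f (omap F S)) \<and>
     (\<forall>g\<in>Arr C. \<forall>T\<in>Obj (Tot E). omap (Proj E) T = Cod C g \<longrightarrow>
        amap F (Pull E g T) = Pull E' g (omap F T))"

text \<open>\<open>E\<close>, with unit \<open>\<eta>\<close>, is the free bifibration on \<open>p : D \<rightarrow> C\<close>. HOL cannot quantify over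
  types, so the bifibrations \<open>Q\<close> tested in the universal property have their objects and arrows
  in the types used by \<open>E\<close> itself; these types play the role of the universe of small sets and
  must be large enough compared with \<open>C\<close> and \<open>D\<close> whenever the predicate is used.\<close>

definition free_bifibration :: "('co, 'ca) cat \<Rightarrow> ('do, 'da) cat \<Rightarrow> ('do, 'da, 'co, 'ca) fmap \<Rightarrow>
    ('eo, 'ea, 'co, 'ca) bifib \<Rightarrow> ('do, 'da, 'eo, 'ea) fmap \<Rightarrow> bool" where
  "free_bifibration C D p E \<eta> \<longleftrightarrow>
     bifibration C E \<and> is_functor D (Tot E) \<eta> \<and> functor_eq D (fmap_comp \<eta> (Proj E)) p \<and>
     (\<forall>(Q :: ('eo, 'ea, 'co, 'ca) bifib) \<theta>.
        bifibration C Q \<and> is_functor D (Tot Q) \<theta> \<and> functor_eq D (fmap_comp \<theta> (Proj Q)) p \<longrightarrow>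
        (\<exists>F. bifib_morphism C E Q F \<and> functor_eq D (fmap_comp \<eta> F) \<theta> \<and>
             (\<forall>G. bifib_morphism C E Q G \<and> functor_eq D (fmap_comp \<eta> G) \<theta> \<longrightarrow>
                  functor_eq (Tot E) G F)))"


section \<open>Bifibrational formulas\<close>

text \<open>\<open>Pos f S\<close> is \<open>f\<^sup>+ S\<close> and \<open>Neg g T\<close> is \<open>g\<^sup>- T\<close>.\<close>

datatype ('do, 'ca) formula =
    Atom 'do
  | is_pos: Pos 'ca "('do, 'ca) formula"
  | is_neg: Neg 'ca "('do, 'ca) formula"

inductive formula_over :: "('co, 'ca) cat \<Rightarrow> ('do, 'da) cat \<Rightarrow> ('do, 'da, 'co, 'ca) fmap \<Rightarrow>
    ('do, 'ca) formula \<Rightarrow> 'co \<Rightarrow> bool"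
  for C D p where
    "X \<in> Obj D \<Longrightarrow> formula_over C D p (Atom X) (omap p X)"
  | "formula_over C D p S A \<Longrightarrow> f \<in> hom C A B \<Longrightarrow> formula_over C D p (Pos f S) B"
  | "formula_over C D p T B' \<Longrightarrow> g \<in> hom C B B' \<Longrightarrow> formula_over C D p (Neg g T) B"

text \<open>The object of a bifibration under \<open>D\<close> denoted by a formula.\<close>

primrec formula_obj :: "('eo, 'ea, 'co, 'ca) bifib \<Rightarrow> ('do, 'da, 'eo, 'ea) fmap \<Rightarrow>
    ('do, 'ca) formula \<Rightarrow> 'eo" where
  "formula_obj E \<eta> (Atom X) = omap \<eta> X"
| "formula_obj E \<eta> (Pos f S) = push_obj E f (formula_obj E \<eta> S)"
| "formula_obj E \<eta> (Neg g T) = pull_obj E g (formula_obj E \<eta> T)"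

text \<open>For \<open>\<pi> = [f\<^sub>0, \<dots>, f\<^sub>n]\<close>: \<open>pos_seq \<pi> S = f\<^sub>n\<^sup>+ \<dots> f\<^sub>0\<^sup>+ S\<close> and
  \<open>neg_seq \<pi> S = f\<^sub>0\<^sup>- \<dots> f\<^sub>n\<^sup>- S\<close>.\<close>

primrec pos_seq :: "'ca list \<Rightarrow> ('do, 'ca) formula \<Rightarrow> ('do, 'ca) formula" where
  "pos_seq [] S = S"
| "pos_seq (f # \<pi>) S = pos_seq \<pi> (Pos f S)"

primrec neg_seq :: "'ca list \<Rightarrow> ('do, 'ca) formula \<Rightarrow> ('do, 'ca) formula" where
  "neg_seq [] S = S"
| "neg_seq (f # \<pi>) S = Neg f (neg_seq \<pi> S)"

text \<open>Composite of a sequence of composable arrows; the object \<open>A\<close> is used only to say which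
  identity the empty sequence stands for.\<close>

fun seq_comp :: "('co, 'ca) cat \<Rightarrow> 'co \<Rightarrow> 'ca list \<Rightarrow> 'ca" where
  "seq_comp C A [] = Ident C A"
| "seq_comp C A [f] = f"
| "seq_comp C A (f # g # \<pi>) = f \<cdot>\<^bsub>C\<^esub> seq_comp C A (g # \<pi>)"


section \<open>Maximally multifocused proofs\<close>

definition fact_le :: "('co, 'ca) cat \<Rightarrow> 'ca \<times> 'ca \<Rightarrow> 'ca \<times> 'ca \<Rightarrow> bool" where
  "fact_le C = (\<lambda>(a, b) (c, d).
     \<exists>e\<in>hom C (Cod C a) (Dom C d). c = a \<cdot>\<^bsub>C\<^esub> e \<and> b = e \<cdot>\<^bsub>C\<^esub> d)"

datatype inv_state = IBot | IL | IR

datatype 'ca foc_state = FBot | FL "'ca list" 'ca | FR 'ca "'ca list"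

fun next_state :: "inv_state \<Rightarrow> 'ca list \<Rightarrow> 'ca \<Rightarrow> 'ca list \<Rightarrow> 'ca foc_state" where
  "next_state IBot \<pi> f \<rho> = FBot"
| "next_state IL \<pi> f \<rho> = FL \<pi> f"
| "next_state IR \<pi> f \<rho> = FR f \<rho>"

text \<open>Proof trees. Each node records the parameters of its rule instance, including the base
  arrow \<open>g\<close> of the premise of a focus rule (which the conclusion does not determine), so that a
  tree together with its end sequent determines all sequents occurring in the proof.\<close>

datatype ('da, 'ca) mproof =
    Axiom 'da
  | Inversion "'ca list" "'ca list" "('da, 'ca) mproof"
  | LeftFocus "'ca list" 'ca "('da, 'ca) mproof"
  | RightFocus 'ca "'ca list" "('da, 'ca) mproof"
  | BiFocus "'ca list" 'ca "'ca list" "('da, 'ca) mproof"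

text \<open>\<open>inv_proof C D p d S f q T\<close> (resp. \<open>foc_proof\<close>): the tree \<open>d\<close> is a maximally multifocused
  proof of \<open>S \<Rightarrow>\<^sub>f T\<close> annotated with the pre-inversion (resp. pre-focus) state \<open>q\<close>. In the
  inversion rule, the polarity conditions on \<open>N\<close> and \<open>P\<close> make \<open>\<pi>\<close> and \<open>\<rho>\<close> maximal, so that
  \<open>\<pi>\<close> (resp. \<open>\<rho>\<close>) is empty iff the left (right) side of the conclusion is non-positive
  (non-negative).\<close>

inductive
  inv_proof :: "('co, 'ca) cat \<Rightarrow> ('do, 'da) cat \<Rightarrow> ('do, 'da, 'co, 'ca) fmap \<Rightarrow>
    ('da, 'ca) mproof \<Rightarrow> ('do, 'ca) formula \<Rightarrow> 'ca \<Rightarrow> inv_state \<Rightarrow> ('do, 'ca) formula \<Rightarrow> bool" and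
  foc_proof :: "('co, 'ca) cat \<Rightarrow> ('do, 'da) cat \<Rightarrow> ('do, 'da, 'co, 'ca) fmap \<Rightarrow>
    ('da, 'ca) mproof \<Rightarrow> ('do, 'ca) formula \<Rightarrow> 'ca \<Rightarrow> 'ca foc_state \<Rightarrow> ('do, 'ca) formula \<Rightarrow> bool"
  for C D p where
  axiom:
    "\<lbrakk>\<delta> \<in> hom D X Y; amap p \<delta> = f\<rbrakk>
     \<Longrightarrow> foc_proof C D p (Axiom \<delta>) (Atom X) f q (Atom Y)"
| inversion:
    "\<lbrakk>foc_proof C D p d N (seq_comp C (Dom C f) \<pi> \<cdot>\<^bsub>C\<^esub> f \<cdot>\<^bsub>C\<^esub> seq_comp C (Cod C f) \<rho>)
        (next_state q \<pi> f \<rho>) P;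
      \<not> is_pos N; \<not> is_neg P;
      q = IL \<longrightarrow> \<rho> = []; q = IR \<longrightarrow> \<pi> = [];
      f \<in> hom C A B; formula_over C D p (pos_seq \<pi> N) A; formula_over C D p (neg_seq \<rho> P) B\<rbrakk>
     \<Longrightarrow> inv_proof C D p (Inversion \<pi> \<rho> d) (pos_seq \<pi> N) f q (neg_seq \<rho> P)"
| left_focus:
    "\<lbrakk>inv_proof C D p d P g IL Q;
      \<not> is_neg P; \<not> is_neg Q; \<sigma> \<noteq> [];
      formula_over C D p (neg_seq \<sigma> P) A;
      \<And>f \<rho>. q = FR f \<rho> \<Longrightarrow>
        \<not> fact_le C (seq_comp C (Dom C g) \<sigma>, g) (f, seq_comp C (Cod C f) \<rho>)\<rbrakk>
     \<Longrightarrow> foc_proof C D p (LeftFocus \<sigma> g d)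
          (neg_seq \<sigma> P) (seq_comp C (Dom C g) \<sigma> \<cdot>\<^bsub>C\<^esub> g) q Q"
| right_focus:
    "\<lbrakk>inv_proof C D p d N g IR M;
      \<not> is_pos N; \<not> is_pos M; \<tau> \<noteq> [];
      formula_over C D p (pos_seq \<tau> M) B;
      \<And>\<pi> f. q = FL \<pi> f \<Longrightarrow>
        \<not> fact_le C (seq_comp C (Dom C f) \<pi>, f) (g, seq_comp C (Cod C g) \<tau>)\<rbrakk>
     \<Longrightarrow> foc_proof C D p (RightFocus g \<tau> d)
          N (g \<cdot>\<^bsub>C\<^esub> seq_comp C (Cod C g) \<tau>) q (pos_seq \<tau> M)"
| bi_focus:
    "\<lbrakk>inv_proof C D p d P g IBot N;
      \<not> is_neg P; \<not> is_pos N; \<sigma> \<noteq> []; \<tau> \<noteq> [];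
      formula_over C D p (neg_seq \<sigma> P) A; formula_over C D p (pos_seq \<tau> N) B;
      \<And>\<pi> f. q = FL \<pi> f \<Longrightarrow>
        \<not> fact_le C (seq_comp C (Dom C f) \<pi>, f)
            (seq_comp C (Dom C g) \<sigma> \<cdot>\<^bsub>C\<^esub> g, seq_comp C (Cod C g) \<tau>);
      \<And>f \<rho>. q = FR f \<rho> \<Longrightarrow>
        \<not> fact_le C (seq_comp C (Dom C g) \<sigma>, g \<cdot>\<^bsub>C\<^esub> seq_comp C (Cod C g) \<tau>)
            (f, seq_comp C (Cod C f) \<rho>)\<rbrakk>
     \<Longrightarrow> foc_proof C D p (BiFocus \<sigma> g \<tau> d)
          (neg_seq \<sigma> P) (seq_comp C (Dom C g) \<sigma> \<cdot>\<^bsub>C\<^esub> g \<cdot>\<^bsub>C\<^esub> seq_comp C (Cod C g) \<tau>) q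
          (pos_seq \<tau> N)"

end

theory Submission imports Defs begin

text \<open>Every arrow \<open>R \<rightarrow> T\<close> of the free bifibration over \<open>k\<close> has a normal form. As both inversions are
  bijections on arrows, they need not be recorded, and a normal form is a sequence of left rules
  (\<open>NL\<close>) and right rules (\<open>PR\<close>) around an arrow of \<open>D\<close>, where a left rule is performed before a
  right rule whenever the two can be exchanged. The normal forms of arrows \<open>g\<^sup>- S \<rightarrow> h\<^sup>+ T\<close> are the
  pushout of those of \<open>S \<rightarrow> h\<^sup>+ T\<close> and \<open>g\<^sup>- S \<rightarrow> T\<close> under those of \<open>S \<rightarrow> T\<close>, and since \<open>C\<close> is
  factorization preordered both legs are injective.

  That different normal forms denote different arrows is shown without cut elimination. The sets of
  normal forms with target \<open>S\<close>, with the operations that introduce connectives on the left, are the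
  objects of a bifibration whose arrows are the arrows of \<open>Bif\<close> paired with a compatible natural
  family of maps of normal forms. The universal property maps \<open>Bif\<close> into it, over \<open>Bif\<close>, so each
  arrow \<open>S \<rightarrow> T\<close> acts on normal forms; its action on the normal form of the identity of \<open>S\<close> is its
  own normal form.

  The pushout property passes from single rules to blocks: an arrow \<open>\<sigma>\<^sup>- P \<rightarrow> \<tau>\<^sup>+ M\<close> ends with a left
  focus on the whole of \<open>\<sigma>\<close>, with a right focus on the whole of \<open>\<tau>\<close>, or with both, and then
  with a bi-focus. The pre-focus states exclude exactly the redundant choices, so that maximally
  multifocused proofs correspond to normal forms.\<close>

section \<open>Smallness of generated sets\<close>

text \<open>Two obstacles shape the construction. First, \<open>free_bifibration\<close> tests only
  bifibrations on the type \<open>'u\<close>, whereas families of maps of normal forms live in a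
  function type that need not fit into it. The universal property is therefore extended to arbitrary
  types: the part generated by the image of D suffices, and an infinite \<open>'u\<close> bounding
  the arrows of C and D also bounds that part.

  Second, exchanging a left and a right rule needs the base arrow e of the common premise S -> T,
  but a left rule stores it only after inversion of T, as \<open>ext T e\<close>. From g, the
  composite g e and \<open>ext T e\<close>, cancellation on both sides recovers e. This is where the
  factorization preorder enters, and again where right rules are cancelled under inverted positive
  connectives.

  Such an e also explains the side conditions of the focus rules. Above a left focus and the
  inversion of \<pi>, let a right focus have arrow g and block \<tau>. Then (\<pi>, f) \<le> (g,
  \<tau>) holds iff it could be performed below that inversion, with a premise over e. It would then
  be adjacent to the left focus and merge with it into a bi-focus.\<close>

inductive_set binary_closure :: "'a set \<Rightarrow> ('a \<Rightarrow> 'a \<Rightarrow> 'a) set \<Rightarrow> 'a set" for A K where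
  base: "a \<in> A \<Longrightarrow> a \<in> binary_closure A K"
| step: "\<lbrakk>k \<in> K; a \<in> binary_closure A K; b \<in> binary_closure A K\<rbrakk> \<Longrightarrow> k a b \<in> binary_closure A K"

lemma lepoll_iff_ordLeq: "A \<lesssim> B \<longleftrightarrow> (card_of A, card_of B) \<in> ordLeq"
  by (simp add: card_of_ordLeq[symmetric] lepoll_def)

lemma Times_lepoll_infinite:
  assumes "infinite U" "A \<lesssim> U" "B \<lesssim> U"
  shows "A \<times> B \<lesssim> U"
  using assms card_of_Sigma_ordLeq_infinite[of U A "\<lambda>_. B"] by (simp add: lepoll_iff_ordLeq)

lemma UN_lepoll_infinite:
  assumes "infinite U" "I \<lesssim> U" "\<And>i. i \<in> I \<Longrightarrow> A i \<lesssim> U"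
  shows "(\<Union>i\<in>I. A i) \<lesssim> U"
  using assms card_of_UNION_ordLeq_infinite[of U I A] by (simp add: lepoll_iff_ordLeq)

lemma Un_lepoll_infinite:
  assumes "infinite U" "A \<lesssim> U" "B \<lesssim> U"
  shows "A \<union> B \<lesssim> U"
proof -
  have "(UNIV :: bool set) \<lesssim> U"
    by (intro finite_lepoll_infinite assms(1)) simp
  then have "(\<Union>b\<in>UNIV. if b then A else B) \<lesssim> U"
    using assms by (intro UN_lepoll_infinite) auto
  moreover have "(\<Union>b\<in>UNIV. if b then A else B) = A \<union> B"
    by (auto split: if_splits)
  ultimately show ?thesis by simp
qed

lemma image_lepoll_trans: "A \<lesssim> U \<Longrightarrow> f ` A \<lesssim> U"
  using image_lepoll lepoll_trans by blast

lemma subset_lepoll_trans: "B \<lesssim> U \<Longrightarrow> A \<subseteq> B \<Longrightarrow> A \<lesssim> U"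
  using subset_imp_lepoll lepoll_trans by blast

text \<open>An infinite set absorbs pairs and countable unions, so countably many small stages stay
  small. Only binary operations are closed under; unary ones are represented by ignoring one
  argument.\<close>

lemma binary_closure_lepoll:
  assumes U: "infinite U" and A: "A \<lesssim> U" and K: "K \<lesssim> U"
  shows "binary_closure A K \<lesssim> U"
proof -
  \<comment> \<open>\<open>L n\<close> collects the elements generated in at most n rounds.\<close>
  define L where "L = rec_nat A (\<lambda>_ B. B \<union> (\<lambda>(k, a, b). k a b) ` (K \<times> B \<times> B))"
  have L0: "L 0 = A" and LS: "\<And>n. L (Suc n) = L n \<union> (\<lambda>(k, a, b). k a b) ` (K \<times> L n \<times> L n)"
    by (simp_all add: L_def)
  have small: "L n \<lesssim> U" for n
    by (induction n) (simp_all add: L0 LS A U K Un_lepoll_infinite image_lepoll_trans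
        Times_lepoll_infinite)
  have mono: "L n \<subseteq> L m" if "n \<le> m" for n m
    using that by (induction rule: dec_induct) (auto simp: LS)
  have "a \<in> (\<Union>n. L n)" if "a \<in> binary_closure A K" for a
    using that
  proof induction
    case (base a)
    then show ?case using L0 by blast
  next
    case (step k a b)
    then obtain n m where "a \<in> L n" "b \<in> L m" by blast
    then have "a \<in> L (max n m)" "b \<in> L (max n m)"
      using mono[of n "max n m"] mono[of m "max n m"] by auto
    then have "k a b \<in> L (Suc (max n m))"
      using step(1) by (force simp: LS)
    then show ?case by blast
  qed
  then have "binary_closure A K \<subseteq> (\<Union>n. L n)" by blast
  moreover have "(\<Union>n. L n) \<lesssim> U"
    using U small infinite_le_lepoll[of U] by (intro UN_lepoll_infinite) auto
  ultimately show ?thesis using subset_lepoll_trans by blast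
qed

section \<open>Functors and bifibrations\<close>

locale cat =
  fixes C :: "('co, 'ca) cat" (structure)
  assumes cat: "category C"
begin

lemma Dom_Obj [simp]: "f \<in> Arr C \<Longrightarrow> Dom C f \<in> Obj C"
  and Cod_Obj [simp]: "f \<in> Arr C \<Longrightarrow> Cod C f \<in> Obj C"
  using cat by (auto simp: category_def)

lemma Ident_simps [simp]:
  assumes "A \<in> Obj C"
  shows "Ident C A \<in> Arr C" "Dom C (Ident C A) = A" "Cod C (Ident C A) = A"
  using cat assms by (auto simp: category_def hom_def)

lemma Comp_simps [simp]:
  assumes "f \<in> Arr C" "g \<in> Arr C" "Cod C f = Dom C g"
  shows "f \<cdot> g \<in> Arr C" "Dom C (f \<cdot> g) = Dom C f" "Cod C (f \<cdot> g) = Cod C g"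
proof -
  have "f \<cdot> g \<in> hom C (Dom C f) (Cod C g)" using cat assms by (simp add: category_def)
  then show "f \<cdot> g \<in> Arr C" "Dom C (f \<cdot> g) = Dom C f" "Cod C (f \<cdot> g) = Cod C g"
    by (simp_all add: hom_def)
qed

lemma Ident_left [simp]: "f \<in> Arr C \<Longrightarrow> A = Dom C f \<Longrightarrow> Ident C A \<cdot> f = f"
  and Ident_right [simp]: "f \<in> Arr C \<Longrightarrow> A = Cod C f \<Longrightarrow> f \<cdot> Ident C A = f"
  using cat by (auto simp: category_def)

lemma assoc:
  assumes "f \<in> Arr C" "g \<in> Arr C" "h \<in> Arr C" "Cod C f = Dom C g" "Cod C g = Dom C h"
  shows "(f \<cdot> g) \<cdot> h = f \<cdot> (g \<cdot> h)"
  using cat assms by (simp add: category_def)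

end

lemma functor_simps:
  assumes "is_functor D C F"
  shows "X \<in> Obj D \<Longrightarrow> omap F X \<in> Obj C"
    and "a \<in> Arr D \<Longrightarrow> amap F a \<in> Arr C"
    and "a \<in> Arr D \<Longrightarrow> Dom C (amap F a) = omap F (Dom D a)"
    and "a \<in> Arr D \<Longrightarrow> Cod C (amap F a) = omap F (Cod D a)"
    and "X \<in> Obj D \<Longrightarrow> amap F (Ident D X) = Ident C (omap F X)"
    and "a \<in> Arr D \<Longrightarrow> b \<in> Arr D \<Longrightarrow> Cod D a = Dom D b
      \<Longrightarrow> amap F (a \<cdot>\<^bsub>D\<^esub> b) = amap F a \<cdot>\<^bsub>C\<^esub> amap F b"
  using assms by (simp_all add: is_functor_def hom_def)

locale bifib = base: cat C for C :: "('co, 'ca) cat" +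
  fixes E :: "('eo, 'ea, 'co, 'ca) bifib"
  assumes bif: "bifibration C E"
begin

abbreviation "ArrE \<equiv> Arr (Tot E)"
abbreviation "ObjE \<equiv> Obj (Tot E)"
abbreviation "DomE \<equiv> Dom (Tot E)"
abbreviation "CodE \<equiv> Cod (Tot E)"
abbreviation "po \<equiv> omap (Proj E)"
abbreviation "pa \<equiv> amap (Proj E)"
abbreviation CompE (infixl \<open>\<star>\<close> 70) where "CompE a b \<equiv> a \<cdot>\<^bsub>Tot E\<^esub> b"

sublocale tot: cat "Tot E"
  using bif by unfold_locales (simp add: bifibration_def)

lemma proj_functor: "is_functor (Tot E) C (Proj E)"
  using bif by (simp add: bifibration_def)

lemmas proj_simps [simp] = functor_simps[OF proj_functor]

lemma Push_simps [simp]: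
  assumes "f \<in> Arr C" "X \<in> ObjE" "po X = Dom C f"
  shows "Push E f X \<in> ArrE" "DomE (Push E f X) = X" "CodE (Push E f X) = push_obj E f X"
    "pa (Push E f X) = f"
  using bif assms by (auto simp: bifibration_def hom_def)

lemma Pull_simps [simp]:
  assumes "g \<in> Arr C" "Y \<in> ObjE" "po Y = Cod C g"
  shows "Pull E g Y \<in> ArrE" "DomE (Pull E g Y) = pull_obj E g Y" "CodE (Pull E g Y) = Y"
    "pa (Pull E g Y) = g"
  using bif assms by (auto simp: bifibration_def hom_def)

lemma push_obj_simps [simp]:
  assumes "f \<in> Arr C" "X \<in> ObjE" "po X = Dom C f"
  shows "push_obj E f X \<in> ObjE" "po (push_obj E f X) = Cod C f"
  using tot.Cod_Obj[of "Push E f X"] proj_simps(4)[of "Push E f X"]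
  by (simp_all only: Push_simps[OF assms])

lemma pull_obj_simps [simp]:
  assumes "g \<in> Arr C" "Y \<in> ObjE" "po Y = Cod C g"
  shows "pull_obj E g Y \<in> ObjE" "po (pull_obj E g Y) = Dom C g"
  using tot.Dom_Obj[of "Pull E g Y"] proj_simps(3)[of "Pull E g Y"]
  by (simp_all only: Pull_simps[OF assms])

lemma push_ex1:
  assumes "f \<in> Arr C" "X \<in> ObjE" "po X = Dom C f" "g \<in> Arr C" "Dom C g = Cod C f"
    "a \<in> ArrE" "DomE a = X" "pa a = f \<cdot>\<^bsub>C\<^esub> g"
  shows "\<exists>!b. b \<in> hom (Tot E) (push_obj E f X) (CodE a) \<and> pa b = g \<and> a = Push E f X \<star> b"
proof -
  have "a \<in> hom (Tot E) X (CodE a)" "CodE a \<in> ObjE" using assms by (simp_all add: hom_def)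
  then show ?thesis using bif assms unfolding bifibration_def by blast
qed

lemma pull_ex1:
  assumes "g \<in> Arr C" "Y \<in> ObjE" "po Y = Cod C g" "f \<in> Arr C" "Cod C f = Dom C g"
    "a \<in> ArrE" "CodE a = Y" "pa a = f \<cdot>\<^bsub>C\<^esub> g"
  shows "\<exists>!b. b \<in> hom (Tot E) (DomE a) (pull_obj E g Y) \<and> pa b = f \<and> a = b \<star> Pull E g Y"
proof -
  have "a \<in> hom (Tot E) (DomE a) Y" "DomE a \<in> ObjE" using assms by (simp_all add: hom_def)
  then show ?thesis using bif assms unfolding bifibration_def by blast
qed

lemma push_factor:
  assumes "f \<in> Arr C" "X \<in> ObjE" "po X = Dom C f" "g \<in> Arr C" "Dom C g = Cod C f"
    "a \<in> ArrE" "DomE a = X" "pa a = f \<cdot>\<^bsub>C\<^esub> g"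
  obtains b where "b \<in> ArrE" "DomE b = push_obj E f X" "CodE b = CodE a" "pa b = g"
    "Push E f X \<star> b = a"
  using push_ex1[OF assms] by (auto simp: hom_def)

lemma pull_factor:
  assumes "g \<in> Arr C" "Y \<in> ObjE" "po Y = Cod C g" "f \<in> Arr C" "Cod C f = Dom C g"
    "a \<in> ArrE" "CodE a = Y" "pa a = f \<cdot>\<^bsub>C\<^esub> g"
  obtains b where "b \<in> ArrE" "DomE b = DomE a" "CodE b = pull_obj E g Y" "pa b = f"
    "b \<star> Pull E g Y = a"
  using pull_ex1[OF assms] by (auto simp: hom_def)

lemma push_cancel:
  assumes X: "f \<in> Arr C" "X \<in> ObjE" "po X = Dom C f"
    and b: "b \<in> ArrE" "DomE b = push_obj E f X" and c: "c \<in> ArrE" "DomE c = push_obj E f X"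
    and cod: "CodE b = CodE c" and pa: "pa b = pa c" and eq: "Push E f X \<star> b = Push E f X \<star> c"
  shows "b = c"
proof -
  let ?P = "\<lambda>d. d \<in> hom (Tot E) (push_obj E f X) (CodE (Push E f X \<star> b)) \<and> pa d = pa b
      \<and> Push E f X \<star> b = Push E f X \<star> d"
  have "\<exists>!d. ?P d"
    using X b proj_simps(3)[OF b(1)] by (intro push_ex1) simp_all
  moreover have "?P b"
    using X b by (simp add: hom_def)
  moreover have "?P c"
    unfolding pa[symmetric] eq[symmetric] using X b c cod[symmetric] by (simp add: hom_def)
  ultimately show ?thesis by blast
qed

lemma pull_cancel:
  assumes Y: "g \<in> Arr C" "Y \<in> ObjE" "po Y = Cod C g"
    and b: "b \<in> ArrE" "CodE b = pull_obj E g Y" and c: "c \<in> ArrE" "CodE c = pull_obj E g Y"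
    and dom: "DomE b = DomE c" and pa: "pa b = pa c" and eq: "b \<star> Pull E g Y = c \<star> Pull E g Y"
  shows "b = c"
proof -
  let ?P = "\<lambda>d. d \<in> hom (Tot E) (DomE (b \<star> Pull E g Y)) (pull_obj E g Y) \<and> pa d = pa b
      \<and> b \<star> Pull E g Y = d \<star> Pull E g Y"
  have "\<exists>!d. ?P d"
    using Y b proj_simps(4)[OF b(1)] by (intro pull_ex1) simp_all
  moreover have "?P b"
    using Y b by (simp add: hom_def)
  moreover have "?P c"
    unfolding pa[symmetric] eq[symmetric] using Y b c dom[symmetric] by (simp add: hom_def)
  ultimately show ?thesis by blast
qed

end

text \<open>Unique factorization is split into existence and cancellation, because in the
  bifibrations built below the two have different sources: existence needs a construction,
  cancellation is inherited.\<close>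

lemma bifibrationI:
  assumes cat: "category (Tot E)" and proj: "is_functor (Tot E) C (Proj E)"
    and push: "\<And>f X. \<lbrakk>f \<in> Arr C; X \<in> Obj (Tot E); omap (Proj E) X = Dom C f\<rbrakk> \<Longrightarrow>
      Push E f X \<in> Arr (Tot E) \<and> Dom (Tot E) (Push E f X) = X \<and> amap (Proj E) (Push E f X) = f"
    and pull: "\<And>g Y. \<lbrakk>g \<in> Arr C; Y \<in> Obj (Tot E); omap (Proj E) Y = Cod C g\<rbrakk> \<Longrightarrow>
      Pull E g Y \<in> Arr (Tot E) \<and> Cod (Tot E) (Pull E g Y) = Y \<and> amap (Proj E) (Pull E g Y) = g"
    and push_ex: "\<And>f X g a. \<lbrakk>f \<in> Arr C; X \<in> Obj (Tot E); omap (Proj E) X = Dom C f; g \<in> Arr C;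
        Dom C g = Cod C f; a \<in> Arr (Tot E); Dom (Tot E) a = X; amap (Proj E) a = f \<cdot>\<^bsub>C\<^esub> g\<rbrakk> \<Longrightarrow>
      \<exists>b\<in>Arr (Tot E). Dom (Tot E) b = push_obj E f X \<and> Cod (Tot E) b = Cod (Tot E) a \<and>
        amap (Proj E) b = g \<and> Push E f X \<cdot>\<^bsub>Tot E\<^esub> b = a"
    and pull_ex: "\<And>g Y f a. \<lbrakk>g \<in> Arr C; Y \<in> Obj (Tot E); omap (Proj E) Y = Cod C g; f \<in> Arr C;
        Cod C f = Dom C g; a \<in> Arr (Tot E); Cod (Tot E) a = Y; amap (Proj E) a = f \<cdot>\<^bsub>C\<^esub> g\<rbrakk> \<Longrightarrow>
      \<exists>b\<in>Arr (Tot E). Dom (Tot E) b = Dom (Tot E) a \<and> Cod (Tot E) b = pull_obj E g Y \<and>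
        amap (Proj E) b = f \<and> b \<cdot>\<^bsub>Tot E\<^esub> Pull E g Y = a"
    and push_un: "\<And>f X b c. \<lbrakk>f \<in> Arr C; X \<in> Obj (Tot E); omap (Proj E) X = Dom C f;
        b \<in> Arr (Tot E); c \<in> Arr (Tot E); Dom (Tot E) b = push_obj E f X;
        Dom (Tot E) c = push_obj E f X; Cod (Tot E) b = Cod (Tot E) c;
        amap (Proj E) b = amap (Proj E) c;
        Push E f X \<cdot>\<^bsub>Tot E\<^esub> b = Push E f X \<cdot>\<^bsub>Tot E\<^esub> c\<rbrakk> \<Longrightarrow> b = c"
    and pull_un: "\<And>g Y b c. \<lbrakk>g \<in> Arr C; Y \<in> Obj (Tot E); omap (Proj E) Y = Cod C g;
        b \<in> Arr (Tot E); c \<in> Arr (Tot E); Cod (Tot E) b = pull_obj E g Y;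
        Cod (Tot E) c = pull_obj E g Y; Dom (Tot E) b = Dom (Tot E) c;
        amap (Proj E) b = amap (Proj E) c;
        b \<cdot>\<^bsub>Tot E\<^esub> Pull E g Y = c \<cdot>\<^bsub>Tot E\<^esub> Pull E g Y\<rbrakk> \<Longrightarrow> b = c"
  shows "bifibration C E"
  unfolding bifibration_def
proof (intro conjI ballI impI cat proj)
  fix f X assume fX: "f \<in> Arr C" "X \<in> Obj (Tot E)" "omap (Proj E) X = Dom C f"
  show "Push E f X \<in> hom (Tot E) X (push_obj E f X)" "amap (Proj E) (Push E f X) = f"
    using push[OF fX] by (simp_all add: hom_def push_obj_def)
  fix g T a
  assume g: "g \<in> Arr C" "T \<in> Obj (Tot E)" "a \<in> hom (Tot E) X T"
    "Dom C g = Cod C f \<and> amap (Proj E) a = f \<cdot>\<^bsub>C\<^esub> g"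
  then obtain b where "b \<in> Arr (Tot E)" "Dom (Tot E) b = push_obj E f X"
    "Cod (Tot E) b = Cod (Tot E) a" "amap (Proj E) b = g" "Push E f X \<cdot>\<^bsub>Tot E\<^esub> b = a"
    using push_ex[OF fX, of g a] by (auto simp: hom_def)
  then show "\<exists>!b. b \<in> hom (Tot E) (push_obj E f X) T \<and> amap (Proj E) b = g \<and>
      a = Push E f X \<cdot>\<^bsub>Tot E\<^esub> b"
    using g by (intro ex1I[of _ b]) (auto simp: hom_def intro: push_un[OF fX])
next
  fix g Y assume gY: "g \<in> Arr C" "Y \<in> Obj (Tot E)" "omap (Proj E) Y = Cod C g"
  show "Pull E g Y \<in> hom (Tot E) (pull_obj E g Y) Y" "amap (Proj E) (Pull E g Y) = g"
    using pull[OF gY] by (simp_all add: hom_def pull_obj_def)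
  fix f S a
  assume g: "f \<in> Arr C" "S \<in> Obj (Tot E)" "a \<in> hom (Tot E) S Y"
    "Cod C f = Dom C g \<and> amap (Proj E) a = f \<cdot>\<^bsub>C\<^esub> g"
  then obtain b where "b \<in> Arr (Tot E)" "Dom (Tot E) b = Dom (Tot E) a"
    "Cod (Tot E) b = pull_obj E g Y" "amap (Proj E) b = f" "b \<cdot>\<^bsub>Tot E\<^esub> Pull E g Y = a"
    using pull_ex[OF gY, of f a] by (auto simp: hom_def)
  then show "\<exists>!b. b \<in> hom (Tot E) S (pull_obj E g Y) \<and> amap (Proj E) b = f \<and>
      a = b \<cdot>\<^bsub>Tot E\<^esub> Pull E g Y"
    using g by (intro ex1I[of _ b]) (auto simp: hom_def intro: pull_un[OF gY])
qed

section \<open>Transport of bifibrations: composites of morphisms, subcategories, copies along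
  injections\<close>

lemma bifib_morphism_comp:
  assumes E: "category (Tot E)" "is_functor (Tot E) C (Proj E)"
    and "bifib_morphism C E E' F" "bifib_morphism C E' E'' G"
  shows "bifib_morphism C E E'' (fmap_comp F G)"
  using assms unfolding bifib_morphism_def functor_eq_def fmap_comp_def is_functor_def hom_def
  by (simp add: category_def hom_def)

text \<open>\<open>push_fac\<close> and \<open>pull_fac\<close> are the decisive closure conditions:
  factorizations formed in E do not leave \<open>W\<close>. Their uniqueness is then that of
  E.\<close>

lemma (in bifib) subbifibration:
  fixes O' :: "'eo set" and W :: "'ea set"
  defines "E' \<equiv> E\<lparr>Tot := (Tot E)\<lparr>Obj := O', Arr := W\<rparr>\<rparr>"
  assumes O': "O' \<subseteq> ObjE" and W: "W \<subseteq> ArrE" "\<And>a. a \<in> W \<Longrightarrow> DomE a \<in> O' \<and> CodE a \<in> O'"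
    and id: "\<And>X. X \<in> O' \<Longrightarrow> Ident (Tot E) X \<in> W"
    and comp: "\<And>a b. \<lbrakk>a \<in> W; b \<in> W; CodE a = DomE b\<rbrakk> \<Longrightarrow> a \<star> b \<in> W"
    and push: "\<And>f X. \<lbrakk>f \<in> Arr C; X \<in> O'; po X = Dom C f\<rbrakk> \<Longrightarrow> Push E f X \<in> W"
    and pull: "\<And>f X. \<lbrakk>f \<in> Arr C; X \<in> O'; po X = Cod C f\<rbrakk> \<Longrightarrow> Pull E f X \<in> W"
    and push_fac: "\<And>f X b. \<lbrakk>f \<in> Arr C; X \<in> O'; po X = Dom C f; b \<in> ArrE; CodE b \<in> O';
        DomE b = push_obj E f X; Push E f X \<star> b \<in> W\<rbrakk> \<Longrightarrow> b \<in> W"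
    and pull_fac: "\<And>f X b. \<lbrakk>f \<in> Arr C; X \<in> O'; po X = Cod C f; b \<in> ArrE; DomE b \<in> O';
        CodE b = pull_obj E f X; b \<star> Pull E f X \<in> W\<rbrakk> \<Longrightarrow> b \<in> W"
  shows "bifibration C E'"
proof -
  have [simp]: "Obj (Tot E') = O'" "Arr (Tot E') = W" "Dom (Tot E') = DomE" "Cod (Tot E') = CodE"
    "Comp (Tot E') = Comp (Tot E)" "Ident (Tot E') = Ident (Tot E)" "Proj E' = Proj E"
    "Push E' = Push E" "Pull E' = Pull E" "push_obj E' = push_obj E" "pull_obj E' = pull_obj E"
    by (auto simp: E'_def push_obj_def pull_obj_def fun_eq_iff)
  have [simp]: "X \<in> O' \<Longrightarrow> X \<in> ObjE" "a \<in> W \<Longrightarrow> a \<in> ArrE" for X a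
    using O' W by auto
  show ?thesis
  proof (rule bifibrationI)
    show "category (Tot E')"
      using id comp W by (simp add: category_def hom_def tot.assoc)
    show "is_functor (Tot E') C (Proj E')"
      using id comp W by (simp add: is_functor_def hom_def)
  next
    fix f X g a
    assume a: "f \<in> Arr C" "X \<in> Obj (Tot E')" "omap (Proj E') X = Dom C f" "g \<in> Arr C"
      "Dom C g = Cod C f" "a \<in> Arr (Tot E')" "Dom (Tot E') a = X" "amap (Proj E') a = f \<cdot>\<^bsub>C\<^esub> g"
    then obtain b where "b \<in> ArrE" "DomE b = push_obj E f X" "CodE b = CodE a" "pa b = g"
      "Push E f X \<star> b = a"
      using push_factor[of f X g a] by auto
    moreover from this have "b \<in> W" using a W push_fac by simp
    ultimately show "\<exists>b\<in>Arr (Tot E'). Dom (Tot E') b = push_obj E' f X \<and>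
        Cod (Tot E') b = Cod (Tot E') a \<and> amap (Proj E') b = g \<and> Push E' f X \<cdot>\<^bsub>Tot E'\<^esub> b = a"
      by auto
  next
    fix g Y f a
    assume a: "g \<in> Arr C" "Y \<in> Obj (Tot E')" "omap (Proj E') Y = Cod C g" "f \<in> Arr C"
      "Cod C f = Dom C g" "a \<in> Arr (Tot E')" "Cod (Tot E') a = Y" "amap (Proj E') a = f \<cdot>\<^bsub>C\<^esub> g"
    then obtain b where "b \<in> ArrE" "DomE b = DomE a" "CodE b = pull_obj E g Y" "pa b = f"
      "b \<star> Pull E g Y = a"
      using pull_factor[of g Y f a] by auto
    moreover from this have "b \<in> W" using a W pull_fac by simp
    ultimately show "\<exists>b\<in>Arr (Tot E'). Dom (Tot E') b = Dom (Tot E') a \<and>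
        Cod (Tot E') b = pull_obj E' g Y \<and> amap (Proj E') b = f \<and> b \<cdot>\<^bsub>Tot E'\<^esub> Pull E' g Y = a"
      by auto
  next
    fix f X b c
    assume "f \<in> Arr C" "X \<in> Obj (Tot E')" "omap (Proj E') X = Dom C f"
      "b \<in> Arr (Tot E')" "c \<in> Arr (Tot E')" "Dom (Tot E') b = push_obj E' f X"
      "Dom (Tot E') c = push_obj E' f X" "Cod (Tot E') b = Cod (Tot E') c"
      "amap (Proj E') b = amap (Proj E') c" "Push E' f X \<cdot>\<^bsub>Tot E'\<^esub> b = Push E' f X \<cdot>\<^bsub>Tot E'\<^esub> c"
    then show "b = c" by (intro push_cancel[of f X b c]) simp_all
  next
    fix f X b c
    assume "f \<in> Arr C" "X \<in> Obj (Tot E')" "omap (Proj E') X = Cod C f"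
      "b \<in> Arr (Tot E')" "c \<in> Arr (Tot E')" "Cod (Tot E') b = pull_obj E' f X"
      "Cod (Tot E') c = pull_obj E' f X" "Dom (Tot E') b = Dom (Tot E') c"
      "amap (Proj E') b = amap (Proj E') c" "b \<cdot>\<^bsub>Tot E'\<^esub> Pull E' f X = c \<cdot>\<^bsub>Tot E'\<^esub> Pull E' f X"
    then show "b = c" by (intro pull_cancel[of f X b c]) simp_all
  qed (simp_all add: push pull)
qed

text \<open>The structure is carried along injections into the new types. The inverse
  \<open>J\<close> is a morphism as well, so that morphisms into the copy can be brought back to
  E.\<close>

lemma (in bifib) bifibration_copy:
  assumes "ObjE \<lesssim> (UNIV :: 'u set)" "ArrE \<lesssim> (UNIV :: 'v set)"
  obtains Q :: "('u, 'v, 'co, 'ca) bifib" and I J where "bifibration C Q"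
    "bifib_morphism C E Q I" "bifib_morphism C Q E J"
    "\<And>X. X \<in> ObjE \<Longrightarrow> omap J (omap I X) = X" "\<And>a. a \<in> ArrE \<Longrightarrow> amap J (amap I a) = a"
proof -
  obtain i :: "'eo \<Rightarrow> 'u" where i: "inj_on i ObjE" using assms(1) by (auto simp: lepoll_def)
  obtain j :: "'ea \<Rightarrow> 'v" where j: "inj_on j ArrE" using assms(2) by (auto simp: lepoll_def)
  define i' where "i' = inv_into ObjE i"
  define j' where "j' = inv_into ArrE j"
  have i'[simp]: "i' (i X) = X" if "X \<in> ObjE" for X using that i by (simp add: i'_def)
  have j'[simp]: "j' (j a) = a" if "a \<in> ArrE" for a using that j by (simp add: j'_def)
  define Q :: "('u, 'v, 'co, 'ca) bifib" where
    "Q = \<lparr>Tot = \<lparr>Obj = i ` ObjE, Arr = j ` ArrE, Dom = (\<lambda>a. i (DomE (j' a))),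
        Cod = (\<lambda>a. i (CodE (j' a))), Ident = (\<lambda>X. j (Ident (Tot E) (i' X))),
        Comp = (\<lambda>a b. j (j' a \<star> j' b))\<rparr>,
      Proj = \<lparr>omap = (\<lambda>X. po (i' X)), amap = (\<lambda>a. pa (j' a))\<rparr>,
      Push = (\<lambda>f X. j (Push E f (i' X))), Pull = (\<lambda>f X. j (Pull E f (i' X)))\<rparr>"
  have Q: "Obj (Tot Q) = i ` ObjE" "Arr (Tot Q) = j ` ArrE" and [simp]:
    "Dom (Tot Q) = (\<lambda>a. i (DomE (j' a)))" "Cod (Tot Q) = (\<lambda>a. i (CodE (j' a)))"
    "Ident (Tot Q) = (\<lambda>X. j (Ident (Tot E) (i' X)))" "Comp (Tot Q) = (\<lambda>a b. j (j' a \<star> j' b))"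
    "omap (Proj Q) = (\<lambda>X. po (i' X))" "amap (Proj Q) = (\<lambda>a. pa (j' a))"
    "Push Q = (\<lambda>f X. j (Push E f (i' X)))" "Pull Q = (\<lambda>f X. j (Pull E f (i' X)))"
    by (simp_all add: Q_def)
  have [simp]: "push_obj Q f (i X) = i (push_obj E f X)"
    if "f \<in> Arr C" "X \<in> ObjE" "po X = Dom C f" for f X
    using that by (simp add: push_obj_def[of Q])
  have [simp]: "pull_obj Q f (i X) = i (pull_obj E f X)"
    if "f \<in> Arr C" "X \<in> ObjE" "po X = Cod C f" for f X
    using that by (simp add: pull_obj_def[of Q])
  have ieq: "i X = i Y \<longleftrightarrow> X = Y" if "X \<in> ObjE" "Y \<in> ObjE" for X Y
    using that i by (auto dest: inj_onD)
  have jeq: "j X = j Y \<longleftrightarrow> X = Y" if "X \<in> ArrE" "Y \<in> ArrE" for X Y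
    using that j by (auto dest: inj_onD)
  have "bifibration C Q"
  proof (rule bifibrationI)
    show "category (Tot Q)"
      by (auto simp: category_def hom_def Q ieq tot.assoc)
    show "is_functor (Tot Q) C (Proj Q)"
      by (auto simp: is_functor_def hom_def Q ieq)
  next
    fix f X g a
    assume a: "f \<in> Arr C" "X \<in> Obj (Tot Q)" "omap (Proj Q) X = Dom C f" "g \<in> Arr C"
      "Dom C g = Cod C f" "a \<in> Arr (Tot Q)" "Dom (Tot Q) a = X" "amap (Proj Q) a = f \<cdot>\<^bsub>C\<^esub> g"
    then obtain a' where [simp]: "a = j a'" "a' \<in> ArrE" by (auto simp: Q)
    obtain b where "b \<in> ArrE" "DomE b = push_obj E f (DomE a')" "CodE b = CodE a'" "pa b = g"
      "Push E f (DomE a') \<star> b = a'"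
      by (rule push_factor[of f "DomE a'" g a']) (use a in auto)
    then show "\<exists>b\<in>Arr (Tot Q). Dom (Tot Q) b = push_obj Q f X \<and>
        Cod (Tot Q) b = Cod (Tot Q) a \<and> amap (Proj Q) b = g \<and> Push Q f X \<cdot>\<^bsub>Tot Q\<^esub> b = a"
      using a by (intro bexI[of _ "j b"]) (auto simp: Q ieq)
  next
    fix g Y f a
    assume a: "g \<in> Arr C" "Y \<in> Obj (Tot Q)" "omap (Proj Q) Y = Cod C g" "f \<in> Arr C"
      "Cod C f = Dom C g" "a \<in> Arr (Tot Q)" "Cod (Tot Q) a = Y" "amap (Proj Q) a = f \<cdot>\<^bsub>C\<^esub> g"
    then obtain a' where [simp]: "a = j a'" "a' \<in> ArrE" by (auto simp: Q)
    obtain b where "b \<in> ArrE" "DomE b = DomE a'" "CodE b = pull_obj E g (CodE a')" "pa b = f"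
      "b \<star> Pull E g (CodE a') = a'"
      by (rule pull_factor[of g "CodE a'" f a']) (use a in auto)
    then show "\<exists>b\<in>Arr (Tot Q). Dom (Tot Q) b = Dom (Tot Q) a \<and>
        Cod (Tot Q) b = pull_obj Q g Y \<and> amap (Proj Q) b = f \<and> b \<cdot>\<^bsub>Tot Q\<^esub> Pull Q g Y = a"
      using a by (intro bexI[of _ "j b"]) (auto simp: Q ieq)
  next
    fix f X b c
    assume a: "f \<in> Arr C" "X \<in> Obj (Tot Q)" "omap (Proj Q) X = Dom C f"
      "b \<in> Arr (Tot Q)" "c \<in> Arr (Tot Q)" "Dom (Tot Q) b = push_obj Q f X"
      "Dom (Tot Q) c = push_obj Q f X" "Cod (Tot Q) b = Cod (Tot Q) c"
      "amap (Proj Q) b = amap (Proj Q) c" "Push Q f X \<cdot>\<^bsub>Tot Q\<^esub> b = Push Q f X \<cdot>\<^bsub>Tot Q\<^esub> c"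
    then obtain X' b' c' where e: "X = i X'" "X' \<in> ObjE" "b = j b'" "b' \<in> ArrE" "c = j c'" "c' \<in> ArrE"
      by (auto simp: Q)
    then have "b' = c'" using a by (intro push_cancel[of f X' b' c']) (auto simp: ieq jeq)
    then show "b = c" by (simp add: e)
  next
    fix f X b c
    assume a: "f \<in> Arr C" "X \<in> Obj (Tot Q)" "omap (Proj Q) X = Cod C f"
      "b \<in> Arr (Tot Q)" "c \<in> Arr (Tot Q)" "Cod (Tot Q) b = pull_obj Q f X"
      "Cod (Tot Q) c = pull_obj Q f X" "Dom (Tot Q) b = Dom (Tot Q) c"
      "amap (Proj Q) b = amap (Proj Q) c" "b \<cdot>\<^bsub>Tot Q\<^esub> Pull Q f X = c \<cdot>\<^bsub>Tot Q\<^esub> Pull Q f X"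
    then obtain X' b' c' where e: "X = i X'" "X' \<in> ObjE" "b = j b'" "b' \<in> ArrE" "c = j c'" "c' \<in> ArrE"
      by (auto simp: Q)
    then have "b' = c'" using a by (intro pull_cancel[of f X' b' c']) (auto simp: ieq jeq)
    then show "b = c" by (simp add: e)
  qed (auto simp: Q)
  moreover have "bifib_morphism C E Q \<lparr>omap = i, amap = j\<rparr>"
    by (auto simp: bifib_morphism_def is_functor_def functor_eq_def fmap_comp_def hom_def Q)
  moreover have "bifib_morphism C Q E \<lparr>omap = i', amap = j'\<rparr>"
    by (auto simp: bifib_morphism_def is_functor_def functor_eq_def fmap_comp_def hom_def Q ieq)
  ultimately show ?thesis
    by (rule that) simp_all
qed

text \<open>The universal property of the free bifibration, which by definition only concerns
  bifibrations on the type \<open>'u\<close>, extends to all types: the part of \<open>E\<close> generated by \<open>D\<close> is small.\<close>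

lemma free_bifibration_extension:
  fixes Bif :: "('u, 'u, 'co, 'ca) bifib" and E :: "('eo, 'ea, 'co, 'ca) bifib"
  assumes C: "category C" and D: "category D"
    and U: "infinite (UNIV :: 'u set)" "Arr C \<lesssim> (UNIV :: 'u set)" "Arr D \<lesssim> (UNIV :: 'u set)"
    and free: "free_bifibration C D p Bif \<eta>"
    and E: "bifibration C E" "is_functor D (Tot E) \<theta>" "functor_eq D (fmap_comp \<theta> (Proj E)) p"
  obtains F where "bifib_morphism C Bif E F" "functor_eq D (fmap_comp \<eta> F) \<theta>"
proof -
  interpret bifib C E using C E by unfold_locales
  interpret D: cat D using D by unfold_locales
  note \<theta>[simp] = functor_simps[OF E(2)]
  \<comment> \<open>The size assumption speaks of arrows only; identities carry the bound over to
    objects.\<close>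
  have "Obj D \<subseteq> Dom D ` Arr D" using D.Ident_simps(1,2) by (metis imageI subsetI)
  then have ObjD: "Obj D \<lesssim> (UNIV :: 'u set)"
    using U(3) image_lepoll_trans subset_lepoll_trans by metis
  define KO where "KO = (\<lambda>f X (_ :: 'eo). push_obj E f X) ` Arr C \<union> (\<lambda>f X _. pull_obj E f X) ` Arr C"
  \<comment> \<open>The closure is untyped and also applies the operations where they are
    unconstrained. Intersecting with \<open>ObjE\<close> discards such values; \<open>W\<close> is
    cut down in the same way.\<close>
  define O' where "O' = {X \<in> ObjE. X \<in> binary_closure (omap \<theta> ` Obj D) KO}"
  have "KO \<lesssim> (UNIV :: 'u set)"
    unfolding KO_def using U by (intro Un_lepoll_infinite image_lepoll_trans)
  then have "binary_closure (omap \<theta> ` Obj D) KO \<lesssim> (UNIV :: 'u set)"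
    using U(1) ObjD by (intro binary_closure_lepoll image_lepoll_trans)
  then have O'small: "O' \<lesssim> (UNIV :: 'u set)"
    by (rule subset_lepoll_trans) (auto simp: O'_def)
  have O'simp[simp]: "X \<in> O' \<Longrightarrow> X \<in> ObjE" for X by (simp add: O'_def)
  have O'\<theta>: "X \<in> Obj D \<Longrightarrow> omap \<theta> X \<in> O'" for X
    unfolding O'_def by (simp add: binary_closure.base del: O'simp)
  have O'push[simp]: "push_obj E f X \<in> O'" if "f \<in> Arr C" "X \<in> O'" "po X = Dom C f" for f X
    using that binary_closure.step[of "\<lambda>X _. push_obj E f X" KO X _ X]
    by (auto simp: O'_def KO_def simp del: O'simp)
  have O'pull[simp]: "pull_obj E f X \<in> O'" if "f \<in> Arr C" "X \<in> O'" "po X = Cod C f" for f X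
    using that binary_closure.step[of "\<lambda>X _. pull_obj E f X" KO X _ X]
    by (auto simp: O'_def KO_def simp del: O'simp)
  \<comment> \<open>Factorization through a lifting, seen as an operation indexed by small data.
    Without it the generated part would contain the composite but perhaps not its factor. The last
    argument is a dummy.\<close>
  define pushf where "pushf = (\<lambda>(f, g, X) a (_ :: 'ea).
    THE b. b \<in> hom (Tot E) (push_obj E f X) (CodE a) \<and> pa b = g \<and> a = Push E f X \<star> b)"
  define pullf where "pullf = (\<lambda>(g, f, Y) a (_ :: 'ea).
    THE b. b \<in> hom (Tot E) (DomE a) (pull_obj E g Y) \<and> pa b = f \<and> a = b \<star> Pull E g Y)"
  define W0 where "W0 = amap \<theta> ` Arr D \<union> (Ident (Tot E) ` O' \<union> ((\<lambda>(f, X). Push E f X) ` (Arr C \<times> O')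
    \<union> (\<lambda>(f, X). Pull E f X) ` (Arr C \<times> O')))"
  define KW where "KW = {CompE} \<union> (pushf ` (Arr C \<times> Arr C \<times> O') \<union> pullf ` (Arr C \<times> Arr C \<times> O'))"
  define W where "W = {a \<in> ArrE. DomE a \<in> O' \<and> CodE a \<in> O' \<and> a \<in> binary_closure W0 KW}"
  have "W0 \<lesssim> (UNIV :: 'u set)"
    unfolding W0_def using U O'small by (intro Un_lepoll_infinite image_lepoll_trans Times_lepoll_infinite)
  moreover have "{CompE} \<lesssim> (UNIV :: 'u set)"
    using U(1) by (intro finite_lepoll_infinite) simp_all
  then have "KW \<lesssim> (UNIV :: 'u set)"
    unfolding KW_def using U O'small
    by (intro Un_lepoll_infinite image_lepoll_trans Times_lepoll_infinite)
  ultimately have "binary_closure W0 KW \<lesssim> (UNIV :: 'u set)"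
    using U(1) by (intro binary_closure_lepoll)
  then have Wsmall: "W \<lesssim> (UNIV :: 'u set)"
    by (rule subset_lepoll_trans) (auto simp: W_def)
  define E' where "E' = E\<lparr>Tot := (Tot E)\<lparr>Obj := O', Arr := W\<rparr>\<rparr>"
  have "bifibration C E'"
    unfolding E'_def
  proof (rule subbifibration)
    fix X assume "X \<in> O'" then show "Ident (Tot E) X \<in> W"
      unfolding W_def by (simp add: binary_closure.base W0_def)
  next
    fix a b assume "a \<in> W" "b \<in> W" "CodE a = DomE b"
    then show "a \<star> b \<in> W"
      using binary_closure.step[of CompE KW a W0 b] by (auto simp: W_def KW_def)
  next
    fix f X assume a: "f \<in> Arr C" "X \<in> O'" "po X = Dom C f"
    then have "Push E f X \<in> W0" unfolding W0_def by blast
    then show "Push E f X \<in> W" unfolding W_def by (simp add: a binary_closure.base)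
  next
    fix f X assume a: "f \<in> Arr C" "X \<in> O'" "po X = Cod C f"
    then have "Pull E f X \<in> W0" unfolding W0_def by blast
    then show "Pull E f X \<in> W" unfolding W_def by (simp add: a binary_closure.base)
  next
    fix f X b
    assume a: "f \<in> Arr C" "X \<in> O'" "po X = Dom C f" "b \<in> ArrE" "CodE b \<in> O'"
      "DomE b = push_obj E f X" "Push E f X \<star> b \<in> W"
    then have db: "Dom C (pa b) = Cod C f" by simp
    \<comment> \<open>By the universal property, b is the only value that the description can take
      on the composite, and the composite is already in the closure.\<close>
    have "pushf (f, pa b, X) (Push E f X \<star> b) b = b"
      unfolding pushf_def prod.case
      using a db by (intro the1_equality push_ex1) (simp_all add: hom_def)
    moreover have "pushf (f, pa b, X) (Push E f X \<star> b) (Push E f X \<star> b) =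
        pushf (f, pa b, X) (Push E f X \<star> b) b"
      by (simp add: pushf_def)
    moreover have "pushf (f, pa b, X) \<in> KW" using a by (auto simp: KW_def)
    ultimately have "b \<in> binary_closure W0 KW"
      using a(7) binary_closure.step[of "pushf (f, pa b, X)" KW "Push E f X \<star> b" W0 "Push E f X \<star> b"]
      by (simp add: W_def)
    then show "b \<in> W" using a by (simp add: W_def)
  next
    fix f X b
    assume a: "f \<in> Arr C" "X \<in> O'" "po X = Cod C f" "b \<in> ArrE" "DomE b \<in> O'"
      "CodE b = pull_obj E f X" "b \<star> Pull E f X \<in> W"
    then have db: "Cod C (pa b) = Dom C f" by simp
    have "pullf (f, pa b, X) (b \<star> Pull E f X) b = b"
      unfolding pullf_def prod.case
      using a db by (intro the1_equality pull_ex1) (simp_all add: hom_def)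
    moreover have "pullf (f, pa b, X) (b \<star> Pull E f X) (b \<star> Pull E f X) =
        pullf (f, pa b, X) (b \<star> Pull E f X) b"
      by (simp add: pullf_def)
    moreover have "pullf (f, pa b, X) \<in> KW" using a by (auto simp: KW_def)
    ultimately have "b \<in> binary_closure W0 KW"
      using a(7) binary_closure.step[of "pullf (f, pa b, X)" KW "b \<star> Pull E f X" W0 "b \<star> Pull E f X"]
      by (simp add: W_def)
    then show "b \<in> W" using a by (simp add: W_def)
  qed (auto simp: W_def)
  then interpret E': bifib C E' by unfold_locales
  have E'simps: "Obj (Tot E') = O'" "Arr (Tot E') = W" "Dom (Tot E') = DomE" "Cod (Tot E') = CodE"
    "Comp (Tot E') = Comp (Tot E)" "Ident (Tot E') = Ident (Tot E)" "Proj E' = Proj E"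
    "Push E' = Push E" "Pull E' = Pull E"
    by (simp_all add: E'_def)
  have \<theta>W: "amap \<theta> a \<in> W" if "a \<in> Arr D" for a
    unfolding W_def using that by (simp add: O'\<theta> W0_def binary_closure.base)
  obtain Q :: "('u, 'u, 'co, 'ca) bifib" and I J where Q: "bifibration C Q"
    "bifib_morphism C E' Q I" "bifib_morphism C Q E' J"
    "\<And>X. X \<in> Obj (Tot E') \<Longrightarrow> omap J (omap I X) = X"
    "\<And>a. a \<in> Arr (Tot E') \<Longrightarrow> amap J (amap I a) = a"
    by (rule E'.bifibration_copy[where 'u='u and 'v='u]) (simp_all add: E'simps O'small Wsmall)
  note I = Q(2)[unfolded bifib_morphism_def, THEN conjunct1]
    Q(2)[unfolded bifib_morphism_def, THEN conjunct2, THEN conjunct1]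
  have "is_functor D (Tot Q) (fmap_comp \<theta> I)"
    using functor_simps[OF I(1)] O'\<theta> \<theta>W
    by (auto simp: is_functor_def fmap_comp_def hom_def E'simps)
  moreover have "functor_eq D (fmap_comp (fmap_comp \<theta> I) (Proj Q)) p"
    using I(2) E(3) O'\<theta> \<theta>W by (auto simp: functor_eq_def fmap_comp_def E'simps)
  ultimately obtain F where F: "bifib_morphism C Bif Q F" "functor_eq D (fmap_comp \<eta> F) (fmap_comp \<theta> I)"
    using free Q(1) unfolding free_bifibration_def by blast
  have Bif: "bifibration C Bif" using free by (simp add: free_bifibration_def)
  then have Bif': "category (Tot Bif)" "is_functor (Tot Bif) C (Proj Bif)"
    by (simp_all add: bifibration_def)
  have Q': "category (Tot Q)" "is_functor (Tot Q) C (Proj Q)"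
    using Q(1) by (simp_all add: bifibration_def)
  have "bifib_morphism C E' E \<lparr>omap = \<lambda>X. X, amap = \<lambda>a. a\<rparr>"
    by (auto simp: bifib_morphism_def is_functor_def functor_eq_def fmap_comp_def hom_def E'simps W_def)
  then have "bifib_morphism C Q E (fmap_comp J \<lparr>omap = \<lambda>X. X, amap = \<lambda>a. a\<rparr>)"
    using bifib_morphism_comp[OF Q'] Q(3) by blast
  then have "bifib_morphism C Q E J"
    by (cases J) (simp add: fmap_comp_def comp_def)
  then have "bifib_morphism C Bif E (fmap_comp F J)"
    using bifib_morphism_comp[OF Bif'] F(1) by blast
  moreover have "functor_eq D (fmap_comp \<eta> (fmap_comp F J)) \<theta>"
    using F(2) Q(4,5) O'\<theta> \<theta>W by (simp add: functor_eq_def fmap_comp_def E'simps)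
  ultimately show ?thesis by (rule that)
qed

section \<open>Normal forms\<close>

text \<open>The arrow of a node is the base arrow of its premise; the connectives involved are determined by
  the end sequent.\<close>

datatype ('da, 'ca) nf = Ax 'da | NL 'ca "('da, 'ca) nf" | PR 'ca "('da, 'ca) nf"

context cat
begin

text \<open>Inverting the negative connectives on the right turns a sequent with target \<open>T\<close> over \<open>k\<close> into one
  over \<open>ext T k\<close>.\<close>

primrec ext :: "('do, 'ca) formula \<Rightarrow> 'ca \<Rightarrow> 'ca" where
  "ext (Atom X) k = k"
| "ext (Pos f S) k = k"
| "ext (Neg g T) k = ext T (k \<cdot> g)"

text \<open>The condition under which a sequent \<open>g\<^sup>- S \<Rightarrow> T\<close> over \<open>m\<close> that is derived by a left rule from a sequent
  over \<open>k\<close>, with the connectives of \<open>T\<close> inverted, is derived by a left rule from a sequent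
  \<open>S \<Rightarrow> T\<close> over \<open>e\<close>.\<close>

definition fac :: "'ca \<Rightarrow> ('do, 'ca) formula \<Rightarrow> 'ca \<Rightarrow> 'ca \<Rightarrow> 'ca \<Rightarrow> bool" where
  "fac g T m k e \<longleftrightarrow> e \<in> Arr C \<and> Dom C e = Cod C g \<and> g \<cdot> e = m \<and> ext T e = k"

text \<open>The right rule for \<open>h\<close> applied to \<open>x\<close>, followed by
  normalization. If \<open>x\<close> ends with a left rule whose premise lies over a suitable e, the
  right rule moves above it, and the left rule then stores \<open>e \<cdot> h\<close>, since the new
  target is positive. A positive source is inverted without a trace, so only the base arrow changes.
  \<open>SOME\<close> is needed because e itself is not stored; \<open>fac_unique\<close> makes it
  harmless.\<close>

primrec posR :: "('do, 'ca) formula \<Rightarrow> ('do, 'ca) formula \<Rightarrow> 'ca \<Rightarrow> 'ca \<Rightarrow> ('da, 'ca) nf \<Rightarrow>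
    ('da, 'ca) nf" where
  "posR (Atom X) T h m x = PR m x"
| "posR (Pos f R) T h m x = posR R T h (f \<cdot> m) x"
| "posR (Neg g R) T h m x = (case x of
      NL k y \<Rightarrow>
        if \<exists>e. fac g T m k e
        then NL ((SOME e. fac g T m k e) \<cdot> h) (posR R T h (SOME e. fac g T m k e) y)
        else PR m x
    | _ \<Rightarrow> PR m x)"

declare posR.simps(3) [simp del]

end

text \<open>The case in which \<open>posR\<close> exchanges the rules: a right rule below
  \<open>x\<close> would violate the priority of left rules.\<close>

definition left_first :: "('co, 'ca) cat \<Rightarrow> ('do, 'ca) formula \<Rightarrow> 'ca \<Rightarrow> ('do, 'ca) formula \<Rightarrow>
    ('da, 'ca) nf \<Rightarrow> bool" where
  "left_first C R m T x \<longleftrightarrow> (\<exists>g S k y e. R = Neg g S \<and> x = NL k y \<and> cat.fac C g T m k e)"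

locale formulas = bifib C E for C :: "('co, 'ca) cat" and E :: "('eo, 'ea, 'co, 'ca) bifib" +
  fixes D :: "('do, 'da) cat" and p :: "('do, 'da, 'co, 'ca) fmap"
    and \<eta> :: "('do, 'da, 'eo, 'ea) fmap"
  assumes D: "category D" and p: "is_functor D C p"
    and preordered: "factorization_preordered C"
    and unit: "is_functor D (Tot E) \<eta>" "functor_eq D (fmap_comp \<eta> (Proj E)) p"
begin

sublocale D: cat D by unfold_locales (rule D)

lemmas p_simps [simp] = functor_simps[OF p]
lemmas unit_simps [simp] = functor_simps[OF unit(1)]

lemma po_unit [simp]: "X \<in> Obj D \<Longrightarrow> po (omap \<eta> X) = omap p X"
  and pa_unit [simp]: "d \<in> Arr D \<Longrightarrow> pa (amap \<eta> d) = amap p d"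
  using unit(2) by (simp_all add: functor_eq_def fmap_comp_def)

abbreviation CompC (infixl \<open>\<odot>\<close> 70) where "f \<odot> g \<equiv> f \<cdot>\<^bsub>C\<^esub> g"
abbreviation "ext \<equiv> base.ext"
abbreviation "posR \<equiv> base.posR"
abbreviation "fac \<equiv> base.fac"
abbreviation "fo \<equiv> formula_obj E \<eta>"

primrec bs :: "('do, 'ca) formula \<Rightarrow> 'co" where
  "bs (Atom X) = omap p X"
| "bs (Pos f S) = Cod C f"
| "bs (Neg g T) = Dom C g"

primrec wff :: "('do, 'ca) formula \<Rightarrow> bool" where
  "wff (Atom X) \<longleftrightarrow> X \<in> Obj D"
| "wff (Pos f S) \<longleftrightarrow> f \<in> Arr C \<and> wff S \<and> bs S = Dom C f"
| "wff (Neg g T) \<longleftrightarrow> g \<in> Arr C \<and> wff T \<and> bs T = Cod C g"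

lemma formula_over_iff: "formula_over C D p S A \<longleftrightarrow> wff S \<and> bs S = A"
proof
  show "formula_over C D p S A \<Longrightarrow> wff S \<and> bs S = A"
    by (induction rule: formula_over.induct) (auto simp: hom_def)
  show "wff S \<and> bs S = A \<Longrightarrow> formula_over C D p S A"
    by (induction S arbitrary: A) (auto simp: hom_def intro!: formula_over.intros)
qed

lemma fo_simps [simp]: "wff S \<Longrightarrow> fo S \<in> ObjE" "wff S \<Longrightarrow> po (fo S) = bs S"
proof -
  have "wff S \<Longrightarrow> fo S \<in> ObjE \<and> po (fo S) = bs S"
    by (induction S) simp_all
  then show "wff S \<Longrightarrow> fo S \<in> ObjE" "wff S \<Longrightarrow> po (fo S) = bs S" by simp_all
qed

lemma bs_Obj [simp]: "wff S \<Longrightarrow> bs S \<in> Obj C"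
  by (cases S) simp_all

abbreviation typed :: "('do, 'ca) formula \<Rightarrow> 'ca \<Rightarrow> ('do, 'ca) formula \<Rightarrow> 'ea \<Rightarrow> bool" where
  "typed R k T a \<equiv> wff R \<and> wff T \<and> k \<in> Arr C \<and> Dom C k = bs R \<and> Cod C k = bs T \<and>
     a \<in> ArrE \<and> DomE a = fo R \<and> CodE a = fo T \<and> pa a = k"

text \<open>\<open>x\<close> is the normal form of the arrow \<open>a : R \<rightarrow> T\<close> over \<open>k\<close>. The side condition of \<open>J_PR\<close> is what gives
  priority to left rules.\<close>

inductive J :: "('do, 'ca) formula \<Rightarrow> 'ca \<Rightarrow> ('do, 'ca) formula \<Rightarrow> ('da, 'ca) nf \<Rightarrow> 'ea \<Rightarrow> bool" where
  J_Ax: "d \<in> Arr D \<Longrightarrow> J (Atom (Dom D d)) (amap p d) (Atom (Cod D d)) (Ax d) (amap \<eta> d)"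
| J_PosL: "\<lbrakk>J R (f \<odot> k) T x (Push E f (fo R) \<star> a); typed (Pos f R) k T a\<rbrakk> \<Longrightarrow> J (Pos f R) k T x a"
| J_NegR: "\<lbrakk>\<not> is_pos R; J R (k \<odot> g) T x (a \<star> Pull E g (fo T)); typed R k (Neg g T) a\<rbrakk>
    \<Longrightarrow> J R k (Neg g T) x a"
| J_NL: "\<lbrakk>\<not> is_neg T; J R k T x a; wff (Neg g R)\<rbrakk>
    \<Longrightarrow> J (Neg g R) (g \<odot> k) T (NL k x) (Pull E g (fo R) \<star> a)"
| J_PR: "\<lbrakk>\<not> is_pos R; J R m T x a; wff (Pos h T); \<not> left_first C R m T x\<rbrakk>
    \<Longrightarrow> J R (m \<odot> h) (Pos h T) (PR m x) (a \<star> Push E h (fo T))"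

lemma J_typed: "J R k T x a \<Longrightarrow> typed R k T a"
  by (induction rule: J.induct) auto

section \<open>The factorization preorder determines the base arrow that normal forms do not
  store\<close>

lemma fp_cancel:
  assumes "f \<odot> g = f \<odot> h" "g \<odot> k = h \<odot> k" "f \<in> Arr C" "g \<in> Arr C" "h \<in> Arr C" "k \<in> Arr C"
    "Cod C f = Dom C g" "Dom C h = Dom C g" "Cod C h = Cod C g" "Cod C g = Dom C k"
  shows "g = h"
  using preordered assms unfolding factorization_preordered_def by metis

text \<open>The negative connectives of T are removed one at a time: once the composites of e and e'
  with h agree, they agree after g on the left and before h on the right, which is the situation of
  \<open>fp_cancel\<close>.\<close>

lemma ext_cancel:
  assumes "ext T e = ext T e'" "g \<odot> e = g \<odot> e'" "wff T" "g \<in> Arr C"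
    "e \<in> Arr C" "Dom C e = Cod C g" "Cod C e = bs T" "e' \<in> Arr C" "Dom C e' = Cod C g" "Cod C e' = bs T"
  shows "e = e'"
  using assms
proof (induction T arbitrary: e e')
  case (Neg h T)
  have eq: "g \<odot> (e \<odot> h) = g \<odot> (e' \<odot> h)"
    using base.assoc[of g e h] base.assoc[of g e' h] Neg.prems by simp
  have "e \<odot> h = e' \<odot> h"
    by (rule Neg.IH) (use eq Neg.prems in simp_all)
  then show ?case
    using Neg.prems by (intro fp_cancel[of g e e' h]) simp_all
qed simp_all

lemma fac_Cod: "fac g T m k e \<Longrightarrow> g \<in> Arr C \<Longrightarrow> Cod C e = Cod C m"
  using base.Comp_simps(3)[of g e] by (auto simp: base.fac_def)

lemma fac_unique:
  assumes "fac g T m k e" "fac g T m k e'" "wff T" "g \<in> Arr C" "Cod C m = bs T"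
  shows "e = e'"
  using fac_Cod[OF assms(1,4)] fac_Cod[OF assms(2,4)] assms
  by (intro ext_cancel[of T e e' g]) (auto simp: base.fac_def)

lemma posR_fac:
  assumes "fac g T m k e" "wff T" "g \<in> Arr C" "Cod C m = bs T"
  shows "posR (Neg g R) T h m (NL k y) = NL (e \<odot> h) (posR R T h e y)"
proof -
  have "(SOME e. fac g T m k e) = e"
    using assms fac_unique by blast
  then show ?thesis using assms(1) by (auto simp: base.posR.simps(3))
qed

lemma posR_not_left_first:
  assumes "\<not> is_pos R" "\<not> left_first C R m T x"
  shows "posR R T h m x = PR m x"
  using assms by (cases R) (auto simp: left_first_def base.posR.simps(3) split: nf.split)

section \<open>Inversion and introduction rules for \<open>J\<close> without polarity
  restrictions\<close>

lemma J_PosD: "J (Pos f R) k T x a \<Longrightarrow> J R (f \<odot> k) T x (Push E f (fo R) \<star> a)"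
  by (erule J.cases) auto

text \<open>\<open>J\<close> performs left inversions before right ones. The induction over the
  positive connectives of the source shows that this order is immaterial: the two composites differ
  by associativity only. \<open>J_NegI\<close> is the converse.\<close>

lemma J_NegD: "J R k (Neg g T) x a \<Longrightarrow> J R (k \<odot> g) T x (a \<star> Pull E g (fo T))"
proof (induction R arbitrary: k a)
  case (Pos f R)
  from J_typed[OF Pos.prems] have t: "typed (Pos f R) k (Neg g T) a" .
  have "J R (f \<odot> k \<odot> g) T x (Push E f (fo R) \<star> a \<star> Pull E g (fo T))"
    by (rule Pos.IH[OF J_PosD[OF Pos.prems]])
  then have "J R (f \<odot> (k \<odot> g)) T x (Push E f (fo R) \<star> (a \<star> Pull E g (fo T)))"
    using t by (simp add: base.assoc tot.assoc)
  then show ?case by (rule J_PosL) (use t in simp)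
qed (erule J.cases; auto)+

lemma J_NegI:
  "\<lbrakk>J R (k \<odot> g) T x (a \<star> Pull E g (fo T)); typed R k (Neg g T) a\<rbrakk> \<Longrightarrow> J R k (Neg g T) x a"
proof (induction R arbitrary: k a)
  case (Pos f R)
  note t = Pos.prems(2)
  have "J R (f \<odot> (k \<odot> g)) T x (Push E f (fo R) \<star> (a \<star> Pull E g (fo T)))"
    by (rule J_PosD[OF Pos.prems(1)])
  then have "J R (f \<odot> k \<odot> g) T x (Push E f (fo R) \<star> a \<star> Pull E g (fo T))"
    using t by (simp add: base.assoc tot.assoc)
  then have "J R (f \<odot> k) (Neg g T) x (Push E f (fo R) \<star> a)"
    by (rule Pos.IH) (use t in simp)
  then show ?case by (rule J_PosL) (rule t)
qed (rule J_NegR; simp)+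

text \<open>\<open>J_NL\<close> is restricted to non-negative targets. For other targets the right
  inversions are performed below the left rule, which therefore stores \<open>ext T k\<close> in
  place of k.\<close>

lemma J_negL:
  "\<lbrakk>J R k T x a; wff (Neg g R)\<rbrakk>
    \<Longrightarrow> J (Neg g R) (g \<odot> k) T (NL (ext T k) x) (Pull E g (fo R) \<star> a)"
proof (induction T arbitrary: k a)
  case (Neg h T)
  from J_typed[OF Neg.prems(1)] have t: "typed R k (Neg h T) a" .
  have "J (Neg g R) (g \<odot> (k \<odot> h)) T (NL (ext T (k \<odot> h)) x) (Pull E g (fo R) \<star> (a \<star> Pull E h (fo T)))"
    by (rule Neg.IH[OF J_NegD[OF Neg.prems(1)] Neg.prems(2)])
  then have "J (Neg g R) (g \<odot> k \<odot> h) T (NL (ext T (k \<odot> h)) x) (Pull E g (fo R) \<star> a \<star> Pull E h (fo T))"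
    using t Neg.prems(2) by (simp add: base.assoc tot.assoc)
  then show ?case
    by (intro J_NegR) (use t Neg.prems(2) in simp_all)
qed (simp_all add: J_NL del: wff.simps)

text \<open>For a non-negative target the stored arrow is e itself, and the last rule can be read
  off. Each negative connective of the target is then restored by factoring b through its lifting,
  and the equation for a is checked after composing with that lifting.\<close>

lemma J_negL_D:
  assumes "J (Neg g R) (g \<odot> e) T (NL (ext T e) y) a" "e \<in> Arr C" "Dom C e = Cod C g" "Cod C e = bs T"
  shows "\<exists>b. J R e T y b \<and> a = Pull E g (fo R) \<star> b"
  using assms
proof (induction T arbitrary: e a)
  case (Neg h T)
  from J_typed[OF Neg.prems(1)] have t: "typed (Neg g R) (g \<odot> e) (Neg h T) a" .
  have "J (Neg g R) (g \<odot> e \<odot> h) T (NL (ext T (e \<odot> h)) y) (a \<star> Pull E h (fo T))"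
    using J_NegD[OF Neg.prems(1)] by simp
  then have "\<exists>b. J R (e \<odot> h) T y b \<and> a \<star> Pull E h (fo T) = Pull E g (fo R) \<star> b"
    using t Neg.prems by (intro Neg.IH) (simp_all add: base.assoc)
  then obtain b where b: "J R (e \<odot> h) T y b" "a \<star> Pull E h (fo T) = Pull E g (fo R) \<star> b" by blast
  note tb = J_typed[OF b(1)]
  obtain c where c: "c \<in> ArrE" "DomE c = DomE b" "CodE c = pull_obj E h (fo T)" "pa c = e"
    "c \<star> Pull E h (fo T) = b"
    by (rule pull_factor[of h "fo T" e b]) (use t tb Neg.prems in auto)
  have "J R e (Neg h T) y c"
    using b(1) by (intro J_NegI) (use t tb c Neg.prems in simp_all)
  moreover have "a = Pull E g (fo R) \<star> c"
  proof (rule pull_cancel[of h "fo T"])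
    show "a \<star> Pull E h (fo T) = Pull E g (fo R) \<star> c \<star> Pull E h (fo T)"
      using b(2) t tb c by (simp add: tot.assoc)
  qed (use t tb c in simp_all)
  ultimately show ?case by blast
qed (erule J.cases; auto)+

text \<open>The normalizing right rule is sound. In the exchange case \<open>J_negL_D\<close>
  recovers the derivation above the left rule, the right rule is applied there, and associativity
  identifies the two composite arrows.\<close>

lemma J_posR:
  "\<lbrakk>J R m T x a; wff (Pos h T)\<rbrakk>
    \<Longrightarrow> J R (m \<odot> h) (Pos h T) (posR R T h m x) (a \<star> Push E h (fo T))"
proof (induction R arbitrary: m x a)
  case (Atom X)
  then show ?case by (auto simp: left_first_def intro: J_PR)
next
  case (Pos f R)
  from J_typed[OF Pos.prems(1)] have t: "typed (Pos f R) m T a" .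
  have "J R (f \<odot> m \<odot> h) (Pos h T) (posR R T h (f \<odot> m) x)
      (Push E f (fo R) \<star> a \<star> Push E h (fo T))"
    by (rule Pos.IH[OF J_PosD[OF Pos.prems(1)] Pos.prems(2)])
  then show ?case
    using t Pos.prems(2) by (intro J_PosL) (simp_all add: base.assoc tot.assoc)
next
  case (Neg g R)
  from J_typed[OF Neg.prems(1)] have t: "typed (Neg g R) m T a" .
  show ?case
  proof (cases "left_first C (Neg g R) m T x")
    case True
    then obtain k y e where x: "x = NL k y" and e: "fac g T m k e" by (auto simp: left_first_def)
    have e': "e \<in> Arr C" "Dom C e = Cod C g" "m = g \<odot> e" "k = ext T e"
      using e by (auto simp: base.fac_def)
    have Ce: "Cod C e = bs T" using t fac_Cod[OF e] by simp
    from Neg.prems(1) have "J (Neg g R) (g \<odot> e) T (NL (ext T e) y) a" by (simp only: x e')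
    from J_negL_D[OF this e'(1,2) Ce]
    obtain b where b: "J R e T y b" "a = Pull E g (fo R) \<star> b" by blast
    have "J (Neg g R) (g \<odot> (e \<odot> h)) (Pos h T) (NL (e \<odot> h) (posR R T h e y))
        (Pull E g (fo R) \<star> (b \<star> Push E h (fo T)))"
      using t Neg.IH[OF b(1) Neg.prems(2)] by (intro J_NL) simp_all
    then show ?thesis
      using t Neg.prems(2) J_typed[OF b(1)] e e'
      by (simp add: x posR_fac base.assoc tot.assoc b(2))
  next
    case False
    then show ?thesis
      using J_PR[OF _ Neg.prems(1,2)] posR_not_left_first[of "Neg g R" m T x h] by simp
  qed
qed

text \<open>The end sequent and the head of \<open>x\<close> fix the last rule. Inversions are
  undone by uniqueness of factorizations; the other rules compose with a lifting that is
  known.\<close>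

lemma J_functional: "\<lbrakk>J R k T x a; J R k T x b\<rbrakk> \<Longrightarrow> a = b"
proof (induction arbitrary: b rule: J.induct)
  case (J_Ax d)
  from J_Ax.prems show ?case by (cases rule: J.cases) simp_all
next
  case (J_PosL R f k T x a)
  have eq: "Push E f (fo R) \<star> a = Push E f (fo R) \<star> b"
    by (rule J_PosL.IH[OF J_PosD[OF J_PosL.prems]])
  show ?case
    by (rule push_cancel[OF _ _ _ _ _ _ _ _ _ eq]) (use J_PosL.hyps J_typed[OF J_PosL.prems] in simp_all)
next
  case (J_NegR R k g T x a)
  have eq: "a \<star> Pull E g (fo T) = b \<star> Pull E g (fo T)"
    by (rule J_NegR.IH[OF J_NegD[OF J_NegR.prems]])
  show ?case
    by (rule pull_cancel[OF _ _ _ _ _ _ _ _ _ eq]) (use J_NegR.hyps J_typed[OF J_NegR.prems] in simp_all)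
next
  case (J_NL T R k x a g)
  from J_NL.prems J_NL.hyps(1) obtain c where "b = Pull E g (fo R) \<star> c" "J R k T x c"
    by (cases rule: J.cases) auto
  then show ?case using J_NL.IH by simp
next
  case (J_PR R m T x a h)
  from J_PR.prems J_PR.hyps(1) obtain c where "b = c \<star> Push E h (fo T)" "J R m T x c"
    by (cases rule: J.cases) auto
  then show ?case using J_PR.IH by simp
qed

end

section \<open>The bifibration of natural families of operations on normal forms\<close>

text \<open>Source and target formulas are part of an arrow: different formulas may denote the same
  object of E, so \<open>und\<close> does not determine them.\<close>

datatype ('do, 'da, 'ca, 'ea) family =
  Family (fsrc: "('do, 'ca) formula") (und: 'ea)
    (fam: "('do, 'ca) formula \<Rightarrow> 'ca \<Rightarrow> ('da, 'ca) nf \<Rightarrow> ('da, 'ca) nf") (ftgt: "('do, 'ca) formula")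

context formulas
begin

text \<open>The first clause ties h to composition with a. The other two ask for naturality only in
  the left introductions, which act directly on trees: that of f^+ leaves the tree alone and that of
  g^- adds \<open>NL\<close>. Naturality in arbitrary arrows would presuppose a composition of
  normal forms.\<close>

definition natural :: "('do, 'ca) formula \<Rightarrow> 'ea \<Rightarrow> ('do, 'ca) formula \<Rightarrow>
    (('do, 'ca) formula \<Rightarrow> 'ca \<Rightarrow> ('da, 'ca) nf \<Rightarrow> ('da, 'ca) nf) \<Rightarrow> bool" where
  "natural S a T h \<longleftrightarrow>
     (\<forall>R k x b. J R k S x b \<longrightarrow> J R (k \<odot> pa a) T (h R k x) (b \<star> a)) \<and>
     (\<forall>g R k x b. J (Pos g R) k S x b \<longrightarrow> h (Pos g R) k x = h R (g \<odot> k) x) \<and>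
     (\<forall>g R k x b. J R k S x b \<longrightarrow> wff (Neg g R) \<longrightarrow>
        h (Neg g R) (g \<odot> k) (NL (ext S k) x) = NL (ext T (k \<odot> pa a)) (h R k x))"

lemma naturalD:
  assumes "natural S a T h"
  shows "J R k S x b \<Longrightarrow> J R (k \<odot> pa a) T (h R k x) (b \<star> a)"
    and "J (Pos g R) k S x b \<Longrightarrow> h (Pos g R) k x = h R (g \<odot> k) x"
    and "J R k S x b \<Longrightarrow> wff (Neg g R) \<Longrightarrow>
      h (Neg g R) (g \<odot> k) (NL (ext S k) x) = NL (ext T (k \<odot> pa a)) (h R k x)"
  using assms unfolding natural_def by blast+

text \<open>Families are made equal to \<open>undefined\<close> outside the normal forms with target \<open>S\<close>, so that
  equality of arrows is equality of families on normal forms.\<close>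

definition restr :: "('do, 'ca) formula \<Rightarrow>
    (('do, 'ca) formula \<Rightarrow> 'ca \<Rightarrow> ('da, 'ca) nf \<Rightarrow> ('da, 'ca) nf) \<Rightarrow>
    ('do, 'ca) formula \<Rightarrow> 'ca \<Rightarrow> ('da, 'ca) nf \<Rightarrow> ('da, 'ca) nf" where
  "restr S h = (\<lambda>R k x. if \<exists>b. J R k S x b then h R k x else undefined)"

lemma restr_app: "J R k S x b \<Longrightarrow> restr S h R k x = h R k x"
  by (auto simp: restr_def)

lemma restr_cong: "(\<And>R k x b. J R k S x b \<Longrightarrow> h R k x = h' R k x) \<Longrightarrow> restr S h = restr S h'"
  unfolding restr_def by (intro ext) auto

lemma restr_restr [simp]: "restr S (restr S h) = restr S h"
  by (rule restr_cong) (simp add: restr_app)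

lemma natural_restr: "natural S a T h \<Longrightarrow> natural S a T (restr S h)"
  unfolding natural_def using J_PosD J_negL restr_app by (smt (verit))

section \<open>Natural families for composites, identities and chosen liftings\<close>

lemma natural_comp:
  assumes h: "natural S a T h" and h': "natural T a' V h'"
    and t: "typed S (pa a) T a" "typed T (pa a') V a'"
  shows "natural S (a \<star> a') V (\<lambda>R k x. h' R (k \<odot> pa a) (h R k x))"
  unfolding natural_def
proof (intro conjI allI impI)
  fix R k x b assume j: "J R k S x b"
  have "J R (k \<odot> pa a \<odot> pa a') V (h' R (k \<odot> pa a) (h R k x)) (b \<star> a \<star> a')"
    by (intro naturalD(1)[OF h'] naturalD(1)[OF h] j)
  then show "J R (k \<odot> pa (a \<star> a')) V (h' R (k \<odot> pa a) (h R k x)) (b \<star> (a \<star> a'))"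
    using J_typed[OF j] t by (simp add: base.assoc tot.assoc)
next
  fix g R k x b assume j: "J (Pos g R) k S x b"
  show "h' (Pos g R) (k \<odot> pa a) (h (Pos g R) k x) = h' R (g \<odot> k \<odot> pa a) (h R (g \<odot> k) x)"
    using naturalD(2)[OF h' naturalD(1)[OF h j]] naturalD(2)[OF h j] J_typed[OF j] t
    by (simp add: base.assoc)
next
  fix g R k x b assume j: "J R k S x b" "wff (Neg g R)"
  show "h' (Neg g R) (g \<odot> k \<odot> pa a) (h (Neg g R) (g \<odot> k) (NL (ext S k) x)) =
      NL (ext V (k \<odot> pa (a \<star> a'))) (h' R (k \<odot> pa a) (h R k x))"
    using naturalD(3)[OF h' naturalD(1)[OF h j(1)] j(2)] naturalD(3)[OF h j] J_typed[OF j(1)] j(2) t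
    by (simp add: base.assoc)
qed

lemma natural_id: "wff S \<Longrightarrow> natural S (Ident (Tot E) (fo S)) S (\<lambda>R k x. x)"
  unfolding natural_def using J_typed by auto

text \<open>Commutation with left rules is the exchange branch of \<open>posR\<close>, with the
  given k as the witness for \<open>fac\<close>.\<close>

lemma natural_push:
  assumes S: "wff (Pos f S)"
  shows "natural S (Push E f (fo S)) (Pos f S) (\<lambda>R k x. posR R S f k x)"
  unfolding natural_def
proof (intro conjI allI impI)
  fix R k x b assume j: "J R k S x b"
  show "J R (k \<odot> pa (Push E f (fo S))) (Pos f S) (posR R S f k x) (b \<star> Push E f (fo S))"
    using J_posR[OF j S] S by simp
next
  fix g R k x b assume j: "J R k S x b" and g: "wff (Neg g R)"
  then have "fac g S (g \<odot> k) (ext S k) k"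
    using J_typed[OF j] by (simp add: base.fac_def)
  note posR_fac[OF this, simp]
  show "posR (Neg g R) S f (g \<odot> k) (NL (ext S k) x)
     = NL (ext (Pos f S) (k \<odot> pa (Push E f (fo S)))) (posR R S f k x)"
    using S g J_typed[OF j] by simp
qed simp

text \<open>Right inversion is not recorded, so composing with this lifting does not change the
  tree.\<close>

lemma natural_pull:
  assumes T: "wff (Neg g T)"
  shows "natural (Neg g T) (Pull E g (fo T)) T (\<lambda>R k x. x)"
  unfolding natural_def using T by (auto intro: J_NegD)

lemma natural_pull_factor:
  assumes h: "natural S (b \<star> Pull E g (fo T)) T h" and b: "typed S (pa b) (Neg g T) b"
  shows "natural S b (Neg g T) h"
  unfolding natural_def
proof (intro conjI allI impI)
  fix R k x c assume j: "J R k S x c"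
  note t = J_typed[OF j]
  have "J R (k \<odot> pa b \<odot> g) T (h R k x) (c \<star> b \<star> Pull E g (fo T))"
    using naturalD(1)[OF h j] t b by (simp add: base.assoc tot.assoc)
  then show "J R (k \<odot> pa b) (Neg g T) (h R k x) (c \<star> b)"
    by (rule J_NegI) (use t b in simp)
next
  fix f R k x c assume "J (Pos f R) k S x c"
  then show "h (Pos f R) k x = h R (f \<odot> k) x" by (rule naturalD(2)[OF h])
next
  fix f R k x c assume j: "J R k S x c" "wff (Neg f R)"
  show "h (Neg f R) (f \<odot> k) (NL (ext S k) x) = NL (ext (Neg g T) (k \<odot> pa b)) (h R k x)"
    using naturalD(3)[OF h j] J_typed[OF j(1)] b by (simp add: base.assoc)
qed

lemma J_to_Pos_cases [consumes 2]:
  assumes "J R k (Pos f S) x c" "\<not> is_pos R"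
  obtains (NL) g R' j y c' where "R = Neg g R'" "x = NL j y" "k = g \<odot> j" "wff (Neg g R')"
      "J R' j (Pos f S) y c'" "c = Pull E g (fo R') \<star> c'"
  | (PR) m y c' where "x = PR m y" "k = m \<odot> f" "J R m S y c'" "\<not> left_first C R m S y"
      "c = c' \<star> Push E f (fo S)"
  using assms by (cases rule: J.cases) auto

text \<open>The extension of h along \<open>posR\<close>, for a factor over g. Both main clauses are
  forced: \<open>PR m y\<close> has to be sent to the value of h at y, and \<open>NL\<close> is
  dictated by naturality. The \<open>undefined\<close> cases cannot occur for normal forms whose
  target is positive.\<close>

primrec push_family :: "(('do, 'ca) formula \<Rightarrow> 'ca \<Rightarrow> ('da, 'ca) nf \<Rightarrow> ('da, 'ca) nf) \<Rightarrow>
    ('do, 'ca) formula \<Rightarrow> 'ca \<Rightarrow> ('do, 'ca) formula \<Rightarrow> 'ca \<Rightarrow> ('da, 'ca) nf \<Rightarrow> ('da, 'ca) nf" where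
  "push_family h T g (Atom X) k x = (case x of PR m y \<Rightarrow> h (Atom X) m y | _ \<Rightarrow> undefined)"
| "push_family h T g (Pos f R) k x = push_family h T g R (f \<odot> k) x"
| "push_family h T g (Neg f R) k x = (case x of
      NL j y \<Rightarrow> NL (ext T (j \<odot> g)) (push_family h T g R j y)
    | PR m y \<Rightarrow> h (Neg f R) m y
    | _ \<Rightarrow> undefined)"

text \<open>The clauses of \<open>push_family\<close> agree where the legs of the pushout overlap:
  if \<open>posR\<close> has exchanged the rules, the \<open>NL\<close> clause applies, and
  naturality of h gives the same tree.\<close>

lemma push_family_posR:
  assumes h: "natural S a T h" and t: "wff (Pos f S)" "pa a = f \<odot> g" "g \<in> Arr C" "Dom C g = Cod C f"
  shows "J R k S x c \<Longrightarrow> push_family h T g R (k \<odot> f) (posR R S f k x) = h R k x"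
proof (induction R arbitrary: k x c)
  case (Atom X)
  then show ?case by simp
next
  case (Pos f' R)
  then show ?case
    using Pos.IH[OF J_PosD[OF Pos.prems]] naturalD(2)[OF h Pos.prems] J_typed[OF Pos.prems] t
    by (simp add: base.assoc)
next
  case (Neg g' R)
  note tj = J_typed[OF Neg.prems]
  show ?case
  proof (cases "left_first C (Neg g' R) k S x")
    case True
    then obtain y e where x: "x = NL (ext S e) y" and k: "k = g' \<odot> e"
      and e: "fac g' S (g' \<odot> e) (ext S e) e" "e \<in> Arr C" "Dom C e = Cod C g'"
      by (auto simp: left_first_def base.fac_def)
    have Ce: "Cod C e = bs S" using fac_Cod[OF e(1)] tj by (simp add: k)
    from Neg.prems obtain b where b: "J R e S y b"
      using J_negL_D[of g' R e S y c] e Ce by (auto simp: x k)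
    have "push_family h T g (Neg g' R) (k \<odot> f) (posR (Neg g' R) S f k x) =
        push_family h T g (Neg g' R) (k \<odot> f) (NL (e \<odot> f) (posR R S f e y))"
      using tj by (simp add: x k posR_fac[OF e(1)])
    also have "\<dots> = NL (ext T (e \<odot> f \<odot> g)) (h R e y)"
      using Neg.IH[OF b] by simp
    also have "\<dots> = h (Neg g' R) k x"
      using naturalD(3)[OF h b] tj t e Ce by (simp add: x k base.assoc)
    finally show ?thesis .
  next
    case False
    then show ?thesis using posR_not_left_first[of "Neg g' R" k S x f] by simp
  qed
qed

lemma push_family_J:
  assumes h: "natural S (Push E f (fo S) \<star> b) T h" and b: "typed (Pos f S) (pa b) T b"
  shows "J R k (Pos f S) x c \<Longrightarrow> J R (k \<odot> pa b) T (push_family h T (pa b) R k x) (c \<star> b)"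
proof (induction R arbitrary: k x c)
  case (Pos f' R)
  note t = J_typed[OF Pos.prems]
  from Pos.IH[OF J_PosD[OF Pos.prems]] show ?case
    using t b by (intro J_PosL) (simp_all add: base.assoc tot.assoc)
next
  case (Atom X)
  have "\<not> is_pos (Atom X)" by simp
  with Atom.prems show ?case
  proof (cases rule: J_to_Pos_cases)
    case (PR m y c')
    then show ?thesis
      using naturalD(1)[OF h PR(3)] b J_typed[OF PR(3)] by (simp add: base.assoc tot.assoc)
  qed simp_all
next
  case (Neg g' R)
  have "\<not> is_pos (Neg g' R)" by simp
  with Neg.prems show ?case
  proof (cases rule: J_to_Pos_cases)
    case (NL g R' j y c')
    then show ?thesis
      using J_negL[OF Neg.IH[of j y c'], of g'] b J_typed[OF NL(5)] by (simp add: base.assoc tot.assoc)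
  next
    case (PR m y c')
    then show ?thesis
      using naturalD(1)[OF h PR(3)] b J_typed[OF PR(3)] by (simp add: base.assoc tot.assoc)
  qed
qed

lemma natural_push_family:
  assumes h: "natural S (Push E f (fo S) \<star> b) T h" and b: "typed (Pos f S) (pa b) T b"
  shows "natural (Pos f S) b T (push_family h T (pa b))"
  unfolding natural_def using push_family_J[OF h b] by simp

text \<open>Normal forms with target \<open>Pos f S\<close> are generated from the image of
  \<open>posR\<close> by left operations: the side condition on \<open>PR m y\<close> says exactly
  that it is \<open>posR\<close> of y. A natural family is thus determined on that image.\<close>

lemma push_family_unique:
  assumes h: "natural (Pos f S) b T h" "natural (Pos f S) b T h'"
    and eq: "\<And>R k x c. J R k S x c \<Longrightarrow> h R (k \<odot> f) (posR R S f k x) = h' R (k \<odot> f) (posR R S f k x)"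
  shows "J R k (Pos f S) x c \<Longrightarrow> h R k x = h' R k x"
proof (induction R arbitrary: k x c)
  case (Pos f' R)
  then show ?case
    using naturalD(2)[OF h(1) Pos.prems] naturalD(2)[OF h(2) Pos.prems] Pos.IH[OF J_PosD[OF Pos.prems]]
    by simp
next
  case (Atom X)
  have "\<not> is_pos (Atom X)" by simp
  with Atom.prems show ?case
  proof (cases rule: J_to_Pos_cases)
    case (PR m y c')
    then show ?thesis using eq[OF PR(3)] by simp
  qed simp_all
next
  case (Neg g' R)
  have "\<not> is_pos (Neg g' R)" by simp
  with Neg.prems show ?case
  proof (cases rule: J_to_Pos_cases)
    case (NL g R' j y c')
    then show ?thesis
      using naturalD(3)[OF h(1) NL(5), of g] naturalD(3)[OF h(2) NL(5), of g] Neg.IH[of j y c'] by simp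
  next
    case (PR m y c')
    then show ?thesis using eq[OF PR(3)] posR_not_left_first[of "Neg g' R" m S y f] by simp
  qed
qed

section \<open>The natural families form a bifibration over C\<close>

definition model :: "(('do, 'ca) formula, ('do, 'da, 'ca, 'ea) family, 'co, 'ca) bifib" where
  "model = \<lparr>Tot = \<lparr>Obj = {S. wff S},
      Arr = {F. typed (fsrc F) (pa (und F)) (ftgt F) (und F) \<and>
        natural (fsrc F) (und F) (ftgt F) (fam F) \<and> restr (fsrc F) (fam F) = fam F},
      Dom = fsrc, Cod = ftgt,
      Ident = (\<lambda>S. Family S (Ident (Tot E) (fo S)) (restr S (\<lambda>R k x. x)) S),
      Comp = (\<lambda>F G. Family (fsrc F) (und F \<star> und G)
        (restr (fsrc F) (\<lambda>R k x. fam G R (k \<odot> pa (und F)) (fam F R k x))) (ftgt G))\<rparr>,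
    Proj = \<lparr>omap = bs, amap = (\<lambda>F. pa (und F))\<rparr>,
    Push = (\<lambda>f S. Family S (Push E f (fo S)) (restr S (\<lambda>R k x. posR R S f k x)) (Pos f S)),
    Pull = (\<lambda>g T. Family (Neg g T) (Pull E g (fo T)) (restr (Neg g T) (\<lambda>R k x. x)) T)\<rparr>"

lemma model_simps [simp]:
  "Obj (Tot model) = {S. wff S}"
  "Dom (Tot model) = fsrc" "Cod (Tot model) = ftgt"
  "Ident (Tot model) S = Family S (Ident (Tot E) (fo S)) (restr S (\<lambda>R k x. x)) S"
  "F \<cdot>\<^bsub>Tot model\<^esub> G = Family (fsrc F) (und F \<star> und G)
        (restr (fsrc F) (\<lambda>R k x. fam G R (k \<odot> pa (und F)) (fam F R k x))) (ftgt G)"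
  "omap (Proj model) = bs" "amap (Proj model) F = pa (und F)"
  "Push model f S = Family S (Push E f (fo S)) (restr S (\<lambda>R k x. posR R S f k x)) (Pos f S)"
  "Pull model g T = Family (Neg g T) (Pull E g (fo T)) (restr (Neg g T) (\<lambda>R k x. x)) T"
  "push_obj model f S = Pos f S" "pull_obj model g T = Neg g T"
  by (simp_all add: model_def push_obj_def pull_obj_def)

lemma Arr_model: "F \<in> Arr (Tot model) \<longleftrightarrow> typed (fsrc F) (pa (und F)) (ftgt F) (und F) \<and>
    natural (fsrc F) (und F) (ftgt F) (fam F) \<and> restr (fsrc F) (fam F) = fam F"
  by (simp add: model_def)

lemma Family_in_model:
  "\<lbrakk>typed S (pa a) T a; natural S a T h\<rbrakk> \<Longrightarrow> Family S a (restr S h) T \<in> Arr (Tot model)"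
  by (simp add: Arr_model natural_restr)

lemma model_category: "category (Tot model)"
  unfolding category_def
proof (intro conjI ballI impI)
  fix F assume F: "F \<in> Arr (Tot model)"
  then show "Dom (Tot model) F \<in> Obj (Tot model)" "Cod (Tot model) F \<in> Obj (Tot model)"
    by (simp_all add: Arr_model)
  have t: "typed (fsrc F) (pa (und F)) (ftgt F) (und F)"
    and n: "natural (fsrc F) (und F) (ftgt F) (fam F)" and r: "restr (fsrc F) (fam F) = fam F"
    using F by (simp_all add: Arr_model)
  have "restr (fsrc F) (\<lambda>R k x. fam F R (k \<odot> Ident C (bs (fsrc F))) (restr (fsrc F) (\<lambda>R k x. x) R k x))
      = restr (fsrc F) (fam F)"
    by (rule restr_cong) (use J_typed in \<open>auto simp: restr_app\<close>)
  then show "Ident (Tot model) (Dom (Tot model) F) \<cdot>\<^bsub>Tot model\<^esub> F = F"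
    using t r by (cases F) simp
  have "restr (fsrc F) (\<lambda>R k x. restr (ftgt F) (\<lambda>R k x. x) R (k \<odot> pa (und F)) (fam F R k x))
      = restr (fsrc F) (fam F)"
    by (rule restr_cong) (simp add: restr_app[OF naturalD(1)[OF n]])
  then show "F \<cdot>\<^bsub>Tot model\<^esub> Ident (Tot model) (Cod (Tot model) F) = F"
    using t r by (cases F) simp
next
  fix S assume "S \<in> Obj (Tot model)"
  then show "Ident (Tot model) S \<in> hom (Tot model) S S"
    by (simp add: hom_def Family_in_model natural_id)
next
  fix F G
  assume F: "F \<in> Arr (Tot model)" and G: "G \<in> Arr (Tot model)"
    and eq: "Cod (Tot model) F = Dom (Tot model) G"
  have t: "typed (fsrc F) (pa (und F)) (ftgt F) (und F)" "typed (ftgt F) (pa (und G)) (ftgt G) (und G)"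
    "natural (fsrc F) (und F) (ftgt F) (fam F)" "natural (ftgt F) (und G) (ftgt G) (fam G)"
    using F G eq by (simp_all add: Arr_model)
  show "F \<cdot>\<^bsub>Tot model\<^esub> G \<in> hom (Tot model) (Dom (Tot model) F) (Cod (Tot model) G)"
    using t by (simp add: hom_def Family_in_model natural_comp)
next
  fix F G H
  assume a: "F \<in> Arr (Tot model)" "G \<in> Arr (Tot model)" "H \<in> Arr (Tot model)"
    "Cod (Tot model) F = Dom (Tot model) G \<and> Cod (Tot model) G = Dom (Tot model) H"
  have t: "typed (fsrc F) (pa (und F)) (ftgt F) (und F)" "typed (ftgt F) (pa (und G)) (ftgt G) (und G)"
    "typed (ftgt G) (pa (und H)) (ftgt H) (und H)" "natural (fsrc F) (und F) (ftgt F) (fam F)"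
    "fsrc G = ftgt F" "fsrc H = ftgt G"
    using a by (simp_all add: Arr_model)
  have "restr (fsrc F) (\<lambda>R k x. fam H R (k \<odot> pa (und F \<star> und G))
        (restr (fsrc F) (\<lambda>R k x. fam G R (k \<odot> pa (und F)) (fam F R k x)) R k x)) =
      restr (fsrc F) (\<lambda>R k x. restr (ftgt F) (\<lambda>R k x. fam H R (k \<odot> pa (und G)) (fam G R k x)) R
        (k \<odot> pa (und F)) (fam F R k x))"
  proof (rule restr_cong)
    fix R k x b assume j: "J R k (fsrc F) x b"
    show "fam H R (k \<odot> pa (und F \<star> und G))
        (restr (fsrc F) (\<lambda>R k x. fam G R (k \<odot> pa (und F)) (fam F R k x)) R k x) =
      restr (ftgt F) (\<lambda>R k x. fam H R (k \<odot> pa (und G)) (fam G R k x)) R (k \<odot> pa (und F)) (fam F R k x)"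
      using J_typed[OF j] t by (simp add: restr_app[OF j] restr_app[OF naturalD(1)[OF t(4) j]] base.assoc)
  qed
  then show "F \<cdot>\<^bsub>Tot model\<^esub> G \<cdot>\<^bsub>Tot model\<^esub> H = F \<cdot>\<^bsub>Tot model\<^esub> (G \<cdot>\<^bsub>Tot model\<^esub> H)"
    using t by (simp add: tot.assoc)
qed

lemma model_bifibration: "bifibration C model"
proof (rule bifibrationI[OF model_category])
  show "is_functor (Tot model) C (Proj model)"
    by (simp add: is_functor_def hom_def Arr_model)
next
  fix f S assume "f \<in> Arr C" "S \<in> Obj (Tot model)" "omap (Proj model) S = Dom C f"
  then show "Push model f S \<in> Arr (Tot model) \<and> Dom (Tot model) (Push model f S) = S \<and>
      amap (Proj model) (Push model f S) = f"
    by (simp add: Family_in_model natural_push)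
next
  fix g T assume "g \<in> Arr C" "T \<in> Obj (Tot model)" "omap (Proj model) T = Cod C g"
  then show "Pull model g T \<in> Arr (Tot model) \<and> Cod (Tot model) (Pull model g T) = T \<and>
      amap (Proj model) (Pull model g T) = g"
    by (simp add: Family_in_model natural_pull)
next
  fix f S g F
  assume a: "f \<in> Arr C" "S \<in> Obj (Tot model)" "omap (Proj model) S = Dom C f" "g \<in> Arr C"
    "Dom C g = Cod C f" "F \<in> Arr (Tot model)" "Dom (Tot model) F = S"
    "amap (Proj model) F = f \<odot> g"
  have S: "wff (Pos f S)" using a by simp
  have t: "typed S (f \<odot> g) (ftgt F) (und F)" "natural S (und F) (ftgt F) (fam F)"
    "restr S (fam F) = fam F" "fsrc F = S"
    using a by (auto simp: Arr_model)
  obtain b where b: "b \<in> ArrE" "DomE b = fo (Pos f S)" "CodE b = fo (ftgt F)" "pa b = g"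
    "Push E f (fo S) \<star> b = und F"
    by (rule push_factor[of f "fo S" g "und F"]) (use a t in auto)
  have tb: "typed (Pos f S) (pa b) (ftgt F) b"
    using S t b a base.Comp_simps(3)[of f g] by auto
  let ?G = "Family (Pos f S) b (restr (Pos f S) (push_family (fam F) (ftgt F) (pa b))) (ftgt F)"
  have "?G \<in> Arr (Tot model)"
    using natural_push_family[OF _ tb] t(2) b by (intro Family_in_model tb) simp
  moreover have "restr S (\<lambda>R k x. restr (Pos f S) (push_family (fam F) (ftgt F) (pa b)) R (k \<odot> f)
      (restr S (\<lambda>R k x. posR R S f k x) R k x)) = restr S (fam F)"
  proof (rule restr_cong)
    fix R k x c assume j: "J R k S x c"
    show "restr (Pos f S) (push_family (fam F) (ftgt F) (pa b)) R (k \<odot> f)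
      (restr S (\<lambda>R k x. posR R S f k x) R k x) = fam F R k x"
      using push_family_posR[OF t(2) S _ _ _ j, of g] a t b
      by (simp add: restr_app[OF j] restr_app[OF J_posR[OF j S]])
  qed
  ultimately show "\<exists>G\<in>Arr (Tot model). Dom (Tot model) G = push_obj model f S \<and>
      Cod (Tot model) G = Cod (Tot model) F \<and> amap (Proj model) G = g \<and>
      Push model f S \<cdot>\<^bsub>Tot model\<^esub> G = F"
    using a t b by (intro bexI[of _ ?G]) (cases F, auto)
next
  fix g T f F
  assume a: "g \<in> Arr C" "T \<in> Obj (Tot model)" "omap (Proj model) T = Cod C g" "f \<in> Arr C"
    "Cod C f = Dom C g" "F \<in> Arr (Tot model)" "Cod (Tot model) F = T"
    "amap (Proj model) F = f \<odot> g"
  have t: "typed (fsrc F) (f \<odot> g) T (und F)" "natural (fsrc F) (und F) T (fam F)"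
    "restr (fsrc F) (fam F) = fam F" "ftgt F = T"
    using a by (auto simp: Arr_model)
  obtain b where b: "b \<in> ArrE" "DomE b = fo (fsrc F)" "CodE b = fo (Neg g T)" "pa b = f"
    "b \<star> Pull E g (fo T) = und F"
    by (rule pull_factor[of g "fo T" f "und F"]) (use a t in auto)
  have tb: "typed (fsrc F) (pa b) (Neg g T) b"
    using t b a base.Comp_simps(2)[of f g] by auto
  have n: "natural (fsrc F) b (Neg g T) (fam F)"
    using t b by (intro natural_pull_factor tb) simp
  let ?G = "Family (fsrc F) b (fam F) (Neg g T)"
  have "?G \<in> Arr (Tot model)"
    using tb n t by (simp add: Arr_model)
  moreover have "restr (fsrc F) (\<lambda>R k x. restr (Neg g T) (\<lambda>R k x. x) R (k \<odot> f) (fam F R k x))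
      = restr (fsrc F) (fam F)"
    by (rule restr_cong) (use restr_app[OF naturalD(1)[OF n]] b in simp)
  ultimately show "\<exists>G\<in>Arr (Tot model). Dom (Tot model) G = Dom (Tot model) F \<and>
      Cod (Tot model) G = pull_obj model g T \<and> amap (Proj model) G = f \<and>
      G \<cdot>\<^bsub>Tot model\<^esub> Pull model g T = F"
    using a t b by (intro bexI[of _ ?G]) (cases F, auto)
next
  fix f S F G
  assume a: "f \<in> Arr C" "S \<in> Obj (Tot model)" "omap (Proj model) S = Dom C f"
    "F \<in> Arr (Tot model)" "G \<in> Arr (Tot model)" "Dom (Tot model) F = push_obj model f S"
    "Dom (Tot model) G = push_obj model f S" "Cod (Tot model) F = Cod (Tot model) G"
    "amap (Proj model) F = amap (Proj model) G"
    and eq: "Push model f S \<cdot>\<^bsub>Tot model\<^esub> F = Push model f S \<cdot>\<^bsub>Tot model\<^esub> G"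
  have S: "wff (Pos f S)" using a by simp
  have tF: "typed (Pos f S) (pa (und F)) (ftgt G) (und F)" "natural (Pos f S) (und F) (ftgt G) (fam F)"
    "restr (Pos f S) (fam F) = fam F" "fsrc F = Pos f S" "ftgt F = ftgt G"
    and tG: "typed (Pos f S) (pa (und G)) (ftgt G) (und G)" "natural (Pos f S) (und G) (ftgt G) (fam G)"
    "restr (Pos f S) (fam G) = fam G" "fsrc G = Pos f S"
    using a by (auto simp: Arr_model)
  have und: "und F = und G"
    by (rule push_cancel[of f "fo S"]) (use a tF tG eq in auto)
  have "fam F R (k \<odot> f) (posR R S f k x) = fam G R (k \<odot> f) (posR R S f k x)" if j: "J R k S x c" for R k x c
  proof -
    have "restr S (\<lambda>R k x. fam F R (k \<odot> f) (restr S (\<lambda>R k x. posR R S f k x) R k x)) R k x =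
      restr S (\<lambda>R k x. fam G R (k \<odot> f) (restr S (\<lambda>R k x. posR R S f k x) R k x)) R k x"
      using eq a by simp
    then show ?thesis by (simp add: restr_app[OF j])
  qed
  from push_family_unique[OF tF(2) _ this] tG(2)
  have "restr (Pos f S) (fam F) = restr (Pos f S) (fam G)"
    by (intro restr_cong) (simp add: und)
  then show "F = G"
    using und tF tG by (cases F; cases G) simp
next
  fix g T F G
  assume a: "g \<in> Arr C" "T \<in> Obj (Tot model)" "omap (Proj model) T = Cod C g"
    "F \<in> Arr (Tot model)" "G \<in> Arr (Tot model)" "Cod (Tot model) F = pull_obj model g T"
    "Cod (Tot model) G = pull_obj model g T" "Dom (Tot model) F = Dom (Tot model) G"
    "amap (Proj model) F = amap (Proj model) G"
    and eq: "F \<cdot>\<^bsub>Tot model\<^esub> Pull model g T = G \<cdot>\<^bsub>Tot model\<^esub> Pull model g T"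
  have tF: "typed (fsrc G) (pa (und F)) (Neg g T) (und F)" "natural (fsrc G) (und F) (Neg g T) (fam F)"
    "restr (fsrc G) (fam F) = fam F" "fsrc F = fsrc G" "ftgt F = Neg g T"
    and tG: "typed (fsrc G) (pa (und G)) (Neg g T) (und G)" "natural (fsrc G) (und G) (Neg g T) (fam G)"
    "restr (fsrc G) (fam G) = fam G" "ftgt G = Neg g T"
    using a by (auto simp: Arr_model)
  have und: "und F = und G"
    by (rule pull_cancel[of g "fo T"]) (use a tF tG eq in auto)
  have "restr (fsrc G) (fam F) = restr (fsrc G) (fam G)"
  proof (rule restr_cong)
    fix R k x c assume j: "J R k (fsrc G) x c"
    have "fam (F \<cdot>\<^bsub>Tot model\<^esub> Pull model g T) R k x = fam (G \<cdot>\<^bsub>Tot model\<^esub> Pull model g T) R k x"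
      by (simp only: eq)
    then show "fam F R k x = fam G R k x"
      using tF(4) by (simp add: restr_app[OF j] restr_app[OF naturalD(1)[OF tF(2) j]]
          restr_app[OF naturalD(1)[OF tG(2) j]])
  qed
  then show "F = G"
    using und tF tG by (cases F; cases G) simp
qed

text \<open>Composition with an arrow of D reaches the axiom through left rules only. The value on
  \<open>PR\<close> is a default: a normal form with atomic target contains no right rule.\<close>

primrec postcomp :: "'da \<Rightarrow> ('da, 'ca) nf \<Rightarrow> ('da, 'ca) nf" where
  "postcomp d (Ax c) = Ax (c \<cdot>\<^bsub>D\<^esub> d)"
| "postcomp d (NL k x) = NL (k \<odot> amap p d) (postcomp d x)"
| "postcomp d (PR k x) = PR k x"

lemma J_to_Atom_cases [consumes 2]:
  assumes "J R k (Atom X) x b" "\<not> is_pos R"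
  obtains (Ax) d where "R = Atom (Dom D d)" "k = amap p d" "Cod D d = X" "x = Ax d" "b = amap \<eta> d"
      "d \<in> Arr D"
  | (NL) g R' j y b' where "R = Neg g R'" "x = NL j y" "k = g \<odot> j" "wff (Neg g R')"
      "J R' j (Atom X) y b'" "b = Pull E g (fo R') \<star> b'"
  using assms by (cases rule: J.cases) auto

lemma postcomp_J:
  assumes d: "d \<in> Arr D"
  shows "J R k (Atom (Dom D d)) x b
    \<Longrightarrow> J R (k \<odot> amap p d) (Atom (Cod D d)) (postcomp d x) (b \<star> amap \<eta> d)"
proof (induction R arbitrary: k x b)
  case (Pos f' R)
  from Pos.IH[OF J_PosD[OF Pos.prems]] show ?case
    using d J_typed[OF Pos.prems] by (intro J_PosL) (simp_all add: base.assoc tot.assoc)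
next
  case (Atom X)
  have "\<not> is_pos (Atom X)" by simp
  with Atom.prems show ?case
  proof (cases rule: J_to_Atom_cases)
    case (Ax c)
    then show ?thesis using J_Ax[of "c \<cdot>\<^bsub>D\<^esub> d"] d by simp
  qed simp
next
  case (Neg g' R)
  have "\<not> is_pos (Neg g' R)" by simp
  with Neg.prems show ?case
  proof (cases rule: J_to_Atom_cases)
    case (NL g R' j y b')
    then show ?thesis
      using J_negL[OF Neg.IH[of j y b'], of g'] d J_typed[OF NL(5)]
      by (simp add: base.assoc tot.assoc)
  qed simp
qed

lemma natural_postcomp:
  assumes "d \<in> Arr D"
  shows "natural (Atom (Dom D d)) (amap \<eta> d) (Atom (Cod D d)) (\<lambda>R k. postcomp d)"
  unfolding natural_def using postcomp_J[OF assms] assms by simp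

lemma postcomp_Ident: "J R k (Atom X) x b \<Longrightarrow> postcomp (Ident D X) x = x"
proof (induction R k "Atom X :: ('do, 'ca) formula" x b rule: J.induct)
  case (J_NL R k x a g)
  then show ?case using J_typed[OF J_NL(2)] by simp
qed simp_all

lemma postcomp_postcomp:
  assumes "c \<in> Arr D" "d \<in> Arr D" "Cod D c = Dom D d"
  shows "J R k (Atom (Dom D c)) x b \<Longrightarrow> postcomp (c \<cdot>\<^bsub>D\<^esub> d) x = postcomp d (postcomp c x)"
proof (induction R k "Atom (Dom D c) :: ('do, 'ca) formula" x b rule: J.induct)
  case (J_NL R k x a g)
  then show ?case using J_typed[OF J_NL(2)] assms by (simp add: base.assoc)
qed (use assms in \<open>simp_all add: D.assoc\<close>)

definition model_unit :: "('do, 'da, ('do, 'ca) formula, ('do, 'da, 'ca, 'ea) family) fmap" where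
  "model_unit = \<lparr>omap = Atom, amap = (\<lambda>d. Family (Atom (Dom D d)) (amap \<eta> d)
     (restr (Atom (Dom D d)) (\<lambda>R k. postcomp d)) (Atom (Cod D d)))\<rparr>"

lemma model_unit_functor: "is_functor D (Tot model) model_unit"
  unfolding is_functor_def
proof (intro conjI ballI impI)
  fix d assume "d \<in> Arr D"
  then show "amap model_unit d \<in> hom (Tot model) (omap model_unit (Dom D d)) (omap model_unit (Cod D d))"
    by (simp add: model_unit_def hom_def Family_in_model natural_postcomp)
next
  fix X assume X: "X \<in> Obj D"
  have "restr (Atom X) (\<lambda>R k. postcomp (Ident D X)) = restr (Atom X) (\<lambda>R k x. x)"
    by (rule restr_cong) (rule postcomp_Ident)
  then show "amap model_unit (Ident D X) = Ident (Tot model) (omap model_unit X)"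
    using X by (simp add: model_unit_def)
next
  fix c d assume cd: "c \<in> Arr D" "d \<in> Arr D" "Cod D c = Dom D d"
  have "restr (Atom (Dom D c)) (\<lambda>R k. postcomp (c \<cdot>\<^bsub>D\<^esub> d)) =
      restr (Atom (Dom D c)) (\<lambda>R k x. restr (Atom (Dom D d)) (\<lambda>R k. postcomp d) R (k \<odot> amap p c)
        (restr (Atom (Dom D c)) (\<lambda>R k. postcomp c) R k x))"
  proof (rule restr_cong)
    fix R k x b assume j: "J R k (Atom (Dom D c)) x b"
    show "postcomp (c \<cdot>\<^bsub>D\<^esub> d) x = restr (Atom (Dom D d)) (\<lambda>R k. postcomp d) R (k \<odot> amap p c)
        (restr (Atom (Dom D c)) (\<lambda>R k. postcomp c) R k x)"
      using restr_app[OF postcomp_J[OF cd(1) j]] cd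
      by (simp add: restr_app[OF j] postcomp_postcomp[OF cd j])
  qed
  then show "amap model_unit (c \<cdot>\<^bsub>D\<^esub> d) = amap model_unit c \<cdot>\<^bsub>Tot model\<^esub> amap model_unit d"
    using cd by (simp add: model_unit_def)
qed (simp add: model_unit_def)

lemma model_unit_over: "functor_eq D (fmap_comp model_unit (Proj model)) p"
  by (simp add: functor_eq_def fmap_comp_def model_unit_def)

section \<open>The action of arrows of E on normal forms\<close>

definition model_und :: "(('do, 'ca) formula, ('do, 'da, 'ca, 'ea) family, 'eo, 'ea) fmap" where
  "model_und = \<lparr>omap = fo, amap = und\<rparr>"

lemma model_und_morphism: "bifib_morphism C model E model_und"
  by (auto simp: bifib_morphism_def is_functor_def functor_eq_def fmap_comp_def hom_def Arr_model
      model_und_def)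

text \<open>Identity expansion. For f^+ S the left inversion leaves no trace, so the right rule is
  applied to the expansion of S; \<open>posR\<close> is used because left rules of that expansion
  may take priority. For g^- T the right inversion leaves no trace and a left rule remains.\<close>

primrec iota :: "('do, 'ca) formula \<Rightarrow> ('da, 'ca) nf" where
  "iota (Atom X) = Ax (Ident D X)"
| "iota (Pos f S) = posR S S f (Ident C (Dom C f)) (iota S)"
| "iota (Neg g T) = NL (ext T (Ident C (Cod C g))) (iota T)"

lemma J_iota: "wff S \<Longrightarrow> J S (Ident C (bs S)) S (iota S) (Ident (Tot E) (fo S))"
proof (induction S)
  case (Atom X)
  then show ?case using J_Ax[of "Ident D X"] by simp
next
  case (Pos f S)
  then have "J S (Ident C (bs S)) S (iota S) (Ident (Tot E) (fo S))" by simp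
  from J_posR[OF this Pos.prems]
  show ?case using Pos.prems by (intro J_PosL) simp_all
next
  case (Neg g T)
  then have "J T (Ident C (bs T)) T (iota T) (Ident (Tot E) (fo T))" by simp
  from J_negL[OF this Neg.prems]
  show ?case using Neg.prems by (intro J_NegI) simp_all
qed

text \<open>Freeness is condensed into F. Since F followed by \<open>model_und\<close> is the
  identity, the family attached to an arrow a has a itself as its underlying arrow, and so it tracks
  composition with a.\<close>

context
  fixes F :: "('eo, 'ea, ('do, 'ca) formula, ('do, 'da, 'ca, 'ea) family) fmap"
  assumes F: "bifib_morphism C E model F" and F_unit: "functor_eq D (fmap_comp \<eta> F) model_unit"
    and F_und: "functor_eq (Tot E) (fmap_comp F model_und) \<lparr>omap = \<lambda>X. X, amap = \<lambda>a. a\<rparr>"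
begin

lemma F_simps [simp]:
  "f \<in> Arr C \<Longrightarrow> X \<in> ObjE \<Longrightarrow> po X = Dom C f \<Longrightarrow> amap F (Push E f X) = Push model f (omap F X)"
  "g \<in> Arr C \<Longrightarrow> X \<in> ObjE \<Longrightarrow> po X = Cod C g \<Longrightarrow> amap F (Pull E g X) = Pull model g (omap F X)"
  "d \<in> Arr D \<Longrightarrow> amap F (amap \<eta> d) = amap model_unit d"
  "Z \<in> Obj D \<Longrightarrow> omap F (omap \<eta> Z) = Atom Z"
  "a \<in> ArrE \<Longrightarrow> und (amap F a) = a"
  using F F_unit F_und unfolding bifib_morphism_def functor_eq_def fmap_comp_def
  by (simp_all add: model_unit_def model_und_def)

lemma F_functor: "is_functor (Tot E) (Tot model) F"
  using F by (simp add: bifib_morphism_def)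

lemma F_fo [simp]: "wff S \<Longrightarrow> omap F (fo S) = S"
proof (induction S)
  case (Pos f S)
  then show ?case
    using functor_simps(4)[OF F_functor, of "Push E f (fo S)", symmetric] by simp
next
  case (Neg g T)
  then show ?case
    using functor_simps(3)[OF F_functor, of "Pull E g (fo T)", symmetric] by simp
qed simp

definition act :: "'ea \<Rightarrow> ('do, 'ca) formula \<Rightarrow> 'ca \<Rightarrow> ('da, 'ca) nf \<Rightarrow> ('da, 'ca) nf" where
  "act a = fam (amap F a)"

lemma natural_act:
  assumes t: "typed S k T a"
  shows "natural S a T (act a)"
proof -
  have "fsrc (amap F a) = S" "ftgt (amap F a) = T"
    using functor_simps(3,4)[OF F_functor, of a] t by (simp_all only: F_fo model_simps)
  then show ?thesis
    using functor_simps(2)[OF F_functor, of a] t by (simp add: Arr_model act_def)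
qed

lemma act_comp:
  assumes "a \<in> ArrE" "b \<in> ArrE" "CodE a = DomE b" "DomE a = fo S" "wff S" "J R k S x c"
  shows "act (a \<star> b) R k x = act b R (k \<odot> pa a) (act a R k x)"
  using functor_simps(3)[OF F_functor assms(1)] functor_simps(6)[OF F_functor assms(1-3)] assms
  by (simp add: act_def restr_app)

lemma act_Push: "wff (Pos f S) \<Longrightarrow> J R k S x c \<Longrightarrow> act (Push E f (fo S)) R k x = posR R S f k x"
  by (simp add: act_def restr_app)

lemma act_Pull: "wff (Neg g S) \<Longrightarrow> J R k (Neg g S) x c \<Longrightarrow> act (Pull E g (fo S)) R k x = x"
  by (simp add: act_def restr_app)

text \<open>A Yoneda-style evaluation at the identity. In each case the arrow, or its composite with
  a lifting, is decomposed by functoriality of the action; naturality takes the left introductions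
  out of \<open>iota\<close>, and the side condition of \<open>J_PR\<close> ensures that
  \<open>posR\<close> yields the expected \<open>PR\<close>.\<close>

lemma act_iota: "J S f T x a \<Longrightarrow> act a S (Ident C (bs S)) (iota S) = x"
proof (induction rule: J.induct)
  case (J_Ax d)
  then show ?case
    using restr_app[OF J_iota[of "Atom (Dom D d)"], of "\<lambda>R k. postcomp d"]
    by (simp add: act_def model_unit_def)
next
  case (J_PosL R f k T x a)
  note t = J_PosL.hyps(2)
  from t have R: "wff R" "wff (Pos f R)" by simp_all
  have "x = act a R (Ident C (bs R) \<odot> f) (posR R R f (Ident C (bs R)) (iota R))"
    using J_PosL.IH t act_comp[OF _ _ _ _ _ J_iota[OF R(1)], of "Push E f (fo R)" a]
      act_Push[OF R(2) J_iota[OF R(1)]] by simp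
  also have "\<dots> = act a (Pos f R) (Ident C (Cod C f)) (iota (Pos f R))"
    using t naturalD(2)[OF natural_act[OF t], of f R "Ident C (Cod C f)" "iota (Pos f R)"]
      J_iota[OF R(2)] by simp
  finally show ?case by simp
next
  case (J_NegR R k g T x a)
  note t = J_NegR.hyps(3)
  from t have R: "wff R" "wff (Neg g T)" by simp_all
  have j: "J R k (Neg g T) (act a R (Ident C (bs R)) (iota R)) a"
    using naturalD(1)[OF natural_act[OF t] J_iota[OF R(1)]] t by simp
  show ?case
    using J_NegR.IH t act_comp[OF _ _ _ _ _ J_iota[OF R(1)], of a "Pull E g (fo T)"]
      act_Pull[OF R(2) j] by simp
next
  case (J_NL T R k x a g)
  note t = J_typed[OF J_NL.hyps(2)]
  have R: "wff R" "wff (Neg g R)" using J_NL.hyps by simp_all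
  have e: "ext T k = k" using J_NL.hyps(1) by (cases T) simp_all
  have "act (Pull E g (fo R) \<star> a) (Neg g R) (Ident C (bs (Neg g R))) (iota (Neg g R)) =
      act a (Neg g R) (Ident C (Dom C g) \<odot> g) (iota (Neg g R))"
    using t R act_comp[OF _ _ _ _ _ J_iota[OF R(2)], of "Pull E g (fo R)" a]
      act_Pull[OF R(2) J_iota[OF R(2)]] by simp
  also have "\<dots> = NL k x"
    using t R J_NL.IH naturalD(3)[OF natural_act[OF t] J_iota[OF R(1)] R(2)] by (simp add: e)
  finally show ?case .
next
  case (J_PR R m T x a h)
  note t = J_typed[OF J_PR.hyps(2)]
  have R: "wff R" using t by simp
  have j: "J R m T (act a R (Ident C (bs R)) (iota R)) a"
    using naturalD(1)[OF natural_act[OF t] J_iota[OF R(1)]] t by simp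
  show ?case
    using t J_PR.IH J_PR.hyps(3) act_comp[OF _ _ _ _ _ J_iota[OF R(1)], of a "Push E h (fo T)"]
      act_Push[OF J_PR.hyps(3) j] posR_not_left_first[OF J_PR.hyps(1,4), of h] by simp
qed

lemma act_iota_bij:
  assumes "wff S" "wff T" "f \<in> Arr C" "Dom C f = bs S" "Cod C f = bs T"
  shows "bij_betw (\<lambda>a. act a S (Ident C (bs S)) (iota S))
    {a \<in> hom (Tot E) (fo S) (fo T). pa a = f} {x. \<exists>a. J S f T x a}"
proof (rule bij_betwI')
  have j: "J S f T (act a S (Ident C (bs S)) (iota S)) a"
    if "a \<in> {a \<in> hom (Tot E) (fo S) (fo T). pa a = f}" for a
  proof -
    have t: "typed S f T a" using that assms by (auto simp: hom_def)
    show ?thesis using naturalD(1)[OF natural_act[OF t] J_iota[OF assms(1)]] t by simp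
  qed
  show "act a S (Ident C (bs S)) (iota S) = act b S (Ident C (bs S)) (iota S) \<longleftrightarrow> a = b"
    if "a \<in> {a \<in> hom (Tot E) (fo S) (fo T). pa a = f}"
      "b \<in> {a \<in> hom (Tot E) (fo S) (fo T). pa a = f}" for a b
    using J_functional[OF j[OF that(1)]] j[OF that(2)] by auto
  show "act a S (Ident C (bs S)) (iota S) \<in> {x. \<exists>a. J S f T x a}"
    if "a \<in> {a \<in> hom (Tot E) (fo S) (fo T). pa a = f}" for a
    using j[OF that] by blast
  show "\<exists>a\<in>{a \<in> hom (Tot E) (fo S) (fo T). pa a = f}. x = act a S (Ident C (bs S)) (iota S)"
    if x: "x \<in> {x. \<exists>a. J S f T x a}" for x
  proof -
    obtain a where a: "J S f T x a" using x by blast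
    show ?thesis using act_iota[OF a] J_typed[OF a] by (intro bexI[of _ a]) (auto simp: hom_def)
  qed
qed

end

end

theorem free_bifibration_normal_forms:
  fixes Bif :: "('u, 'u, 'co, 'ca) bifib"
  assumes C: "category C" and D: "category D" and p: "is_functor D C p"
    and fp: "factorization_preordered C"
    and U: "infinite (UNIV :: 'u set)" "Arr C \<lesssim> (UNIV :: 'u set)" "Arr D \<lesssim> (UNIV :: 'u set)"
    and free: "free_bifibration C D p Bif \<eta>"
  shows "formulas C Bif D p \<eta>"
    and "\<lbrakk>formula_over C D p S A; formula_over C D p T B; f \<in> hom C A B\<rbrakk> \<Longrightarrow>
      \<exists>\<phi>. bij_betw \<phi>
        {\<alpha> \<in> hom (Tot Bif) (formula_obj Bif \<eta> S) (formula_obj Bif \<eta> T). amap (Proj Bif) \<alpha> = f}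
        {x. \<exists>a. formulas.J C Bif D p \<eta> S f T x a}"
proof -
  have Bif: "bifibration C Bif" "is_functor D (Tot Bif) \<eta>" "functor_eq D (fmap_comp \<eta> (Proj Bif)) p"
    using free by (simp_all add: free_bifibration_def)
  show "formulas C Bif D p \<eta>"
    using C D p fp Bif by unfold_locales
  then interpret formulas C Bif D p \<eta> .
  obtain F where F: "bifib_morphism C Bif model F" "functor_eq D (fmap_comp \<eta> F) model_unit"
    using free_bifibration_extension[OF C D U free model_bifibration model_unit_functor
        model_unit_over] by blast
  let ?id = "\<lparr>omap = \<lambda>X. X, amap = \<lambda>a. a\<rparr> :: ('u, 'u, 'u, 'u) fmap"
  \<comment> \<open>The uniqueness half of freeness, for endomorphisms: F followed by
    \<open>model_und\<close> and the identity both extend the unit, so both agree with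
    \<open>H\<close>.\<close>
  obtain H where H: "functor_eq (Tot Bif) G H"
    if "bifib_morphism C Bif Bif G" "functor_eq D (fmap_comp \<eta> G) \<eta>" for G
    using free Bif unfolding free_bifibration_def by blast
  have "bifib_morphism C Bif Bif (fmap_comp F model_und)"
    using bifib_morphism_comp[OF tot.cat proj_functor F(1) model_und_morphism] .
  moreover have "functor_eq D (fmap_comp \<eta> (fmap_comp F model_und)) \<eta>"
    using F(2) by (simp add: functor_eq_def fmap_comp_def model_und_def model_unit_def)
  ultimately have "functor_eq (Tot Bif) (fmap_comp F model_und) H" by (rule H)
  moreover have "bifib_morphism C Bif Bif ?id"
    by (simp add: bifib_morphism_def is_functor_def functor_eq_def fmap_comp_def hom_def)
  then have "functor_eq (Tot Bif) ?id H"
    by (rule H) (simp add: functor_eq_def fmap_comp_def)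
  ultimately have und: "functor_eq (Tot Bif) (fmap_comp F model_und) ?id"
    by (simp add: functor_eq_def)
  show "\<exists>\<phi>. bij_betw \<phi>
      {\<alpha> \<in> hom (Tot Bif) (formula_obj Bif \<eta> S) (formula_obj Bif \<eta> T). amap (Proj Bif) \<alpha> = f}
      {x. \<exists>a. formulas.J C Bif D p \<eta> S f T x a}"
    if "formula_over C D p S A" "formula_over C D p T B" "f \<in> hom C A B"
    using act_iota_bij[OF F und, of S T f] that by (auto simp: formula_over_iff hom_def)
qed

section \<open>Blocks of normal forms\<close>

context cat
begin

section \<open>Sequences of base arrows and their composites\<close>

primrec path :: "'co \<Rightarrow> 'ca list \<Rightarrow> 'co \<Rightarrow> bool" where
  "path A [] B \<longleftrightarrow> A = B \<and> A \<in> Obj C"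
| "path A (f # \<sigma>) B \<longleftrightarrow> f \<in> Arr C \<and> Dom C f = A \<and> path (Cod C f) \<sigma> B"

text \<open>Composing with a fixed arrow avoids choosing an identity for the empty sequence, unlike
  \<open>seq_comp\<close>. The bracketings of \<open>cl\<close> and \<open>cr\<close> are those
  produced by applying left, respectively right, rules one at a time.\<close>

primrec cl :: "'ca list \<Rightarrow> 'ca \<Rightarrow> 'ca" where
  "cl [] k = k"
| "cl (f # \<sigma>) k = f \<cdot> cl \<sigma> k"

primrec cr :: "'ca \<Rightarrow> 'ca list \<Rightarrow> 'ca" where
  "cr k [] = k"
| "cr k (f # \<sigma>) = cr (k \<cdot> f) \<sigma>"

lemma cr_snoc [simp]: "cr k (\<sigma> @ [f]) = cr k \<sigma> \<cdot> f"
  by (induction \<sigma> arbitrary: k) simp_all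

lemma cl_snoc: "cl (\<sigma> @ [f]) k = cl \<sigma> (f \<cdot> k)"
  by (induction \<sigma>) simp_all

lemma path_snoc [simp]: "path A (\<sigma> @ [f]) B \<longleftrightarrow> path A \<sigma> (Dom C f) \<and> f \<in> Arr C \<and> B = Cod C f"
  by (induction \<sigma> arbitrary: A) auto

lemma cl_simps [simp]:
  "path A \<sigma> B \<Longrightarrow> k \<in> Arr C \<Longrightarrow> Dom C k = B
    \<Longrightarrow> cl \<sigma> k \<in> Arr C \<and> Dom C (cl \<sigma> k) = A \<and> Cod C (cl \<sigma> k) = Cod C k"
  by (induction \<sigma> arbitrary: A) auto

lemma cr_simps [simp]:
  "path A \<sigma> B \<Longrightarrow> k \<in> Arr C \<Longrightarrow> Cod C k = A
    \<Longrightarrow> cr k \<sigma> \<in> Arr C \<and> Dom C (cr k \<sigma>) = Dom C k \<and> Cod C (cr k \<sigma>) = B"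
  by (induction \<sigma> arbitrary: A k) auto

lemma cr_Comp:
  "\<lbrakk>path B \<tau> B'; e \<in> Arr C; Cod C e = B; f \<in> Arr C; Cod C f = Dom C e\<rbrakk> \<Longrightarrow> cr (f \<cdot> e) \<tau> = f \<cdot> cr e \<tau>"
  by (induction \<tau> arbitrary: e B) (auto simp: assoc)

lemma cr_cl:
  "\<lbrakk>path A \<sigma> A'; path B \<tau> B'; e \<in> Arr C; Dom C e = A'; Cod C e = B\<rbrakk> \<Longrightarrow> cr (cl \<sigma> e) \<tau> = cl \<sigma> (cr e \<tau>)"
proof (induction \<sigma> arbitrary: A)
  case (Cons f \<sigma>)
  have "path (Cod C f) \<sigma> A'" using Cons.prems by simp
  from cl_simps[OF this] Cons.IH[OF this] Cons.prems show ?case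
    by (simp add: cr_Comp[of B \<tau> B'])
qed simp

lemma seq_comp_simps:
  "\<lbrakk>path A \<sigma> B; \<sigma> = [] \<Longrightarrow> X = A\<rbrakk>
    \<Longrightarrow> seq_comp C X \<sigma> \<in> Arr C \<and> Dom C (seq_comp C X \<sigma>) = A \<and> Cod C (seq_comp C X \<sigma>) = B"
proof (induction \<sigma> arbitrary: A)
  case (Cons f \<sigma>)
  then show ?case by (cases \<sigma>) auto
qed simp

lemma seq_comp_cl:
  "\<lbrakk>path A \<sigma> B; \<sigma> = [] \<Longrightarrow> X = A; k \<in> Arr C; Dom C k = B\<rbrakk> \<Longrightarrow> seq_comp C X \<sigma> \<cdot> k = cl \<sigma> k"
proof (induction \<sigma> arbitrary: A)
  case (Cons f \<sigma>)
  show ?case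
  proof (cases \<sigma>)
    case (Cons g \<sigma>')
    have p: "path (Cod C f) \<sigma> B" using Cons.prems by simp
    show ?thesis
      using Cons Cons.prems Cons.IH[OF p] seq_comp_simps[OF p, of X] by (simp add: assoc)
  qed simp
qed simp

lemma seq_comp_cr:
  "\<lbrakk>path A \<tau> B; \<tau> = [] \<Longrightarrow> X = A; k \<in> Arr C; Cod C k = A\<rbrakk> \<Longrightarrow> k \<cdot> seq_comp C X \<tau> = cr k \<tau>"
proof (induction \<tau> arbitrary: A k)
  case (Cons f \<tau>)
  show ?case
  proof (cases \<tau>)
    case (Cons g \<tau>')
    have p: "path (Cod C f) \<tau> B" using Cons.prems by simp
    show ?thesis
      using Cons Cons.prems Cons.IH[OF p, of "k \<cdot> f"] seq_comp_simps[OF p, of X]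
      by (simp add: assoc)
  qed simp
qed simp

text \<open>The objects X and Y only name identities, so they are constrained just for empty
  sequences. This brings the mediating arrow e into the form used for blocks.\<close>

lemma fact_le_iff:
  assumes "path A \<sigma> A'" "path B \<tau> B'" "\<sigma> = [] \<Longrightarrow> X = A" "\<tau> = [] \<Longrightarrow> Y = B"
  shows "fact_le C (seq_comp C X \<sigma>, f) (m, seq_comp C Y \<tau>) \<longleftrightarrow>
    (\<exists>e\<in>Arr C. Dom C e = A' \<and> Cod C e = B \<and> m = cl \<sigma> e \<and> f = cr e \<tau>)"
  using seq_comp_simps[OF assms(1,3)] seq_comp_simps[OF assms(2,4)]
    seq_comp_cl[OF assms(1,3)] seq_comp_cr[OF assms(2,4)]
  by (auto simp: fact_le_def hom_def)

primrec negLs :: "'ca list \<Rightarrow> ('do, 'ca) formula \<Rightarrow> 'ca \<Rightarrow> ('da, 'ca) nf \<Rightarrow> ('da, 'ca) nf" where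
  "negLs [] T k x = x"
| "negLs (g # \<sigma>) T k x = NL (ext T (cl \<sigma> k)) (negLs \<sigma> T k x)"

primrec posRs :: "('do, 'ca) formula \<Rightarrow> 'ca list \<Rightarrow> ('do, 'ca) formula \<Rightarrow> 'ca \<Rightarrow> ('da, 'ca) nf \<Rightarrow>
    ('da, 'ca) nf" where
  "posRs R [] M m x = x"
| "posRs R (h # \<tau>) M m x = posRs R \<tau> (Pos h M) (m \<cdot> h) (posR R M h m x)"

lemma posRs_snoc [simp]:
  "posRs R (\<tau> @ [h]) M m x = posR R (pos_seq \<tau> M) h (cr m \<tau>) (posRs R \<tau> M m x)"
  by (induction \<tau> arbitrary: M m x) simp_all

end

section \<open>Unique decomposition of formulas into a maximal block and a core\<close>

lemma pos_seq_snoc [simp]: "pos_seq (\<tau> @ [h]) M = Pos h (pos_seq \<tau> M)"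
  by (induction \<tau> arbitrary: M) simp_all

lemma is_pos_pos_seq [simp]: "is_pos (pos_seq \<tau> M) \<longleftrightarrow> \<tau> \<noteq> [] \<or> is_pos M"
  by (induction \<tau> arbitrary: M) simp_all

lemma is_neg_neg_seq [simp]: "is_neg (neg_seq \<sigma> P) \<longleftrightarrow> \<sigma> \<noteq> [] \<or> is_neg P"
  by (cases \<sigma>) simp_all

lemma is_neg_pos_seq: "\<tau> \<noteq> [] \<Longrightarrow> \<not> is_neg (pos_seq \<tau> M)"
  by (cases \<tau> rule: rev_cases) simp_all

lemma is_pos_neg_seq: "\<sigma> \<noteq> [] \<Longrightarrow> \<not> is_pos (neg_seq \<sigma> P)"
  by (cases \<sigma>) simp_all

primrec strip_pos :: "('do, 'ca) formula \<Rightarrow> ('do, 'ca) formula" where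
  "strip_pos (Atom X) = Atom X"
| "strip_pos (Pos f S) = strip_pos S"
| "strip_pos (Neg g T) = Neg g T"

primrec strip_neg :: "('do, 'ca) formula \<Rightarrow> ('do, 'ca) formula" where
  "strip_neg (Atom X) = Atom X"
| "strip_neg (Pos f S) = Pos f S"
| "strip_neg (Neg g T) = strip_neg T"

lemma strip_pos_pos_seq [simp]: "\<not> is_pos N \<Longrightarrow> strip_pos (pos_seq \<pi> N) = N"
  by (induction \<pi> rule: rev_induct) (cases N; simp)+

lemma strip_neg_neg_seq [simp]: "\<not> is_neg P \<Longrightarrow> strip_neg (neg_seq \<rho> P) = P"
  by (induction \<rho>) (cases P; simp)+

lemma pos_seq_eqD: "pos_seq \<pi> N = pos_seq \<pi>' N' \<Longrightarrow> \<not> is_pos N \<Longrightarrow> \<not> is_pos N' \<Longrightarrow> \<pi> = \<pi>' \<and> N = N'"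
proof (induction \<pi> arbitrary: \<pi>' rule: rev_induct)
  case Nil
  then show ?case by (cases \<pi>' rule: rev_cases) auto
next
  case (snoc f \<pi>)
  then show ?case by (cases \<pi>' rule: rev_cases) auto
qed

lemma neg_seq_eqD: "neg_seq \<rho> P = neg_seq \<rho>' P' \<Longrightarrow> \<not> is_neg P \<Longrightarrow> \<not> is_neg P' \<Longrightarrow> \<rho> = \<rho>' \<and> P = P'"
proof (induction \<rho> arbitrary: \<rho>')
  case Nil
  then show ?case by (cases \<rho>') auto
next
  case (Cons f \<rho>)
  then show ?case by (cases \<rho>') auto
qed

lemma pos_seq_exhaust: obtains \<pi> N where "S = pos_seq \<pi> N" "\<not> is_pos N"
proof -
  have "\<exists>\<pi> N. S = pos_seq \<pi> N \<and> \<not> is_pos N"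
  proof (induction S)
    case (Pos f S)
    then obtain \<pi> N where "S = pos_seq \<pi> N" "\<not> is_pos N" by blast
    then show ?case by (intro exI[of _ "\<pi> @ [f]"] exI[of _ N]) simp
  qed (rule exI[of _ "[]"]; simp)+
  then show ?thesis using that by blast
qed

lemma neg_seq_exhaust: obtains \<rho> P where "T = neg_seq \<rho> P" "\<not> is_neg P"
proof -
  have "\<exists>\<rho> P. T = neg_seq \<rho> P \<and> \<not> is_neg P"
  proof (induction T)
    case (Neg g T)
    then obtain \<rho> P where "T = neg_seq \<rho> P" "\<not> is_neg P" by blast
    then show ?case by (intro exI[of _ "g # \<rho>"] exI[of _ P]) simp
  qed (rule exI[of _ "[]"]; simp)+
  then show ?thesis using that by blast
qed

lemma size_neg_seq: "size (neg_seq \<sigma> P) = length \<sigma> + size P"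
  by (induction \<sigma>) simp_all

lemma size_pos_seq: "size (pos_seq \<tau> M) = length \<tau> + size M"
  by (induction \<tau> arbitrary: M) simp_all

context formulas
begin

abbreviation "path \<equiv> base.path"
abbreviation "cl \<equiv> base.cl"
abbreviation "cr \<equiv> base.cr"
abbreviation "negLs \<equiv> base.negLs"
abbreviation "posRs \<equiv> base.posRs"

lemma path_neg_seq: "wff (neg_seq \<sigma> P) \<Longrightarrow> path (bs (neg_seq \<sigma> P)) \<sigma> (bs P)"
  by (induction \<sigma>) auto

lemma path_pos_seq: "wff (pos_seq \<tau> M) \<Longrightarrow> path (bs M) \<tau> (bs (pos_seq \<tau> M))"
  by (induction \<tau> rule: rev_induct) auto

lemma wff_neg_seqD: "wff (neg_seq \<sigma> P) \<Longrightarrow> wff P"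
  by (induction \<sigma>) auto

lemma wff_pos_seqD: "wff (pos_seq \<tau> M) \<Longrightarrow> wff M"
  by (induction \<tau> rule: rev_induct) auto

text \<open>By \<open>J_functional\<close> the sequent and x determine the arrow, so the
  combinatorics of blocks can forget it.\<close>

definition H :: "('do, 'ca) formula \<Rightarrow> 'ca \<Rightarrow> ('do, 'ca) formula \<Rightarrow> ('da, 'ca) nf \<Rightarrow> bool" where
  "H S f T x \<longleftrightarrow> (\<exists>a. J S f T x a)"

abbreviation ctyped :: "('do, 'ca) formula \<Rightarrow> 'ca \<Rightarrow> ('do, 'ca) formula \<Rightarrow> bool" where
  "ctyped S f T \<equiv> wff S \<and> wff T \<and> f \<in> Arr C \<and> Dom C f = bs S \<and> Cod C f = bs T"

lemma H_typed: "H S f T x \<Longrightarrow> ctyped S f T"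
  unfolding H_def using J_typed by blast

text \<open>Inversion becomes an equivalence because the arrow required from right to left exists by
  factorization through the lifting.\<close>

lemma H_Pos_iff: "H (Pos f S) k T x \<longleftrightarrow> ctyped (Pos f S) k T \<and> H S (f \<odot> k) T x"
proof
  assume "H (Pos f S) k T x"
  then obtain a where a: "J (Pos f S) k T x a" by (auto simp: H_def)
  then show "ctyped (Pos f S) k T \<and> H S (f \<odot> k) T x"
    using J_PosD[OF a] J_typed[OF a] by (auto simp: H_def)
next
  assume r: "ctyped (Pos f S) k T \<and> H S (f \<odot> k) T x"
  then obtain a where a: "J S (f \<odot> k) T x a" by (auto simp: H_def)
  note t = J_typed[OF a]
  obtain b where "b \<in> ArrE" "DomE b = push_obj E f (fo S)" "CodE b = CodE a" "pa b = k"
    "Push E f (fo S) \<star> b = a"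
    by (rule push_factor[of f "fo S" k a]) (use r t in auto)
  then have "J (Pos f S) k T x b"
    using a r t by (intro J_PosL) auto
  then show "H (Pos f S) k T x" by (auto simp: H_def)
qed

lemma H_Neg_iff: "H S k (Neg g T) x \<longleftrightarrow> ctyped S k (Neg g T) \<and> H S (k \<odot> g) T x"
proof
  assume "H S k (Neg g T) x"
  then obtain a where a: "J S k (Neg g T) x a" by (auto simp: H_def)
  then show "ctyped S k (Neg g T) \<and> H S (k \<odot> g) T x"
    using J_NegD[OF a] J_typed[OF a] by (auto simp: H_def)
next
  assume r: "ctyped S k (Neg g T) \<and> H S (k \<odot> g) T x"
  then obtain a where a: "J S (k \<odot> g) T x a" by (auto simp: H_def)
  note t = J_typed[OF a]
  obtain b where "b \<in> ArrE" "DomE b = DomE a" "CodE b = pull_obj E g (fo T)" "pa b = k"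
    "b \<star> Pull E g (fo T) = a"
    by (rule pull_factor[of g "fo T" k a]) (use r t in auto)
  then have "J S k (Neg g T) x b"
    using a r t by (intro J_NegI) auto
  then show "H S k (Neg g T) x" by (auto simp: H_def)
qed

lemma H_Atom_iff: "H (Atom X) f (Atom Y) x \<longleftrightarrow> (\<exists>d\<in>hom D X Y. amap p d = f \<and> x = Ax d)"
proof
  assume "H (Atom X) f (Atom Y) x"
  then obtain a where "J (Atom X) f (Atom Y) x a" by (auto simp: H_def)
  then show "\<exists>d\<in>hom D X Y. amap p d = f \<and> x = Ax d"
    by (cases rule: J.cases) (auto simp: hom_def)
qed (auto simp: H_def hom_def intro: J_Ax)

section \<open>The pushout square for one left and one right connective\<close>

lemma H_negL: "H R k T x \<Longrightarrow> wff (Neg g R) \<Longrightarrow> H (Neg g R) (g \<odot> k) T (NL (ext T k) x)"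
  unfolding H_def using J_negL by blast

lemma H_posR: "H R m T x \<Longrightarrow> wff (Pos h T) \<Longrightarrow> H R (m \<odot> h) (Pos h T) (posR R T h m x)"
  unfolding H_def using J_posR by blast

lemma H_Neg_Atom:
  assumes "H (Neg g S) f (Atom Y) u"
  shows "\<exists>k x. f = g \<odot> k \<and> H S k (Atom Y) x \<and> u = NL k x"
proof -
  obtain a where "J (Neg g S) f (Atom Y) u a" using assms by (auto simp: H_def)
  then show ?thesis by (cases rule: J.cases) (auto simp: H_def)
qed

lemma H_Atom_Pos:
  assumes "H (Atom X) f (Pos h T) u"
  shows "\<exists>m x. f = m \<odot> h \<and> H (Atom X) m T x \<and> u = posR (Atom X) T h m x"
proof -
  obtain a where "J (Atom X) f (Pos h T) u a" using assms by (auto simp: H_def)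
  then show ?thesis by (cases rule: J.cases) (auto simp: H_def)
qed

text \<open>The two legs are jointly surjective: a final \<open>PR\<close> satisfies the side
  condition, and so is a value of \<open>posR\<close>.\<close>

lemma H_Neg_Pos:
  assumes "H (Neg g S) f (Pos h T) u"
  shows "(\<exists>k x. f = g \<odot> k \<and> H S k (Pos h T) x \<and> u = NL k x) \<or>
    (\<exists>m x. f = m \<odot> h \<and> H (Neg g S) m T x \<and> u = posR (Neg g S) T h m x)"
proof -
  obtain a where a: "J (Neg g S) f (Pos h T) u a" using assms by (auto simp: H_def)
  have "\<not> is_pos (Neg g S)" by simp
  with a show ?thesis
  proof (cases rule: J_to_Pos_cases)
    case (PR m y c')
    then have "f = m \<odot> h \<and> H (Neg g S) m T y \<and> u = posR (Neg g S) T h m y"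
      by (auto simp: H_def posR_not_left_first)
    then show ?thesis by blast
  qed (auto simp: H_def)
qed

lemma posR_negL:
  assumes "H S e T z" "wff (Neg g S)"
  shows "posR (Neg g S) T h (g \<odot> e) (NL (ext T e) z) = NL (e \<odot> h) (posR S T h e z)"
  using H_typed[OF assms(1)] assms(2) by (intro posR_fac) (auto simp: base.fac_def)

lemma negL_inject:
  assumes "H R k T x" "H R k' T x'" "wff (Neg g R)" "g \<odot> k = g \<odot> k'"
    "NL (ext T k) x = NL (ext T k') x'"
  shows "k = k' \<and> x = x'"
  using ext_cancel[of T k k' g] H_typed[OF assms(1)] H_typed[OF assms(2)] assms(3-5) by simp

lemma left_first_cases:
  assumes "H R m T x" "left_first C R m T x"
  obtains g S e y where "R = Neg g S" "m = g \<odot> e" "x = NL (ext T e) y" "H S e T y" "wff (Neg g S)"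
    "posR R T h m x = NL (e \<odot> h) (posR S T h e y)"
proof -
  obtain g S y e where R: "R = Neg g S" and x: "x = NL (ext T e) y" and m: "m = g \<odot> e"
    and e: "fac g T (g \<odot> e) (ext T e) e" "e \<in> Arr C" "Dom C e = Cod C g"
    using assms(2) by (auto simp: left_first_def base.fac_def)
  have t: "ctyped (Neg g S) (g \<odot> e) T" using H_typed[OF assms(1)] by (simp add: R m)
  then have "Cod C e = bs T" using fac_Cod[OF e(1)] by simp
  then have y: "H S e T y"
    using assms(1) J_negL_D[of g S e T y] e by (auto simp: R x m H_def)
  show ?thesis
    by (rule that[OF R m x y]) (use t posR_negL[OF y, of g h] in \<open>simp_all add: R x m\<close>)
qed

text \<open>Under an inverted f^+ the induction yields equal composites with f, while the end
  sequent yields equal composites with h; \<open>fp_cancel\<close> does the rest. For a negative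
  source the head constructor tells whether an exchange took place.\<close>

lemma posR_inject:
  "\<lbrakk>H R m T x; H R m' T x'; wff (Pos h T); m \<odot> h = m' \<odot> h; posR R T h m x = posR R T h m' x'\<rbrakk>
    \<Longrightarrow> m = m' \<and> x = x'"
proof (induction R arbitrary: m m' x x')
  case (Pos f R)
  note t = H_typed[OF Pos.prems(1)] H_typed[OF Pos.prems(2)]
  have "f \<odot> m = f \<odot> m' \<and> x = x'"
  proof (rule Pos.IH)
    show "f \<odot> m \<odot> h = f \<odot> m' \<odot> h" using t Pos.prems(3,4) by (simp add: base.assoc)
  qed (use Pos.prems in \<open>simp_all add: H_Pos_iff\<close>)
  then show ?case
    using t Pos.prems(3,4) fp_cancel[of f m m' h] by simp
next
  case (Atom X)
  then show ?case by simp
next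
  case (Neg g R)
  consider (LL) "left_first C (Neg g R) m T x" "left_first C (Neg g R) m' T x'"
    | (LR) "left_first C (Neg g R) m T x" "\<not> left_first C (Neg g R) m' T x'"
    | (RL) "\<not> left_first C (Neg g R) m T x" "left_first C (Neg g R) m' T x'"
    | (RR) "\<not> left_first C (Neg g R) m T x" "\<not> left_first C (Neg g R) m' T x'" by blast
  then show ?case
  proof cases
    case LL
    obtain e y where e: "m = g \<odot> e" "x = NL (ext T e) y" "H R e T y"
      "posR (Neg g R) T h m x = NL (e \<odot> h) (posR R T h e y)"
      by (rule left_first_cases[OF Neg.prems(1) LL(1), of h]) auto
    obtain e' y' where e': "m' = g \<odot> e'" "x' = NL (ext T e') y'" "H R e' T y'"
      "posR (Neg g R) T h m' x' = NL (e' \<odot> h) (posR R T h e' y')"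
      by (rule left_first_cases[OF Neg.prems(2) LL(2), of h]) auto
    have "e = e' \<and> y = y'"
      by (rule Neg.IH[OF e(3) e'(3) Neg.prems(3)]) (use Neg.prems(5) e(4) e'(4) in auto)
    then show ?thesis by (simp add: e(1,2) e'(1,2))
  next
    case LR
    have "posR (Neg g R) T h m' x' = PR m' x'" using LR(2) by (intro posR_not_left_first) simp_all
    then show ?thesis
      using left_first_cases[OF Neg.prems(1) LR(1), of h] Neg.prems(5) by (metis nf.distinct(5))
  next
    case RL
    have "posR (Neg g R) T h m x = PR m x" using RL(1) by (intro posR_not_left_first) simp_all
    then show ?thesis
      using left_first_cases[OF Neg.prems(2) RL(2), of h] Neg.prems(5) by (metis nf.distinct(5))
  next
    case RR
    have "posR (Neg g R) T h m x = PR m x" "posR (Neg g R) T h m' x' = PR m' x'"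
      using RR by (auto intro: posR_not_left_first)
    with Neg.prems(5) show ?thesis by (simp only: nf.inject)
  qed
qed

text \<open>The legs meet only over S -> T: \<open>posR\<close> produces \<open>NL\<close> only by
  an exchange, whose witness e gives the common premise.\<close>

lemma negL_eq_posR:
  assumes "H (Neg g S) m T y" "NL k x = posR (Neg g S) T h m y"
  shows "\<exists>e z. H S e T z \<and> k = e \<odot> h \<and> m = g \<odot> e \<and> x = posR S T h e z \<and> y = NL (ext T e) z"
proof (cases "left_first C (Neg g S) m T y")
  case True
  show ?thesis
    by (rule left_first_cases[OF assms(1) True, of h]) (use assms(2) in auto)
next
  case False
  then show ?thesis using posR_not_left_first[of "Neg g S" m T y h] assms(2) by simp
qed

section \<open>The pushout square for blocks\<close>

lemma H_negLs: "H P k T x \<Longrightarrow> wff (neg_seq \<sigma> P) \<Longrightarrow> H (neg_seq \<sigma> P) (cl \<sigma> k) T (negLs \<sigma> T k x)"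
  by (induction \<sigma>) (simp_all add: H_negL)

lemma H_posRs: "H R m M x \<Longrightarrow> wff (pos_seq \<tau> M) \<Longrightarrow> H R (cr m \<tau>) (pos_seq \<tau> M) (posRs R \<tau> M m x)"
  by (induction \<tau> rule: rev_induct) (simp_all add: H_posR)

lemma negLs_inject:
  assumes "H P k T x" "H P k' T x'"
  shows "\<lbrakk>wff (neg_seq \<sigma> P); cl \<sigma> k = cl \<sigma> k'; negLs \<sigma> T k x = negLs \<sigma> T k' x'\<rbrakk> \<Longrightarrow> k = k' \<and> x = x'"
proof (induction \<sigma>)
  case (Cons g \<sigma>)
  have w: "wff (neg_seq \<sigma> P)" "wff (Neg g (neg_seq \<sigma> P))" using Cons.prems(1) by simp_all
  have "cl \<sigma> k = cl \<sigma> k' \<and> negLs \<sigma> T k x = negLs \<sigma> T k' x'"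
    by (rule negL_inject[OF H_negLs[OF assms(1) w(1)] H_negLs[OF assms(2) w(1)] w(2)])
      (use Cons.prems(2,3) in simp_all)
  then show ?case using Cons.IH[OF w(1)] by simp
qed simp

lemma posRs_inject:
  assumes "H R m M x" "H R m' M x'"
  shows "\<lbrakk>wff (pos_seq \<tau> M); cr m \<tau> = cr m' \<tau>; posRs R \<tau> M m x = posRs R \<tau> M m' x'\<rbrakk> \<Longrightarrow> m = m' \<and> x = x'"
proof (induction \<tau> rule: rev_induct)
  case (snoc h \<tau>)
  have w: "wff (pos_seq \<tau> M)" "wff (Pos h (pos_seq \<tau> M))" using snoc.prems(1) by simp_all
  have "cr m \<tau> = cr m' \<tau> \<and> posRs R \<tau> M m x = posRs R \<tau> M m' x'"
    by (rule posR_inject[OF H_posRs[OF assms(1) w(1)] H_posRs[OF assms(2) w(1)] w(2)])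
      (use snoc.prems(2,3) in simp_all)
  then show ?case using snoc.IH[OF w(1)] by simp
qed simp

lemma posRs_negL:
  assumes e: "H S e M z" and g: "wff (Neg g S)"
  shows "wff (pos_seq \<tau> M) \<Longrightarrow> posRs (Neg g S) \<tau> M (g \<odot> e) (NL (ext M e) z) =
    NL (ext (pos_seq \<tau> M) (cr e \<tau>)) (posRs S \<tau> M e z)"
proof (induction \<tau> rule: rev_induct)
  case (snoc h \<tau>)
  have w: "wff (pos_seq \<tau> M)" using snoc.prems by simp
  have "cr (g \<odot> e) \<tau> = g \<odot> cr e \<tau>"
    using base.cr_Comp[OF path_pos_seq[OF w], of e g] H_typed[OF e] g by simp
  then show ?case
    using snoc.IH[OF w] posR_negL[OF H_posRs[OF e w] g, of h] by simp
qed simp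

lemma cr_cl_formula:
  assumes "ctyped P e M" "wff (neg_seq \<sigma> P)" "wff (pos_seq \<tau> M)"
  shows "cr (cl \<sigma> e) \<tau> = cl \<sigma> (cr e \<tau>)"
  using base.cr_cl[OF path_neg_seq[OF assms(2)] path_pos_seq[OF assms(3)]] assms(1) by simp

lemma posRs_negLs:
  assumes e: "H P e M z" and \<tau>: "wff (pos_seq \<tau> M)"
  shows "wff (neg_seq \<sigma> P) \<Longrightarrow> posRs (neg_seq \<sigma> P) \<tau> M (cl \<sigma> e) (negLs \<sigma> M e z) =
    negLs \<sigma> (pos_seq \<tau> M) (cr e \<tau>) (posRs P \<tau> M e z)"
proof (induction \<sigma>)
  case (Cons g \<sigma>)
  have w: "wff (neg_seq \<sigma> P)" "wff (Neg g (neg_seq \<sigma> P))" using Cons.prems by simp_all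
  show ?case
    using posRs_negL[OF H_negLs[OF e w(1)] w(2) \<tau>] Cons.IH[OF w(1)]
      cr_cl_formula[OF H_typed[OF e] w(1) \<tau>] by simp
qed simp

lemma negL_eq_posRs:
  assumes "wff (Neg g S)" "H (Neg g S) m M y"
  shows "\<lbrakk>wff (pos_seq \<tau> M); H S k (pos_seq \<tau> M) x; g \<odot> k = cr m \<tau>;
      NL (ext (pos_seq \<tau> M) k) x = posRs (Neg g S) \<tau> M m y\<rbrakk>
    \<Longrightarrow> \<exists>e z. H S e M z \<and> k = cr e \<tau> \<and> m = g \<odot> e \<and> x = posRs S \<tau> M e z \<and> y = NL (ext M e) z"
proof (induction \<tau> arbitrary: k x rule: rev_induct)
  case Nil
  then show ?case by (intro exI[of _ k] exI[of _ x]) simp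
next
  case (snoc h \<tau>)
  have w: "wff (pos_seq \<tau> M)" using snoc.prems(1) by simp
  obtain e z where e: "H S e (pos_seq \<tau> M) z" "k = e \<odot> h" "cr m \<tau> = g \<odot> e"
    "x = posR S (pos_seq \<tau> M) h e z" "posRs (Neg g S) \<tau> M m y = NL (ext (pos_seq \<tau> M) e) z"
    using negL_eq_posR[OF H_posRs[OF assms(2) w], of k x h] snoc.prems(4) by auto
  from snoc.IH[OF w e(1) e(3)[symmetric] e(5)[symmetric]] show ?case
    using e by auto
qed

text \<open>The connectives of the left block are peeled off one by one; at each stage the whole
  right block moves past one left rule, and the common premise moves up.\<close>

lemma negLs_eq_posRs:
  assumes k: "H P k (pos_seq \<tau> M) x" and w: "wff (pos_seq \<tau> M)"
  shows "\<lbrakk>wff (neg_seq \<sigma> P); H (neg_seq \<sigma> P) m M y; cl \<sigma> k = cr m \<tau>;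
      negLs \<sigma> (pos_seq \<tau> M) k x = posRs (neg_seq \<sigma> P) \<tau> M m y\<rbrakk>
    \<Longrightarrow> \<exists>e z. H P e M z \<and> k = cr e \<tau> \<and> m = cl \<sigma> e \<and> x = posRs P \<tau> M e z \<and> y = negLs \<sigma> M e z"
proof (induction \<sigma> arbitrary: m y)
  case Nil
  then show ?case by (intro exI[of _ m] exI[of _ y]) simp
next
  case (Cons g \<sigma>)
  have s: "wff (neg_seq \<sigma> P)" "wff (Neg g (neg_seq \<sigma> P))" using Cons.prems(1) by simp_all
  obtain e z where e: "H (neg_seq \<sigma> P) e M z" "cl \<sigma> k = cr e \<tau>" "m = g \<odot> e"
    "negLs \<sigma> (pos_seq \<tau> M) k x = posRs (neg_seq \<sigma> P) \<tau> M e z" "y = NL (ext M e) z"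
    using negL_eq_posRs[OF s(2) _ w H_negLs[OF k s(1)], of m y] Cons.prems(2-4) by auto
  from Cons.IH[OF s(1) e(1,2,4)] show ?case using e(3,5) by auto
qed

lemma H_Neg_pos_seq:
  "H (Neg g S) f (pos_seq \<tau> M) u \<Longrightarrow>
    (\<exists>k x. f = g \<odot> k \<and> H S k (pos_seq \<tau> M) x \<and> u = NL (ext (pos_seq \<tau> M) k) x) \<or>
    (\<exists>m y. f = cr m \<tau> \<and> H (Neg g S) m M y \<and> u = posRs (Neg g S) \<tau> M m y)"
proof (induction \<tau> arbitrary: f u rule: rev_induct)
  case (snoc h \<tau>)
  note t = H_typed[OF snoc.prems]
  have w: "wff (Neg g S)" "wff (Pos h (pos_seq \<tau> M))" using t by simp_all
  from snoc.prems have "H (Neg g S) f (Pos h (pos_seq \<tau> M)) u" by simp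
  from H_Neg_Pos[OF this] show ?case
  proof (elim disjE exE conjE)
    fix m x assume m: "f = m \<odot> h" "H (Neg g S) m (pos_seq \<tau> M) x"
      "u = posR (Neg g S) (pos_seq \<tau> M) h m x"
    from snoc.IH[OF m(2)] show ?case
    proof (elim disjE exE conjE)
      \<comment> \<open>The shorter right block leaves a left rule at the end of x. By
        \<open>posR_negL\<close> the remaining right rule moves above it, so u ends with a left rule
        too.\<close>
      fix k z assume k: "m = g \<odot> k" "H S k (pos_seq \<tau> M) z" "x = NL (ext (pos_seq \<tau> M) k) z"
      have "f = g \<odot> (k \<odot> h)"
        using H_typed[OF k(2)] w by (simp add: m(1) k(1) base.assoc)
      moreover have "u = NL (k \<odot> h) (posR S (pos_seq \<tau> M) h k z)"
        using posR_negL[OF k(2) w(1), of h] by (simp add: m(3) k(1,3))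
      ultimately show ?case using H_posR[OF k(2) w(2)] by auto
    next
      fix m' y assume "m = cr m' \<tau>" "H (Neg g S) m' M y" "x = posRs (Neg g S) \<tau> M m' y"
      then show ?case using m by auto
    qed
  qed auto
qed auto

lemma H_neg_seq_pos_seq:
  "H (neg_seq \<sigma> P) f (pos_seq \<tau> M) u \<Longrightarrow>
    (\<exists>k x. f = cl \<sigma> k \<and> H P k (pos_seq \<tau> M) x \<and> u = negLs \<sigma> (pos_seq \<tau> M) k x) \<or>
    (\<exists>m y. f = cr m \<tau> \<and> H (neg_seq \<sigma> P) m M y \<and> u = posRs (neg_seq \<sigma> P) \<tau> M m y)"
proof (induction \<sigma> arbitrary: f u)
  case (Cons g \<sigma>)
  note t = H_typed[OF Cons.prems]
  have w: "wff (Neg g (neg_seq \<sigma> P))" "wff (pos_seq \<tau> M)" using t by simp_all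
  from Cons.prems have "H (Neg g (neg_seq \<sigma> P)) f (pos_seq \<tau> M) u" by simp
  from H_Neg_pos_seq[OF this] show ?case
  proof (elim disjE exE conjE)
    fix k x assume k: "f = g \<odot> k" "H (neg_seq \<sigma> P) k (pos_seq \<tau> M) x"
      "u = NL (ext (pos_seq \<tau> M) k) x"
    from Cons.IH[OF k(2)] show ?case
    proof (elim disjE exE conjE)
      fix m y assume m: "k = cr m \<tau>" "H (neg_seq \<sigma> P) m M y" "x = posRs (neg_seq \<sigma> P) \<tau> M m y"
      have "f = cr (g \<odot> m) \<tau>"
        using base.cr_Comp[OF path_pos_seq[OF w(2)], of m g] H_typed[OF m(2)] w(1) by (simp add: k m)
      moreover have "u = posRs (Neg g (neg_seq \<sigma> P)) \<tau> M (g \<odot> m) (NL (ext M m) y)"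
        using posRs_negL[OF m(2) w] by (simp add: k(3) m(1,3))
      ultimately show ?case using H_negL[OF m(2) w(1)] by auto
    qed (use k in auto)
  qed auto
qed auto

lemma H_neg_seq_Atom:
  "H (neg_seq \<sigma> P) f (Atom Y) u \<Longrightarrow>
    \<exists>k x. f = cl \<sigma> k \<and> H P k (Atom Y) x \<and> u = negLs \<sigma> (Atom Y) k x"
proof (induction \<sigma> arbitrary: f u)
  case (Cons g \<sigma>)
  from Cons.prems have "H (Neg g (neg_seq \<sigma> P)) f (Atom Y) u" by simp
  from H_Neg_Atom[OF this]
  obtain k x where k: "f = g \<odot> k" "H (neg_seq \<sigma> P) k (Atom Y) x" "u = NL k x" by blast
  from Cons.IH[OF k(2)] show ?case using k by auto
qed auto

lemma H_Atom_pos_seq: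
  "H (Atom X) f (pos_seq \<tau> M) u \<Longrightarrow>
    \<exists>m x. f = cr m \<tau> \<and> H (Atom X) m M x \<and> u = posRs (Atom X) \<tau> M m x"
proof (induction \<tau> arbitrary: f u rule: rev_induct)
  case (snoc h \<tau>)
  from snoc.prems have "H (Atom X) f (Pos h (pos_seq \<tau> M)) u" by simp
  from H_Atom_Pos[OF this]
  obtain m x where m: "f = m \<odot> h" "H (Atom X) m (pos_seq \<tau> M) x"
    "u = posR (Atom X) (pos_seq \<tau> M) h m x" by blast
  from snoc.IH[OF m(2)] show ?case using m by auto
qed auto

section \<open>Maximally multifocused proofs as normal forms\<close>

text \<open>Inversions leave no trace. In a bi-focus the right block is placed above the left one,
  which therefore acts over \<open>cr g \<tau>\<close>; by \<open>posRs_negLs\<close> the opposite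
  order gives the same tree.\<close>

primrec enc :: "('da, 'ca) mproof \<Rightarrow> ('do, 'ca) formula \<Rightarrow> ('do, 'ca) formula \<Rightarrow> ('da, 'ca) nf" where
  "enc (Axiom d) S T = Ax d"
| "enc (Inversion \<pi> \<rho> e) S T = enc e (strip_pos S) (strip_neg T)"
| "enc (LeftFocus \<sigma> g e) S T = negLs \<sigma> T g (enc e (strip_neg S) T)"
| "enc (RightFocus g \<tau> e) S T = posRs S \<tau> (strip_pos T) g (enc e S (strip_pos T))"
| "enc (BiFocus \<sigma> g \<tau> e) S T = negLs \<sigma> T (cr g \<tau>)
    (posRs (strip_neg S) \<tau> (strip_pos T) g (enc e (strip_neg S) (strip_pos T)))"

text \<open>\<open>x\<close> can be put in a form that ends with a left (right) focus on the whole maximal block.\<close>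

definition left_block :: "('do, 'ca) formula \<Rightarrow> 'ca \<Rightarrow> ('do, 'ca) formula \<Rightarrow> ('da, 'ca) nf \<Rightarrow>
    'ca list \<Rightarrow> ('do, 'ca) formula \<Rightarrow> 'ca \<Rightarrow> ('da, 'ca) nf \<Rightarrow> bool" where
  "left_block N h T x \<sigma> P k y \<longleftrightarrow> \<sigma> \<noteq> [] \<and> N = neg_seq \<sigma> P \<and> \<not> is_neg P \<and> H P k T y \<and> wff N \<and>
     h = cl \<sigma> k \<and> x = negLs \<sigma> T k y"

definition right_block :: "('do, 'ca) formula \<Rightarrow> 'ca \<Rightarrow> ('do, 'ca) formula \<Rightarrow> ('da, 'ca) nf \<Rightarrow>
    'ca list \<Rightarrow> ('do, 'ca) formula \<Rightarrow> 'ca \<Rightarrow> ('da, 'ca) nf \<Rightarrow> bool" where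
  "right_block S h P x \<tau> M m y \<longleftrightarrow> \<tau> \<noteq> [] \<and> P = pos_seq \<tau> M \<and> \<not> is_pos M \<and> H S m M y \<and> wff P \<and>
     h = cr m \<tau> \<and> x = posRs S \<tau> M m y"

definition inL where "inL N h T x \<longleftrightarrow> (\<exists>\<sigma> P k y. left_block N h T x \<sigma> P k y)"
definition inR where "inR S h P x \<longleftrightarrow> (\<exists>\<tau> M m y. right_block S h P x \<tau> M m y)"

lemma left_block_unique:
  assumes "left_block N h T x \<sigma> P k y" "left_block N h T x \<sigma>' P' k' y'"
  shows "\<sigma> = \<sigma>' \<and> P = P' \<and> k = k' \<and> y = y'"
proof -
  have "\<sigma> = \<sigma>' \<and> P = P'" using assms neg_seq_eqD[of \<sigma> P \<sigma>' P'] by (simp add: left_block_def)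
  then show ?thesis using assms negLs_inject[of P k T y k' y' \<sigma>] by (auto simp: left_block_def)
qed

lemma right_block_unique:
  assumes "right_block S h P x \<tau> M k y" "right_block S h P x \<tau>' M' k' y'"
  shows "\<tau> = \<tau>' \<and> M = M' \<and> k = k' \<and> y = y'"
proof -
  have "\<tau> = \<tau>' \<and> M = M'" using assms pos_seq_eqD[of \<tau> M \<tau>' M'] by (simp add: right_block_def)
  then show ?thesis using assms posRs_inject[of S k M y k' y' \<tau>] by (auto simp: right_block_def)
qed

lemma left_block_H: "left_block N h T x \<sigma> P k y \<Longrightarrow> H N h T x"
  using H_negLs by (auto simp: left_block_def)

lemma right_block_H: "right_block S h P x \<tau> M m y \<Longrightarrow> H S h P x"
  using H_posRs by (auto simp: right_block_def)

text \<open>This is the source of bi-focus: being in both legs of the pushout means coming from a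
  common premise.\<close>

lemma left_right_block:
  assumes L: "left_block N h P x \<sigma> P' k y" and R: "right_block N h P x \<tau> M m y'"
  shows "\<exists>e z. H P' e M z \<and> k = cr e \<tau> \<and> m = cl \<sigma> e \<and> y = posRs P' \<tau> M e z \<and> y' = negLs \<sigma> M e z"
  using assms negLs_eq_posRs[of P' k \<tau> M y \<sigma> m y'] by (auto simp: left_block_def right_block_def)

lemma bi_block:
  assumes z: "H P' e M z" and w: "wff (neg_seq \<sigma> P')" "wff (pos_seq \<tau> M)" and "\<sigma> \<noteq> []" "\<tau> \<noteq> []"
    "\<not> is_neg P'" "\<not> is_pos M"
  defines "x \<equiv> negLs \<sigma> (pos_seq \<tau> M) (cr e \<tau>) (posRs P' \<tau> M e z)"
  shows "left_block (neg_seq \<sigma> P') (cl \<sigma> (cr e \<tau>)) (pos_seq \<tau> M) x \<sigma> P' (cr e \<tau>) (posRs P' \<tau> M e z)"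
    and "right_block (neg_seq \<sigma> P') (cl \<sigma> (cr e \<tau>)) (pos_seq \<tau> M) x \<tau> M (cl \<sigma> e) (negLs \<sigma> M e z)"
  using assms H_posRs[OF z w(2)] H_negLs[OF z w(1)] posRs_negLs[OF z w(2,1)]
    cr_cl_formula[OF H_typed[OF z] w]
  by (simp_all add: left_block_def right_block_def)

text \<open>An empty block on a side of admissible polarity leaves an atom there. If only one block
  is present every normal form ends with it; if both are, the legs are jointly surjective.\<close>

lemma block_cases:
  assumes x: "H N h P x" and N: "\<not> is_pos N" "\<not> is_neg P"
  shows "(\<exists>X Y. N = Atom X \<and> P = Atom Y) \<or> inL N h P x \<or> inR N h P x"
proof -
  obtain \<sigma> P' where \<sigma>: "N = neg_seq \<sigma> P'" "\<not> is_neg P'" by (rule neg_seq_exhaust)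
  obtain \<tau> M where \<tau>: "P = pos_seq \<tau> M" "\<not> is_pos M" by (rule pos_seq_exhaust)
  note t = H_typed[OF x]
  show ?thesis
  proof (cases "\<sigma> = []")
    case s: True
    then obtain X where X: "N = Atom X" using \<sigma> N by (cases P') auto
    show ?thesis
    proof (cases "\<tau> = []")
      case True
      then show ?thesis using \<tau> N X by (cases M) auto
    next
      case False
      then have "inR N h P x"
        using H_Atom_pos_seq[of X h \<tau> M x] x X \<tau> t unfolding inR_def right_block_def by blast
      then show ?thesis by blast
    qed
  next
    case s: False
    show ?thesis
    proof (cases "\<tau> = []")
      case True
      then obtain Y where Y: "P = Atom Y" using \<tau> N by (cases M) auto
      have "inL N h P x"
        using H_neg_seq_Atom[of \<sigma> P' h Y x] x Y \<sigma> s t unfolding inL_def left_block_def by blast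
      then show ?thesis by blast
    next
      case False
      then have "inL N h P x \<or> inR N h P x"
        using H_neg_seq_pos_seq[of \<sigma> P' h \<tau> M x] x \<tau> \<sigma> s t
        unfolding inL_def left_block_def inR_def right_block_def by blast
      then show ?thesis by blast
    qed
  qed
qed

text \<open>A right block in the premise of a left focus shows up in the conclusion, by exchange.
  Read contrapositively, a normal form without a right block has a left-focus premise that the state
  L admits.\<close>

lemma inR_negLs:
  assumes "inR P' k P y" "wff (neg_seq \<sigma> P')" "\<sigma> \<noteq> []" "\<not> is_neg P'"
  shows "inR (neg_seq \<sigma> P') (cl \<sigma> k) P (negLs \<sigma> P k y)"
  using assms bi_block(2) unfolding inR_def right_block_def by blast

lemma inL_posRs:
  assumes "inL S k M y" "wff (pos_seq \<tau> M)" "\<tau> \<noteq> []" "\<not> is_pos M"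
  shows "inL S (cr k \<tau>) (pos_seq \<tau> M) (posRs S \<tau> M k y)"
proof -
  obtain \<sigma> P' e z where l: "left_block S k M y \<sigma> P' e z" using assms(1) by (auto simp: inL_def)
  then have S: "\<sigma> \<noteq> []" "S = neg_seq \<sigma> P'" "\<not> is_neg P'" "H P' e M z" "wff (neg_seq \<sigma> P')"
    "k = cl \<sigma> e" "y = negLs \<sigma> M e z" by (auto simp: left_block_def)
  show ?thesis
    using bi_block(1)[OF S(4,5) assms(2) S(1) assms(3) S(3) assms(4)]
      posRs_negLs[OF S(4) assms(2) S(5)] cr_cl_formula[OF H_typed[OF S(4)] S(5) assms(2)]
    unfolding inL_def S(2,6,7) by auto
qed

text \<open>The annotations as conditions on normal forms. A premise of a left focus must not end
  with a right block, since the two would form a bi-focus. \<open>ok_foc\<close> expresses this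
  after inversion: there a right block is forbidden only if it already existed before inversion,
  which \<open>fact_le\<close> decides.\<close>

fun ok_inv :: "inv_state \<Rightarrow> ('do, 'ca) formula \<Rightarrow> 'ca \<Rightarrow> ('do, 'ca) formula \<Rightarrow> ('da, 'ca) nf \<Rightarrow> bool" where
  "ok_inv IBot S f T x \<longleftrightarrow> True"
| "ok_inv IL S f T x \<longleftrightarrow> \<not> inR S f T x"
| "ok_inv IR S f T x \<longleftrightarrow> \<not> inL S f T x"

fun ok_foc :: "'ca foc_state \<Rightarrow> ('do, 'ca) formula \<Rightarrow> 'ca \<Rightarrow> ('do, 'ca) formula \<Rightarrow> ('da, 'ca) nf \<Rightarrow> bool" where
  "ok_foc FBot N h P x \<longleftrightarrow> True"
| "ok_foc (FL \<pi> f) N h P x \<longleftrightarrow> \<not> (\<exists>\<tau> M m y. right_block N h P x \<tau> M m y \<and>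
     fact_le C (seq_comp C (Dom C f) \<pi>, f) (m, seq_comp C (Cod C m) \<tau>))"
| "ok_foc (FR f \<rho>) N h P x \<longleftrightarrow> \<not> (\<exists>\<sigma> P' k y. left_block N h P x \<sigma> P' k y \<and>
     fact_le C (seq_comp C (Dom C k) \<sigma>, k) (f, seq_comp C (Cod C f) \<rho>))"

section \<open>Inversion of whole blocks and the side conditions of the pre-focus states\<close>

lemma H_pos_seq_iff: "H (pos_seq \<pi> N) f T x \<longleftrightarrow> ctyped (pos_seq \<pi> N) f T \<and> H N (cl \<pi> f) T x"
proof (induction \<pi> arbitrary: f rule: rev_induct)
  case (snoc g \<pi>)
  show ?case
    unfolding pos_seq_snoc H_Pos_iff snoc.IH by (auto simp: base.cl_snoc)
qed (auto dest: H_typed)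

lemma H_neg_seq_iff: "H S f (neg_seq \<rho> P) x \<longleftrightarrow> ctyped S f (neg_seq \<rho> P) \<and> H S (cr f \<rho>) P x"
proof (induction \<rho> arbitrary: f)
  case (Cons g \<rho>)
  show ?case
    unfolding neg_seq.simps H_Neg_iff Cons.IH by auto
qed (auto dest: H_typed)

lemma posR_pos_seq: "posR (pos_seq \<pi> N) T h m x = posR N T h (cl \<pi> m) x"
  by (induction \<pi> arbitrary: m rule: rev_induct) (simp_all add: base.cl_snoc)

lemma posRs_pos_seq:
  assumes "wff (pos_seq \<pi> N)"
  shows "\<lbrakk>m \<in> Arr C; Dom C m = bs (pos_seq \<pi> N); Cod C m = bs M; wff (pos_seq \<tau> M)\<rbrakk>
    \<Longrightarrow> posRs (pos_seq \<pi> N) \<tau> M m x = posRs N \<tau> M (cl \<pi> m) x"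
proof (induction \<tau> rule: rev_induct)
  case (snoc h \<tau>)
  then have w: "wff (pos_seq \<tau> M)" by simp
  show ?case
    using snoc.IH[OF snoc.prems(1-3) w] base.cr_cl[OF path_pos_seq[OF assms] path_pos_seq[OF w], of m]
      snoc.prems by (simp add: posR_pos_seq)
qed simp

lemma ext_neg_seq: "ext (neg_seq \<rho> P) k = ext P (cr k \<rho>)"
  by (induction \<rho> arbitrary: k) simp_all

lemma negLs_neg_seq:
  assumes "wff (neg_seq \<rho> P)" "k \<in> Arr C" "Dom C k = bs S" "Cod C k = bs (neg_seq \<rho> P)"
  shows "wff (neg_seq \<sigma> S) \<Longrightarrow> negLs \<sigma> (neg_seq \<rho> P) k x = negLs \<sigma> P (cr k \<rho>) x"
proof (induction \<sigma>)
  case (Cons g \<sigma>)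
  then have w: "wff (neg_seq \<sigma> S)" by simp
  show ?case
    using Cons.IH[OF w] base.cr_cl[OF path_neg_seq[OF w] path_neg_seq[OF assms(1)], of k] assms
    by (simp add: ext_neg_seq)
qed simp

text \<open>The arrow mediating in \<open>fact_le\<close> is the base arrow of the block's premise
  before inversion. A block of the inverted sequent thus comes from one of the original sequent iff
  the inequality holds.\<close>

lemma ok_inv_iff_ok_foc:
  assumes f: "f \<in> Arr C" "Dom C f = bs (pos_seq \<pi> N)" "Cod C f = bs (neg_seq \<rho> P)"
    and w: "wff (pos_seq \<pi> N)" "wff (neg_seq \<rho> P)" and pol: "\<not> is_pos N" "\<not> is_neg P"
    and q: "q = IL \<longrightarrow> \<rho> = []" "q = IR \<longrightarrow> \<pi> = []"
  shows "ok_inv q (pos_seq \<pi> N) f (neg_seq \<rho> P) x \<longleftrightarrow>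
    ok_foc (next_state q \<pi> f \<rho>) N (cl \<pi> (cr f \<rho>)) P x"
proof (cases q)
  case IL
  have \<rho>: "\<rho> = []" using q IL by simp
  have le: "fact_le C (seq_comp C (Dom C f) \<pi>, f) (m, seq_comp C (Cod C m) \<tau>) \<longleftrightarrow>
      (\<exists>e\<in>Arr C. Dom C e = bs (pos_seq \<pi> N) \<and> Cod C e = bs M \<and> m = cl \<pi> e \<and> f = cr e \<tau>)"
    if "wff (pos_seq \<tau> M)" "H N m M y" for m \<tau> M y
    using H_typed[OF that(2)] f
    by (intro base.fact_le_iff[OF path_pos_seq[OF w(1)] path_pos_seq[OF that(1)]]) auto
  \<comment> \<open>Inversion does not change the tree; it only replaces the arrow e of the block's
    premise by \<open>cl \<pi> e\<close>.\<close>
  have rb: "right_block (pos_seq \<pi> N) f P x \<tau> M e y \<longleftrightarrow> right_block N (cl \<pi> f) P x \<tau> M (cl \<pi> e) y \<and>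
      e \<in> Arr C \<and> Dom C e = bs (pos_seq \<pi> N) \<and> Cod C e = bs M \<and> f = cr e \<tau>" for \<tau> M e y
    using posRs_pos_seq[OF w(1), of e M \<tau> y] base.cr_cl[OF path_pos_seq[OF w(1)] path_pos_seq[of \<tau> M], of e] w
    unfolding right_block_def by (auto simp: H_pos_seq_iff dest: wff_pos_seqD)
  have "inR (pos_seq \<pi> N) f P x \<longleftrightarrow> (\<exists>\<tau> M m y. right_block N (cl \<pi> f) P x \<tau> M m y \<and>
      fact_le C (seq_comp C (Dom C f) \<pi>, f) (m, seq_comp C (Cod C m) \<tau>))"
  proof
    assume "inR (pos_seq \<pi> N) f P x"
    then obtain \<tau> M e y where "right_block (pos_seq \<pi> N) f P x \<tau> M e y" unfolding inR_def by blast
    then have r: "right_block N (cl \<pi> f) P x \<tau> M (cl \<pi> e) y"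
      and e: "e \<in> Arr C" "Dom C e = bs (pos_seq \<pi> N)" "Cod C e = bs M" "f = cr e \<tau>"
      unfolding rb by blast+
    from r have "wff (pos_seq \<tau> M)" "H N (cl \<pi> e) M y" by (auto simp: right_block_def)
    from le[OF this] e have "fact_le C (seq_comp C (Dom C f) \<pi>, f) (cl \<pi> e, seq_comp C (Cod C (cl \<pi> e)) \<tau>)"
      by blast
    with r show "\<exists>\<tau> M m y. right_block N (cl \<pi> f) P x \<tau> M m y \<and>
      fact_le C (seq_comp C (Dom C f) \<pi>, f) (m, seq_comp C (Cod C m) \<tau>)" by blast
  next
    assume "\<exists>\<tau> M m y. right_block N (cl \<pi> f) P x \<tau> M m y \<and>
      fact_le C (seq_comp C (Dom C f) \<pi>, f) (m, seq_comp C (Cod C m) \<tau>)"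
    then obtain \<tau> M m y where r: "right_block N (cl \<pi> f) P x \<tau> M m y"
      and m: "fact_le C (seq_comp C (Dom C f) \<pi>, f) (m, seq_comp C (Cod C m) \<tau>)" by blast
    from r have "wff (pos_seq \<tau> M)" "H N m M y" by (auto simp: right_block_def)
    from le[OF this] m r have "\<exists>e. right_block (pos_seq \<pi> N) f P x \<tau> M e y" unfolding rb by blast
    then show "inR (pos_seq \<pi> N) f P x" unfolding inR_def by blast
  qed
  then show ?thesis by (simp add: IL \<rho>)
next
  case IR
  have \<pi>: "\<pi> = []" using q IR by simp
  have le: "fact_le C (seq_comp C (Dom C k) \<sigma>, k) (f, seq_comp C (Cod C f) \<rho>) \<longleftrightarrow>
      (\<exists>e\<in>Arr C. Dom C e = bs P' \<and> Cod C e = bs (neg_seq \<rho> P) \<and> f = cl \<sigma> e \<and> k = cr e \<rho>)"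
    if "wff (neg_seq \<sigma> P')" "H P' k P y" for k \<sigma> P' y
    using H_typed[OF that(2)] f
    by (intro base.fact_le_iff[OF path_neg_seq[OF that(1)] path_neg_seq[OF w(2)]]) auto
  have lb: "left_block N f (neg_seq \<rho> P) x \<sigma> P' e y \<longleftrightarrow> left_block N (cr f \<rho>) P x \<sigma> P' (cr e \<rho>) y \<and>
      e \<in> Arr C \<and> Dom C e = bs P' \<and> Cod C e = bs (neg_seq \<rho> P) \<and> f = cl \<sigma> e" for \<sigma> P' e y
    using negLs_neg_seq[OF w(2), of e P' \<sigma> y] base.cr_cl[OF path_neg_seq[of \<sigma> P'] path_neg_seq[OF w(2)], of e] w
    unfolding left_block_def by (auto simp: H_neg_seq_iff dest: wff_neg_seqD)
  have "inL N f (neg_seq \<rho> P) x \<longleftrightarrow> (\<exists>\<sigma> P' k y. left_block N (cr f \<rho>) P x \<sigma> P' k y \<and>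
      fact_le C (seq_comp C (Dom C k) \<sigma>, k) (f, seq_comp C (Cod C f) \<rho>))"
  proof
    assume "inL N f (neg_seq \<rho> P) x"
    then obtain \<sigma> P' e y where "left_block N f (neg_seq \<rho> P) x \<sigma> P' e y" unfolding inL_def by blast
    then have l: "left_block N (cr f \<rho>) P x \<sigma> P' (cr e \<rho>) y"
      and e: "e \<in> Arr C" "Dom C e = bs P'" "Cod C e = bs (neg_seq \<rho> P)" "f = cl \<sigma> e"
      unfolding lb by blast+
    from l have "wff (neg_seq \<sigma> P')" "H P' (cr e \<rho>) P y" by (auto simp: left_block_def)
    from le[OF this] e
    have "fact_le C (seq_comp C (Dom C (cr e \<rho>)) \<sigma>, cr e \<rho>) (f, seq_comp C (Cod C f) \<rho>)" by blast
    with l show "\<exists>\<sigma> P' k y. left_block N (cr f \<rho>) P x \<sigma> P' k y \<and>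
      fact_le C (seq_comp C (Dom C k) \<sigma>, k) (f, seq_comp C (Cod C f) \<rho>)" by blast
  next
    assume "\<exists>\<sigma> P' k y. left_block N (cr f \<rho>) P x \<sigma> P' k y \<and>
      fact_le C (seq_comp C (Dom C k) \<sigma>, k) (f, seq_comp C (Cod C f) \<rho>)"
    then obtain \<sigma> P' k y where l: "left_block N (cr f \<rho>) P x \<sigma> P' k y"
      and k: "fact_le C (seq_comp C (Dom C k) \<sigma>, k) (f, seq_comp C (Cod C f) \<rho>)" by blast
    from l have "wff (neg_seq \<sigma> P')" "H P' k P y" by (auto simp: left_block_def)
    from le[OF this] k l have "\<exists>e. left_block N f (neg_seq \<rho> P) x \<sigma> P' e y" unfolding lb by blast
    then show "inL N f (neg_seq \<rho> P) x" unfolding inL_def by blast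
  qed
  then show ?thesis by (simp add: IR \<pi>)
qed simp

section \<open>Each proof rule characterized by its conclusion, with composites in the form
  \<open>cl\<close> and \<open>cr\<close>\<close>

abbreviation "iproof \<equiv> inv_proof C D p"
abbreviation "fproof \<equiv> foc_proof C D p"

lemma inv_ctyped: "iproof d S f q T \<Longrightarrow> ctyped S f T"
  by (erule inv_proof.cases) (auto simp: formula_over_iff hom_def)

lemma seq_comp_composite:
  assumes "f \<in> Arr C" "Dom C f = bs (pos_seq \<pi> N)" "Cod C f = bs (neg_seq \<rho> P)"
    and w: "wff (pos_seq \<pi> N)" "wff (neg_seq \<rho> P)"
  shows "seq_comp C (Dom C f) \<pi> \<odot> f \<odot> seq_comp C (Cod C f) \<rho> = cl \<pi> (cr f \<rho>)"
proof -
  note p = path_pos_seq[OF w(1)] path_neg_seq[OF w(2)]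
  have "seq_comp C (Dom C f) \<pi> \<odot> f = cl \<pi> f"
    using assms p by (intro base.seq_comp_cl[OF p(1)]) auto
  moreover have "cl \<pi> f \<odot> seq_comp C (Cod C f) \<rho> = cr (cl \<pi> f) \<rho>"
    using assms base.cl_simps[OF p(1)] by (intro base.seq_comp_cr[OF p(2)]) auto
  ultimately show ?thesis
    using base.cr_cl[OF p] assms by simp
qed

lemma inv_proof_iff:
  "iproof d S f q T \<longleftrightarrow> (\<exists>\<pi> \<rho> e N P. d = Inversion \<pi> \<rho> e \<and> S = pos_seq \<pi> N \<and> T = neg_seq \<rho> P \<and>
     \<not> is_pos N \<and> \<not> is_neg P \<and> (q = IL \<longrightarrow> \<rho> = []) \<and> (q = IR \<longrightarrow> \<pi> = []) \<and> ctyped S f T \<and>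
     fproof e N (cl \<pi> (cr f \<rho>)) (next_state q \<pi> f \<rho>) P)"
proof
  assume i: "iproof d S f q T"
  from inv_ctyped[OF i] i show "\<exists>\<pi> \<rho> e N P. d = Inversion \<pi> \<rho> e \<and> S = pos_seq \<pi> N \<and>
      T = neg_seq \<rho> P \<and> \<not> is_pos N \<and> \<not> is_neg P \<and> (q = IL \<longrightarrow> \<rho> = []) \<and> (q = IR \<longrightarrow> \<pi> = []) \<and>
      ctyped S f T \<and> fproof e N (cl \<pi> (cr f \<rho>)) (next_state q \<pi> f \<rho>) P"
    by (elim inv_proof.cases) (metis seq_comp_composite)
next
  assume "\<exists>\<pi> \<rho> e N P. d = Inversion \<pi> \<rho> e \<and> S = pos_seq \<pi> N \<and>
      T = neg_seq \<rho> P \<and> \<not> is_pos N \<and> \<not> is_neg P \<and> (q = IL \<longrightarrow> \<rho> = []) \<and> (q = IR \<longrightarrow> \<pi> = []) \<and>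
      ctyped S f T \<and> fproof e N (cl \<pi> (cr f \<rho>)) (next_state q \<pi> f \<rho>) P"
  then obtain \<pi> \<rho> e N P where i: "d = Inversion \<pi> \<rho> e" "S = pos_seq \<pi> N" "T = neg_seq \<rho> P"
    "\<not> is_pos N" "\<not> is_neg P" "q = IL \<longrightarrow> \<rho> = []" "q = IR \<longrightarrow> \<pi> = []"
    "ctyped (pos_seq \<pi> N) f (neg_seq \<rho> P)" "fproof e N (cl \<pi> (cr f \<rho>)) (next_state q \<pi> f \<rho>) P"
    by blast
  have "fproof e N (seq_comp C (Dom C f) \<pi> \<odot> f \<odot> seq_comp C (Cod C f) \<rho>) (next_state q \<pi> f \<rho>) P"
    using i(8,9) seq_comp_composite[of f \<pi> N \<rho> P] by simp
  from inversion[OF this i(4-7), of "bs S" "bs T"] i(8) show "iproof d S f q T"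
    unfolding i(1-3) by (simp add: formula_over_iff hom_def)
qed

lemma foc_Axiom_iff: "fproof (Axiom d) N h q P \<longleftrightarrow>
    (\<exists>X Y. N = Atom X \<and> P = Atom Y \<and> d \<in> hom D X Y \<and> h = amap p d)"
  by (auto elim: foc_proof.cases intro: axiom)

lemma not_foc_Inversion: "\<not> fproof (Inversion \<pi> \<rho> e) N h q P"
  by (auto elim: foc_proof.cases)

lemma seq_comp_left:
  assumes "wff (neg_seq \<sigma> P)" "g \<in> Arr C" "Dom C g = bs P"
  shows "seq_comp C (Dom C g) \<sigma> \<odot> g = cl \<sigma> g"
  using assms by (intro base.seq_comp_cl[OF path_neg_seq[OF assms(1)]]) auto

lemma seq_comp_right:
  assumes "wff (pos_seq \<tau> M)" "g \<in> Arr C" "Cod C g = bs M"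
  shows "g \<odot> seq_comp C (Cod C g) \<tau> = cr g \<tau>"
  using assms by (intro base.seq_comp_cr[OF path_pos_seq[OF assms(1)]]) auto

lemma foc_LeftFocus_iff: "fproof (LeftFocus \<sigma> g e) N h q Q \<longleftrightarrow>
    (\<exists>P. N = neg_seq \<sigma> P \<and> iproof e P g IL Q \<and> \<not> is_neg P \<and> \<not> is_neg Q \<and> \<sigma> \<noteq> [] \<and> wff N \<and> h = cl \<sigma> g \<and>
      (\<forall>f \<rho>. q = FR f \<rho> \<longrightarrow>
        \<not> fact_le C (seq_comp C (Dom C g) \<sigma>, g) (f, seq_comp C (Cod C f) \<rho>)))"
    (is "?l \<longleftrightarrow> ?r")
proof
  assume ?l then show ?r
    by (cases rule: foc_proof.cases) (use inv_ctyped seq_comp_left in \<open>auto simp: formula_over_iff\<close>)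
next
  assume ?r
  then obtain P where P: "N = neg_seq \<sigma> P" "iproof e P g IL Q" "\<not> is_neg P" "\<not> is_neg Q" "\<sigma> \<noteq> []"
    "wff (neg_seq \<sigma> P)" "h = cl \<sigma> g"
    "\<And>f \<rho>. q = FR f \<rho> \<Longrightarrow> \<not> fact_le C (seq_comp C (Dom C g) \<sigma>, g) (f, seq_comp C (Cod C f) \<rho>)"
    by blast
  have "formula_over C D p (neg_seq \<sigma> P) (bs N)" using P by (simp add: formula_over_iff)
  from left_focus[OF P(2-5) this, of q] P(8) show ?l
    using seq_comp_left[OF P(6)] inv_ctyped[OF P(2)] by (simp add: P(1,7))
qed

lemma foc_RightFocus_iff: "fproof (RightFocus g \<tau> e) N h q P \<longleftrightarrow>
    (\<exists>M. P = pos_seq \<tau> M \<and> iproof e N g IR M \<and> \<not> is_pos N \<and> \<not> is_pos M \<and> \<tau> \<noteq> [] \<and> wff P \<and> h = cr g \<tau> \<and>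
      (\<forall>\<pi> f. q = FL \<pi> f \<longrightarrow>
        \<not> fact_le C (seq_comp C (Dom C f) \<pi>, f) (g, seq_comp C (Cod C g) \<tau>)))"
    (is "?l \<longleftrightarrow> ?r")
proof
  assume ?l then show ?r
    by (cases rule: foc_proof.cases) (use inv_ctyped seq_comp_right in \<open>auto simp: formula_over_iff\<close>)
next
  assume ?r
  then obtain M where P: "P = pos_seq \<tau> M" "iproof e N g IR M" "\<not> is_pos N" "\<not> is_pos M" "\<tau> \<noteq> []"
    "wff (pos_seq \<tau> M)" "h = cr g \<tau>"
    "\<And>\<pi> f. q = FL \<pi> f \<Longrightarrow> \<not> fact_le C (seq_comp C (Dom C f) \<pi>, f) (g, seq_comp C (Cod C g) \<tau>)"
    by blast
  have "formula_over C D p (pos_seq \<tau> M) (bs P)" using P by (simp add: formula_over_iff)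
  from right_focus[OF P(2-5) this, of q] P(8) show ?l
    using seq_comp_right[OF P(6)] inv_ctyped[OF P(2)] by (simp add: P(1,7))
qed

lemma seq_comp_bi:
  assumes w: "wff (neg_seq \<sigma> P)" "wff (pos_seq \<tau> N)" and g: "g \<in> Arr C" "Dom C g = bs P" "Cod C g = bs N"
  shows "seq_comp C (Dom C g) \<sigma> \<odot> g \<odot> seq_comp C (Cod C g) \<tau> = cl \<sigma> (cr g \<tau>)"
proof -
  have "cl \<sigma> g \<odot> seq_comp C (Cod C g) \<tau> = cr (cl \<sigma> g) \<tau>"
    using base.cl_simps[OF path_neg_seq[OF w(1)], of g] g
    by (intro base.seq_comp_cr[OF path_pos_seq[OF w(2)]]) auto
  then show ?thesis
    unfolding seq_comp_left[OF w(1) g(1,2)]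
    using base.cr_cl[OF path_neg_seq[OF w(1)] path_pos_seq[OF w(2)]] g by simp
qed

lemma foc_BiFocus_iff: "fproof (BiFocus \<sigma> g \<tau> e) N h q P \<longleftrightarrow>
    (\<exists>P' M. N = neg_seq \<sigma> P' \<and> P = pos_seq \<tau> M \<and> iproof e P' g IBot M \<and> \<not> is_neg P' \<and> \<not> is_pos M \<and>
      \<sigma> \<noteq> [] \<and> \<tau> \<noteq> [] \<and> wff N \<and> wff P \<and> h = cl \<sigma> (cr g \<tau>) \<and>
      (\<forall>\<pi> f. q = FL \<pi> f \<longrightarrow>
        \<not> fact_le C (seq_comp C (Dom C f) \<pi>, f) (cl \<sigma> g, seq_comp C (Cod C g) \<tau>)) \<and>
      (\<forall>f \<rho>. q = FR f \<rho> \<longrightarrow>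
        \<not> fact_le C (seq_comp C (Dom C g) \<sigma>, cr g \<tau>) (f, seq_comp C (Cod C f) \<rho>)))"
    (is "?l \<longleftrightarrow> ?r")
proof
  assume ?l then show ?r
    by (cases rule: foc_proof.cases)
      (use inv_ctyped seq_comp_bi seq_comp_left seq_comp_right in \<open>auto simp: formula_over_iff\<close>)
next
  assume ?r
  then obtain P' M where P: "N = neg_seq \<sigma> P'" "P = pos_seq \<tau> M" "iproof e P' g IBot M" "\<not> is_neg P'"
    "\<not> is_pos M" "\<sigma> \<noteq> []" "\<tau> \<noteq> []" "wff (neg_seq \<sigma> P')" "wff (pos_seq \<tau> M)" "h = cl \<sigma> (cr g \<tau>)"
    "\<And>\<pi> f. q = FL \<pi> f \<Longrightarrow>
        \<not> fact_le C (seq_comp C (Dom C f) \<pi>, f) (cl \<sigma> g, seq_comp C (Cod C g) \<tau>)"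
    "\<And>f \<rho>. q = FR f \<rho> \<Longrightarrow>
        \<not> fact_le C (seq_comp C (Dom C g) \<sigma>, cr g \<tau>) (f, seq_comp C (Cod C f) \<rho>)"
    by blast
  have o: "formula_over C D p (neg_seq \<sigma> P') (bs N)" "formula_over C D p (pos_seq \<tau> M) (bs P)"
    using P by (simp_all add: formula_over_iff)
  note t = inv_ctyped[OF P(3)]
  from bi_focus[OF P(3-7) o, of q] P(11,12) show ?l
    using seq_comp_left[OF P(8), of g] seq_comp_right[OF P(9), of g] seq_comp_bi[OF P(8,9), of g] t
    by (simp add: P(1,2,10))
qed

text \<open>The last two clauses say which focus rule ends the proof that encodes a given normal form.\<close>

lemma enc_sound:
  "(\<forall>S f q T. iproof d S f q T \<longrightarrow> H S f T (enc d S T) \<and> ok_inv q S f T (enc d S T)) \<and>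
   (\<forall>N h q P. fproof d N h q P \<longrightarrow> \<not> is_pos N \<and> \<not> is_neg P \<and> H N h P (enc d N P) \<and>
      ok_foc q N h P (enc d N P) \<and>
      (inL N h P (enc d N P) \<longleftrightarrow> (\<exists>\<sigma> g e. d = LeftFocus \<sigma> g e) \<or> (\<exists>\<sigma> g \<tau> e. d = BiFocus \<sigma> g \<tau> e)) \<and>
      (inR N h P (enc d N P) \<longleftrightarrow> (\<exists>g \<tau> e. d = RightFocus g \<tau> e) \<or> (\<exists>\<sigma> g \<tau> e. d = BiFocus \<sigma> g \<tau> e)))"
proof (induction d)
  case (Axiom d)
  have "\<not> right_block N h (Atom Y) x \<tau> M m y" for N h Y x \<tau> M m y
    by (cases \<tau> rule: rev_cases) (auto simp: right_block_def)
  moreover have "\<not> left_block (Atom X) h P x \<sigma> M m y" for X h P x \<sigma> M m y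
    by (cases \<sigma>) (auto simp: left_block_def)
  ultimately have "ok_foc q (Atom X) h (Atom Y) x" "\<not> inL (Atom X) h (Atom Y) x"
    "\<not> inR (Atom X) h (Atom Y) x" for q X h Y x
    by (cases q; simp add: inL_def inR_def)+
  then show ?case
    by (auto simp: inv_proof_iff foc_Axiom_iff H_Atom_iff)
next
  case (Inversion \<pi> \<rho> e)
  show ?case
  proof (intro conjI allI impI)
    fix S f q T assume i: "iproof (Inversion \<pi> \<rho> e) S f q T"
    then obtain N P where e: "S = pos_seq \<pi> N" "T = neg_seq \<rho> P"
      "\<not> is_pos N" "\<not> is_neg P" "q = IL \<longrightarrow> \<rho> = []" "q = IR \<longrightarrow> \<pi> = []" "ctyped S f T"
      "fproof e N (cl \<pi> (cr f \<rho>)) (next_state q \<pi> f \<rho>) P"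
      unfolding inv_proof_iff by blast
    have r: "H N (cl \<pi> (cr f \<rho>)) P (enc e N P)"
      "ok_foc (next_state q \<pi> f \<rho>) N (cl \<pi> (cr f \<rho>)) P (enc e N P)"
      using Inversion.IH e(8) by blast+
    have w: "wff (pos_seq \<pi> N)" "wff (neg_seq \<rho> P)" "f \<in> Arr C" "Dom C f = bs (pos_seq \<pi> N)"
      "Cod C f = bs (neg_seq \<rho> P)" using e by simp_all
    have en: "enc (Inversion \<pi> \<rho> e) S T = enc e N P" using e by simp
    have "ctyped (pos_seq \<pi> N) (cr f \<rho>) P"
      using w base.cr_simps[OF path_neg_seq[OF w(2)] w(3)] wff_neg_seqD[OF w(2)] by simp
    then show "H S f T (enc (Inversion \<pi> \<rho> e) S T)"
      unfolding en unfolding e(1,2) H_neg_seq_iff H_pos_seq_iff using r(1) w by simp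
    show "ok_inv q S f T (enc (Inversion \<pi> \<rho> e) S T)"
      unfolding en unfolding e(1,2) using ok_inv_iff_ok_foc[OF w(3-5,1,2) e(3-6)] r(2) by simp
  qed (simp_all add: not_foc_Inversion)
next
  case (LeftFocus \<sigma> g e)
  show ?case
  proof (intro conjI allI impI)
    fix N h q P assume "fproof (LeftFocus \<sigma> g e) N h q P"
    then obtain P' where P: "N = neg_seq \<sigma> P'" "iproof e P' g IL P" "\<not> is_neg P'" "\<not> is_neg P" "\<sigma> \<noteq> []"
      "wff N" "h = cl \<sigma> g"
      and side: "\<And>f \<rho>. q = FR f \<rho> \<Longrightarrow>
        \<not> fact_le C (seq_comp C (Dom C g) \<sigma>, g) (f, seq_comp C (Cod C f) \<rho>)"
      unfolding foc_LeftFocus_iff by blast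
    define y where "y = enc e P' P"
    have "H P' g P y \<and> ok_inv IL P' g P y" unfolding y_def using LeftFocus.IH P(2) by blast
    then have y: "H P' g P y" "\<not> inR P' g P y" by simp_all
    have x: "enc (LeftFocus \<sigma> g e) N P = negLs \<sigma> P g y" using P by (simp add: y_def)
    have L: "left_block N h P (negLs \<sigma> P g y) \<sigma> P' g y"
      using P y by (simp add: left_block_def)
    \<comment> \<open>A right block beside the left one would give a common premise, hence a right
      block in the premise of this left focus, which state L forbids.\<close>
    have R: "\<not> inR N h P (negLs \<sigma> P g y)"
    proof
      assume "inR N h P (negLs \<sigma> P g y)"
      then obtain \<tau> M m z where r: "right_block N h P (negLs \<sigma> P g y) \<tau> M m z" by (auto simp: inR_def)
      from left_right_block[OF L r] r have "inR P' g P y"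
        unfolding inR_def right_block_def by blast
      with y show False by simp
    qed
    show "\<not> is_pos N" "\<not> is_neg P" using P by (simp_all add: is_pos_neg_seq)
    show "H N h P (enc (LeftFocus \<sigma> g e) N P)" unfolding x by (rule left_block_H[OF L])
    show "ok_foc q N h P (enc (LeftFocus \<sigma> g e) N P)"
      unfolding x
    proof (cases q)
      case (FR f \<rho>)
      \<comment> \<open>The left block is unique, so the single side condition of the rule settles
        all blocks quantified over in \<open>ok_foc\<close>.\<close>
      then have "\<not> (\<exists>\<sigma>' P' k z. left_block N h P (negLs \<sigma> P g y) \<sigma>' P' k z \<and>
          fact_le C (seq_comp C (Dom C k) \<sigma>', k) (f, seq_comp C (Cod C f) \<rho>))"
        using side[OF FR] left_block_unique[OF L] by blast
      then show "ok_foc q N h P (negLs \<sigma> P g y)" by (simp add: FR)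
    qed (use R in \<open>auto simp: inR_def\<close>)
    show "inL N h P (enc (LeftFocus \<sigma> g e) N P) \<longleftrightarrow> (\<exists>\<sigma>' g' e'. LeftFocus \<sigma> g e = LeftFocus \<sigma>' g' e') \<or>
        (\<exists>\<sigma>' g' \<tau> e'. LeftFocus \<sigma> g e = BiFocus \<sigma>' g' \<tau> e')"
      unfolding x using L by (auto simp: inL_def)
    show "inR N h P (enc (LeftFocus \<sigma> g e) N P) \<longleftrightarrow> (\<exists>g' \<tau> e'. LeftFocus \<sigma> g e = RightFocus g' \<tau> e') \<or>
        (\<exists>\<sigma>' g' \<tau> e'. LeftFocus \<sigma> g e = BiFocus \<sigma>' g' \<tau> e')"
      unfolding x using R by simp
  qed (simp_all add: inv_proof_iff)
next
  case (RightFocus g \<tau> e)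
  show ?case
  proof (intro conjI allI impI)
    fix N h q P assume "fproof (RightFocus g \<tau> e) N h q P"
    then obtain M where P: "P = pos_seq \<tau> M" "iproof e N g IR M" "\<not> is_pos N" "\<not> is_pos M" "\<tau> \<noteq> []"
      "wff P" "h = cr g \<tau>"
      and side: "\<And>\<pi> f. q = FL \<pi> f \<Longrightarrow>
        \<not> fact_le C (seq_comp C (Dom C f) \<pi>, f) (g, seq_comp C (Cod C g) \<tau>)"
      unfolding foc_RightFocus_iff by blast
    define y where "y = enc e N M"
    have "H N g M y \<and> ok_inv IR N g M y" unfolding y_def using RightFocus.IH P(2) by blast
    then have y: "H N g M y" "\<not> inL N g M y" by simp_all
    have x: "enc (RightFocus g \<tau> e) N P = posRs N \<tau> M g y" using P by (simp add: y_def)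
    have R: "right_block N h P (posRs N \<tau> M g y) \<tau> M g y"
      using P y by (simp add: right_block_def)
    have L: "\<not> inL N h P (posRs N \<tau> M g y)"
    proof
      assume "inL N h P (posRs N \<tau> M g y)"
      then obtain \<sigma> P' m z where l: "left_block N h P (posRs N \<tau> M g y) \<sigma> P' m z" by (auto simp: inL_def)
      from left_right_block[OF l R] l have "inL N g M y"
        unfolding inL_def left_block_def by blast
      with y show False by simp
    qed
    show "\<not> is_pos N" "\<not> is_neg P" using P by (simp_all add: is_neg_pos_seq)
    show "H N h P (enc (RightFocus g \<tau> e) N P)" unfolding x by (rule right_block_H[OF R])
    show "ok_foc q N h P (enc (RightFocus g \<tau> e) N P)"
      unfolding x
    proof (cases q)
      case (FL \<pi> f)
      then have "\<not> (\<exists>\<tau>' M' m z. right_block N h P (posRs N \<tau> M g y) \<tau>' M' m z \<and>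
          fact_le C (seq_comp C (Dom C f) \<pi>, f) (m, seq_comp C (Cod C m) \<tau>'))"
        using side[OF FL] right_block_unique[OF R] by blast
      then show "ok_foc q N h P (posRs N \<tau> M g y)" by (simp add: FL)
    qed (use L in \<open>auto simp: inL_def\<close>)
    show "inL N h P (enc (RightFocus g \<tau> e) N P) \<longleftrightarrow> (\<exists>\<sigma>' g' e'. RightFocus g \<tau> e = LeftFocus \<sigma>' g' e') \<or>
        (\<exists>\<sigma>' g' \<tau>' e'. RightFocus g \<tau> e = BiFocus \<sigma>' g' \<tau>' e')"
      unfolding x using L by simp
    show "inR N h P (enc (RightFocus g \<tau> e) N P) \<longleftrightarrow> (\<exists>g' \<tau>' e'. RightFocus g \<tau> e = RightFocus g' \<tau>' e') \<or>
        (\<exists>\<sigma>' g' \<tau>' e'. RightFocus g \<tau> e = BiFocus \<sigma>' g' \<tau>' e')"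
      unfolding x using R by (auto simp: inR_def)
  qed (simp_all add: inv_proof_iff)
next
  case (BiFocus \<sigma> g \<tau> e)
  show ?case
  proof (intro conjI allI impI)
    fix N h q P assume "fproof (BiFocus \<sigma> g \<tau> e) N h q P"
    then obtain P' M where P: "N = neg_seq \<sigma> P'" "P = pos_seq \<tau> M" "iproof e P' g IBot M" "\<not> is_neg P'"
      "\<not> is_pos M" "\<sigma> \<noteq> []" "\<tau> \<noteq> []" "wff (neg_seq \<sigma> P')" "wff (pos_seq \<tau> M)" "h = cl \<sigma> (cr g \<tau>)"
      and side: "\<And>\<pi> f. q = FL \<pi> f \<Longrightarrow>
        \<not> fact_le C (seq_comp C (Dom C f) \<pi>, f) (cl \<sigma> g, seq_comp C (Cod C g) \<tau>)"
        "\<And>f \<rho>. q = FR f \<rho> \<Longrightarrow>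
        \<not> fact_le C (seq_comp C (Dom C g) \<sigma>, cr g \<tau>) (f, seq_comp C (Cod C f) \<rho>)"
      unfolding foc_BiFocus_iff by blast
    define z where "z = enc e P' M"
    have z: "H P' g M z" unfolding z_def using BiFocus.IH P(3) by blast
    note t = H_typed[OF z]
    \<comment> \<open>\<open>ok_foc\<close> names the identity of an empty sequence by the arrow of
      a block's premise, the rule by the arrow g; their relevant end objects coincide.\<close>
    have Cd: "Cod C (cl \<sigma> g) = Cod C g" "Dom C (cr g \<tau>) = Dom C g"
      using base.cl_simps[OF path_neg_seq[OF P(8)], of g] base.cr_simps[OF path_pos_seq[OF P(9)], of g] t
      by simp_all
    let ?x = "enc (BiFocus \<sigma> g \<tau> e) N P"
    have x: "?x = negLs \<sigma> (pos_seq \<tau> M) (cr g \<tau>) (posRs P' \<tau> M g z)" using P by (simp add: z_def)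
    have L: "left_block N h P ?x \<sigma> P' (cr g \<tau>) (posRs P' \<tau> M g z)"
      and R: "right_block N h P ?x \<tau> M (cl \<sigma> g) (negLs \<sigma> M g z)"
      unfolding x unfolding P(1,2,10) using bi_block[OF z P(8,9,6,7,4,5)] by simp_all
    show "\<not> is_pos N" "\<not> is_neg P" using P by (simp_all add: is_neg_pos_seq is_pos_neg_seq)
    show "H N h P ?x" by (rule left_block_H[OF L])
    show "ok_foc q N h P ?x"
    proof (cases q)
      case (FL \<pi> f)
      then have "\<not> (\<exists>\<tau>' M' m y. right_block N h P ?x \<tau>' M' m y \<and>
          fact_le C (seq_comp C (Dom C f) \<pi>, f) (m, seq_comp C (Cod C m) \<tau>'))"
        using side(1)[OF FL, folded Cd(1)] right_block_unique[OF R] by blast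
      then show ?thesis by (simp add: FL)
    next
      case (FR f \<rho>)
      then have "\<not> (\<exists>\<sigma>' P' k y. left_block N h P ?x \<sigma>' P' k y \<and>
          fact_le C (seq_comp C (Dom C k) \<sigma>', k) (f, seq_comp C (Cod C f) \<rho>))"
        using side(2)[OF FR, folded Cd(2)] left_block_unique[OF L] by blast
      then show ?thesis by (simp add: FR)
    qed simp
    show "inL N h P ?x \<longleftrightarrow> (\<exists>\<sigma>' g' e'. BiFocus \<sigma> g \<tau> e = LeftFocus \<sigma>' g' e') \<or>
        (\<exists>\<sigma>' g' \<tau>' e'. BiFocus \<sigma> g \<tau> e = BiFocus \<sigma>' g' \<tau>' e')"
      using L unfolding inL_def by blast
    show "inR N h P ?x \<longleftrightarrow> (\<exists>g' \<tau>' e'. BiFocus \<sigma> g \<tau> e = RightFocus g' \<tau>' e') \<or>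
        (\<exists>\<sigma>' g' \<tau>' e'. BiFocus \<sigma> g \<tau> e = BiFocus \<sigma>' g' \<tau>' e')"
      using R unfolding inR_def by blast
  qed (simp_all add: inv_proof_iff)
qed

section \<open>The encoding is a bijection onto normal forms\<close>

lemma enc_sound_inv:
  assumes "iproof d S f q T"
  shows "H S f T (enc d S T)" "ok_inv q S f T (enc d S T)"
  using enc_sound[of d] assms by blast+

lemma enc_sound_foc:
  assumes "fproof d N h q P"
  shows "inL N h P (enc d N P) \<longleftrightarrow> (\<exists>\<sigma> g e. d = LeftFocus \<sigma> g e) \<or> (\<exists>\<sigma> g \<tau> e. d = BiFocus \<sigma> g \<tau> e)"
    and "inR N h P (enc d N P) \<longleftrightarrow> (\<exists>g \<tau> e. d = RightFocus g \<tau> e) \<or> (\<exists>\<sigma> g \<tau> e. d = BiFocus \<sigma> g \<tau> e)"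
  using enc_sound[of d] assms by blast+

text \<open>The last focus rule is read off the common normal form through \<open>inL\<close> and
  \<open>inR\<close>. The end sequent fixes the blocks, and injectivity of block introduction fixes
  the base arrow and the normal form of the premise.\<close>

lemma enc_injective:
  "(\<forall>S f q T d' q'. iproof d S f q T \<longrightarrow> iproof d' S f q' T \<longrightarrow> enc d S T = enc d' S T \<longrightarrow> d = d') \<and>
   (\<forall>N h q P d' q'. fproof d N h q P \<longrightarrow> fproof d' N h q' P \<longrightarrow> enc d N P = enc d' N P \<longrightarrow> d = d')"
proof (induction d)
  case (Axiom d)
  have "Axiom d = d'" if a: "fproof (Axiom d) N h q P" "fproof d' N h q' P" "enc (Axiom d) N P = enc d' N P"
    for N h q P d' q'
  proof -
    obtain d'' where "d' = Axiom d''"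
      using a enc_sound_foc[OF a(1)] enc_sound_foc[OF a(2)] not_foc_Inversion by (cases d') auto
    then show ?thesis using a by simp
  qed
  then show ?case by (auto simp: inv_proof_iff)
next
  case (Inversion \<pi> \<rho> e)
  have "Inversion \<pi> \<rho> e = d'" if a: "iproof (Inversion \<pi> \<rho> e) S f q T" "iproof d' S f q' T"
    "enc (Inversion \<pi> \<rho> e) S T = enc d' S T" for S f q T d' q'
  proof -
    obtain N P where e: "S = pos_seq \<pi> N" "T = neg_seq \<rho> P" "\<not> is_pos N" "\<not> is_neg P"
      "fproof e N (cl \<pi> (cr f \<rho>)) (next_state q \<pi> f \<rho>) P"
      using a(1) unfolding inv_proof_iff by blast
    obtain \<pi>' \<rho>' e' N' P' where e': "d' = Inversion \<pi>' \<rho>' e'" "S = pos_seq \<pi>' N'" "T = neg_seq \<rho>' P'"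
      "\<not> is_pos N'" "\<not> is_neg P'" "fproof e' N' (cl \<pi>' (cr f \<rho>')) (next_state q' \<pi>' f \<rho>') P'"
      using a(2) unfolding inv_proof_iff by blast
    have [simp]: "\<pi>' = \<pi>" "N' = N" "\<rho>' = \<rho>" "P' = P"
      using pos_seq_eqD[of \<pi> N \<pi>' N'] neg_seq_eqD[of \<rho> P \<rho>' P'] e e' by simp_all
    have "enc e N P = enc e' N P" using a(3) e e'(1) by simp
    then have "e = e'" using Inversion.IH e(5) e'(6) by simp blast
    then show ?thesis using e'(1) by simp
  qed
  then show ?case using not_foc_Inversion by blast
next
  case (LeftFocus \<sigma> g e)
  have "LeftFocus \<sigma> g e = d'" if a: "fproof (LeftFocus \<sigma> g e) N h q P" "fproof d' N h q' P"
    "enc (LeftFocus \<sigma> g e) N P = enc d' N P" for N h q P d' q'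
  proof -
    obtain \<sigma>' g' e' where d': "d' = LeftFocus \<sigma>' g' e'"
      using enc_sound_foc[OF a(1)] enc_sound_foc[OF a(2)] a(3) by auto
    obtain P' where P: "N = neg_seq \<sigma> P'" "iproof e P' g IL P" "\<not> is_neg P'" "\<sigma> \<noteq> []" "wff N" "h = cl \<sigma> g"
      using a(1) unfolding foc_LeftFocus_iff by blast
    obtain P'' where P': "N = neg_seq \<sigma>' P''" "iproof e' P'' g' IL P" "\<not> is_neg P''" "h = cl \<sigma>' g'"
      using a(2) unfolding d' foc_LeftFocus_iff by blast
    have [simp]: "\<sigma>' = \<sigma>" "P'' = P'" using neg_seq_eqD[of \<sigma> P' \<sigma>' P''] P P' by simp_all
    have "g = g' \<and> enc e P' P = enc e' P' P"
      using negLs_inject[OF enc_sound_inv(1)[OF P(2)] enc_sound_inv(1)[OF P'(2)[simplified]], of \<sigma>]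
        a(3) P P' by (simp add: d')
    then show ?thesis using LeftFocus.IH P(2) P'(2) d' by simp blast
  qed
  then show ?case by (auto simp: inv_proof_iff)
next
  case (RightFocus g \<tau> e)
  have "RightFocus g \<tau> e = d'" if a: "fproof (RightFocus g \<tau> e) N h q P" "fproof d' N h q' P"
    "enc (RightFocus g \<tau> e) N P = enc d' N P" for N h q P d' q'
  proof -
    obtain g' \<tau>' e' where d': "d' = RightFocus g' \<tau>' e'"
      using enc_sound_foc[OF a(1)] enc_sound_foc[OF a(2)] a(3) by auto
    obtain M where P: "P = pos_seq \<tau> M" "iproof e N g IR M" "\<not> is_pos M" "\<tau> \<noteq> []" "wff P" "h = cr g \<tau>"
      using a(1) unfolding foc_RightFocus_iff by blast
    obtain M' where P': "P = pos_seq \<tau>' M'" "iproof e' N g' IR M'" "\<not> is_pos M'" "h = cr g' \<tau>'"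
      using a(2) unfolding d' foc_RightFocus_iff by blast
    have [simp]: "\<tau>' = \<tau>" "M' = M" using pos_seq_eqD[of \<tau> M \<tau>' M'] P P' by simp_all
    have "g = g' \<and> enc e N M = enc e' N M"
      using posRs_inject[OF enc_sound_inv(1)[OF P(2)] enc_sound_inv(1)[OF P'(2)[simplified]], of \<tau>]
        a(3) P P' by (simp add: d')
    then show ?thesis using RightFocus.IH P(2) P'(2) d' by simp blast
  qed
  then show ?case by (auto simp: inv_proof_iff)
next
  case (BiFocus \<sigma> g \<tau> e)
  have "BiFocus \<sigma> g \<tau> e = d'" if a: "fproof (BiFocus \<sigma> g \<tau> e) N h q P" "fproof d' N h q' P"
    "enc (BiFocus \<sigma> g \<tau> e) N P = enc d' N P" for N h q P d' q'
  proof -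
    obtain \<sigma>' g' \<tau>' e' where d': "d' = BiFocus \<sigma>' g' \<tau>' e'"
      using enc_sound_foc[OF a(1)] enc_sound_foc[OF a(2)] a(3) by auto
    obtain P' M where P: "N = neg_seq \<sigma> P'" "P = pos_seq \<tau> M" "iproof e P' g IBot M" "\<not> is_neg P'"
      "\<not> is_pos M" "wff (neg_seq \<sigma> P')" "wff (pos_seq \<tau> M)" "h = cl \<sigma> (cr g \<tau>)"
      using a(1) unfolding foc_BiFocus_iff by blast
    obtain P'' M' where P': "N = neg_seq \<sigma>' P''" "P = pos_seq \<tau>' M'" "iproof e' P'' g' IBot M'"
      "\<not> is_neg P''" "\<not> is_pos M'" "h = cl \<sigma>' (cr g' \<tau>')"
      using a(2) unfolding d' foc_BiFocus_iff by blast
    have [simp]: "\<sigma>' = \<sigma>" "P'' = P'" "\<tau>' = \<tau>" "M' = M"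
      using neg_seq_eqD[of \<sigma> P' \<sigma>' P''] pos_seq_eqD[of \<tau> M \<tau>' M'] P P' by simp_all
    have z: "H P' g M (enc e P' M)" "H P' g' M (enc e' P' M)"
      using enc_sound_inv(1)[OF P(3)] enc_sound_inv(1)[OF P'(3)] by simp_all
    have "cr g \<tau> = cr g' \<tau> \<and> posRs P' \<tau> M g (enc e P' M) = posRs P' \<tau> M g' (enc e' P' M)"
      by (rule negLs_inject[OF H_posRs[OF z(1) P(7)] H_posRs[OF z(2) P(7)] P(6)])
        (use a(3) P P' in \<open>simp_all add: d'\<close>)
    then have "g = g' \<and> enc e P' M = enc e' P' M"
      using posRs_inject[OF z P(7)] by blast
    then show ?thesis using BiFocus.IH P(3) P'(3) d' by simp blast
  qed
  then show ?case by (auto simp: inv_proof_iff)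
qed

text \<open>After the maximal inversions the blocks present dictate the focus rule. The polarity
  assumptions on S and T mirror the requirement that \<rho>, respectively \<pi>, be empty in the
  states L and R.\<close>

lemma enc_surjective:
  "\<lbrakk>H S f T x; ok_inv q S f T x; q = IL \<longrightarrow> \<not> is_neg T; q = IR \<longrightarrow> \<not> is_pos S\<rbrakk>
    \<Longrightarrow> \<exists>d. iproof d S f q T \<and> enc d S T = x"
proof (induction "size S + size T" arbitrary: S f T x q rule: less_induct)
  case less
  obtain \<pi> N where S: "S = pos_seq \<pi> N" "\<not> is_pos N" by (rule pos_seq_exhaust)
  obtain \<rho> P where T: "T = neg_seq \<rho> P" "\<not> is_neg P" by (rule neg_seq_exhaust)
  have q: "q = IL \<longrightarrow> \<rho> = []" "q = IR \<longrightarrow> \<pi> = []" using less.prems(3,4) S T by simp_all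
  note t = H_typed[OF less.prems(1)]
  have w: "f \<in> Arr C" "Dom C f = bs (pos_seq \<pi> N)" "Cod C f = bs (neg_seq \<rho> P)" "wff (pos_seq \<pi> N)"
    "wff (neg_seq \<rho> P)" using t S T by simp_all
  let ?h = "cl \<pi> (cr f \<rho>)" and ?q = "next_state q \<pi> f \<rho>"
  have x: "H N ?h P x"
    using less.prems(1) unfolding S(1) T(1) H_neg_seq_iff H_pos_seq_iff by blast
  have ok: "ok_foc ?q N ?h P x"
    using less.prems(2) ok_inv_iff_ok_foc[OF w S(2) T(2) q] by (simp add: S T)
  \<comment> \<open>Inversion never enlarges the formulas, and every focus removes a non-empty
    block, so premises of focus rules are strictly smaller.\<close>
  have IH: "\<exists>d. iproof d S' f' q' T' \<and> enc d S' T' = x'"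
    if "size S' + size T' < size N + size P" "H S' f' T' x'" "ok_inv q' S' f' T' x'"
      "q' = IL \<longrightarrow> \<not> is_neg T'" "q' = IR \<longrightarrow> \<not> is_pos S'" for S' f' T' x' q'
    using that by (intro less.hyps) (simp_all add: S T size_pos_seq size_neg_seq)
  have "\<exists>d. fproof d N ?h ?q P \<and> enc d N P = x"
  proof -
    \<comment> \<open>The first two non-atomic cases exclude the other block, which is what the
      states L and R demand of the premise; with both blocks present only bi-focus is
      possible.\<close>
    consider (A) X Y where "N = Atom X" "P = Atom Y" | (L) "inL N ?h P x" "\<not> inR N ?h P x"
      | (R) "\<not> inL N ?h P x" "inR N ?h P x" | (B) "inL N ?h P x" "inR N ?h P x"
      using block_cases[OF x S(2) T(2)] by blast
    then show ?thesis
    proof cases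
      case A
      then show ?thesis
        using x by (auto simp: H_Atom_iff intro!: exI[of _ "Axiom _"] simp: foc_Axiom_iff)
    next
      case L
      then obtain \<sigma> P' k y where l: "left_block N ?h P x \<sigma> P' k y" by (auto simp: inL_def)
      then have \<sigma>: "\<sigma> \<noteq> []" "N = neg_seq \<sigma> P'" "\<not> is_neg P'" "H P' k P y" "wff N" "?h = cl \<sigma> k"
        "x = negLs \<sigma> P k y" unfolding left_block_def by blast+
      have "\<not> inR P' k P y"
        using L(2) inR_negLs[of P' k P y \<sigma>] \<sigma> by auto
      then obtain d where d: "iproof d P' k IL P" "enc d P' P = y"
        using IH[of P' P k y IL] \<sigma> T(2) by (auto simp: size_neg_seq)
      have "\<forall>f' \<rho>'. ?q = FR f' \<rho>' \<longrightarrow>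
          \<not> fact_le C (seq_comp C (Dom C k) \<sigma>, k) (f', seq_comp C (Cod C f') \<rho>')"
      proof (intro allI impI)
        fix f' \<rho>' assume "?q = FR f' \<rho>'"
        with ok have "ok_foc (FR f' \<rho>') N ?h P x" by simp
        with l show "\<not> fact_le C (seq_comp C (Dom C k) \<sigma>, k) (f', seq_comp C (Cod C f') \<rho>')"
          unfolding ok_foc.simps by blast
      qed
      then have "fproof (LeftFocus \<sigma> k d) N ?h ?q P"
        unfolding foc_LeftFocus_iff using \<sigma> d(1) T(2) by blast
      moreover have "enc (LeftFocus \<sigma> k d) N P = x" using \<sigma> d by simp
      ultimately show ?thesis by blast
    next
      case R
      then obtain \<tau> M m y where r: "right_block N ?h P x \<tau> M m y" by (auto simp: inR_def)
      then have \<tau>: "\<tau> \<noteq> []" "P = pos_seq \<tau> M" "\<not> is_pos M" "H N m M y" "wff P" "?h = cr m \<tau>"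
        "x = posRs N \<tau> M m y" unfolding right_block_def by blast+
      have "\<not> inL N m M y"
        using R(1) inL_posRs[of N m M y \<tau>] \<tau> by auto
      then obtain d where d: "iproof d N m IR M" "enc d N M = y"
        using IH[of N M m y IR] \<tau> S(2) by (auto simp: size_pos_seq)
      have "\<forall>\<pi>' f'. ?q = FL \<pi>' f' \<longrightarrow>
          \<not> fact_le C (seq_comp C (Dom C f') \<pi>', f') (m, seq_comp C (Cod C m) \<tau>)"
      proof (intro allI impI)
        fix \<pi>' f' assume "?q = FL \<pi>' f'"
        with ok have "ok_foc (FL \<pi>' f') N ?h P x" by simp
        with r show "\<not> fact_le C (seq_comp C (Dom C f') \<pi>', f') (m, seq_comp C (Cod C m) \<tau>)"
          unfolding ok_foc.simps by blast
      qed
      then have "fproof (RightFocus m \<tau> d) N ?h ?q P"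
        unfolding foc_RightFocus_iff using \<tau> d(1) S(2) by blast
      moreover have "enc (RightFocus m \<tau> d) N P = x" using \<tau> d by simp
      ultimately show ?thesis by blast
    next
      case B
      obtain \<sigma> P' k y where l: "left_block N ?h P x \<sigma> P' k y" using B(1) by (auto simp: inL_def)
      obtain \<tau> M m y' where r: "right_block N ?h P x \<tau> M m y'" using B(2) by (auto simp: inR_def)
      obtain e z where z: "H P' e M z" "k = cr e \<tau>" "m = cl \<sigma> e" "y = posRs P' \<tau> M e z"
        using left_right_block[OF l r] by blast
      have \<sigma>: "\<sigma> \<noteq> []" "N = neg_seq \<sigma> P'" "\<not> is_neg P'" "wff N" "?h = cl \<sigma> k" "x = negLs \<sigma> P k y"
        and \<tau>: "\<tau> \<noteq> []" "P = pos_seq \<tau> M" "\<not> is_pos M" "wff P"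
        using l r unfolding left_block_def right_block_def by blast+
      obtain d where d: "iproof d P' e IBot M" "enc d P' M = z"
        using IH[of P' M e z IBot] \<sigma>(1,2) \<tau>(1,2) z(1) by (auto simp: size_pos_seq size_neg_seq)
      note te = H_typed[OF z(1)]
      have Cd: "Cod C m = Cod C e" "Dom C k = Dom C e"
        using base.cl_simps[OF path_neg_seq, of \<sigma> P' e] base.cr_simps[OF path_pos_seq, of \<tau> M e]
          te \<sigma> \<tau> z by simp_all
      have "\<forall>\<pi>' f'. ?q = FL \<pi>' f' \<longrightarrow>
          \<not> fact_le C (seq_comp C (Dom C f') \<pi>', f') (cl \<sigma> e, seq_comp C (Cod C e) \<tau>)"
      proof (intro allI impI)
        fix \<pi>' f' assume "?q = FL \<pi>' f'"
        with ok have "ok_foc (FL \<pi>' f') N ?h P x" by simp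
        with r show "\<not> fact_le C (seq_comp C (Dom C f') \<pi>', f') (cl \<sigma> e, seq_comp C (Cod C e) \<tau>)"
          unfolding ok_foc.simps z(3)[symmetric] Cd(1)[symmetric] by blast
      qed
      moreover have "\<forall>f' \<rho>'. ?q = FR f' \<rho>' \<longrightarrow>
          \<not> fact_le C (seq_comp C (Dom C e) \<sigma>, cr e \<tau>) (f', seq_comp C (Cod C f') \<rho>')"
      proof (intro allI impI)
        fix f' \<rho>' assume "?q = FR f' \<rho>'"
        with ok have "ok_foc (FR f' \<rho>') N ?h P x" by simp
        with l show "\<not> fact_le C (seq_comp C (Dom C e) \<sigma>, cr e \<tau>) (f', seq_comp C (Cod C f') \<rho>')"
          unfolding ok_foc.simps z(2)[symmetric] Cd(2)[symmetric] by blast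
      qed
      ultimately have "fproof (BiFocus \<sigma> e \<tau> d) N ?h ?q P"
        unfolding foc_BiFocus_iff using \<sigma> \<tau> d z by blast
      moreover have "enc (BiFocus \<sigma> e \<tau> d) N P = x" using \<sigma> \<tau> d z by simp
      ultimately show ?thesis by blast
    qed
  qed
  then obtain d where d: "fproof d N ?h ?q P" "enc d N P = x" by blast
  have "iproof (Inversion \<pi> \<rho> d) S f q T"
    unfolding inv_proof_iff using d S T q t by blast
  moreover have "enc (Inversion \<pi> \<rho> d) S T = x" using d S T by simp
  ultimately show ?case by blast
qed

lemma enc_bij: "bij_betw (\<lambda>d. enc d S T) {d. iproof d S f IBot T} {x. \<exists>a. J S f T x a}"
  unfolding H_def[symmetric]
proof (rule bij_betw_imageI)
  show "inj_on (\<lambda>d. enc d S T) {d. iproof d S f IBot T}"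
    using enc_injective unfolding inj_on_def by blast
  show "(\<lambda>d. enc d S T) ` {d. iproof d S f IBot T} = {x. H S f T x}"
    using enc_sound_inv(1) enc_surjective[of S f T _ IBot] by (auto simp: image_iff) metis
qed

end


theorem corollary3p25:
  fixes C :: "('co, 'ca) cat" and D :: "('do, 'da) cat"
    and p :: "('do, 'da, 'co, 'ca) fmap"
    and Bif :: "('u, 'u, 'co, 'ca) bifib" and \<eta> :: "('do, 'da, 'u, 'u) fmap"
    and S T :: "('do, 'ca) formula" and A B :: 'co and f :: 'ca
  assumes "category C" and "category D" and "is_functor D C p"
    and "factorization_preordered C"
    and universe: "infinite (UNIV :: 'u set)"
      "Arr C \<lesssim> (UNIV :: 'u set)" "Arr D \<lesssim> (UNIV :: 'u set)"
    and "free_bifibration C D p Bif \<eta>"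
    and "formula_over C D p S A" and "formula_over C D p T B" and "f \<in> hom C A B"
  shows "\<exists>\<phi>. bij_betw \<phi>
           {\<alpha> \<in> hom (Tot Bif) (formula_obj Bif \<eta> S) (formula_obj Bif \<eta> T). amap (Proj Bif) \<alpha> = f}
           {d. inv_proof C D p d S f IBot T}"
proof -
  note nf = free_bifibration_normal_forms[OF assms(1-8)]
  interpret formulas C Bif D p \<eta> by (rule nf(1))
  obtain \<phi> where "bij_betw \<phi>
      {\<alpha> \<in> hom (Tot Bif) (formula_obj Bif \<eta> S) (formula_obj Bif \<eta> T). amap (Proj Bif) \<alpha> = f}
      {x. \<exists>a. J S f T x a}"
    using nf(2)[OF assms(9-11)] by blast
  from bij_betw_trans[OF this bij_betw_inv_into[OF enc_bij]] show ?thesis by blast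
qed

end
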